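(* Let $(E,\omega)$ be an integer-valued valuated matroid of rank $n$ and let $\mathcal L(\omega):=\mathcal T(\omega)\cap\mathbb Z^E$, ordered by the vector order $\le$. Then $\mathcal L(\omega)$ is a uniform semimodular lattice of uniform-rank $n$, and: (1) the ascending operator is $x\mapsto x+\mathbf 1$; (2) $x\mapsto\max_{B\in\mathcal B}(\omega+x)(B)$ is a height function; (3) $x\wedge y=\min(x,y)$ (componentwise) and $x\vee y=\bigwedge\{z\in\mathcal L(\omega): x\le z\ge y\}$ for $x,y\in\mathcal L(\omega)$; (4) for every $x\in\mathcal L(\omega)$, the valuated matroid $(E^{\mathcal L(\omega)},\omega^{\mathcal L(\omega),x})$ is a completion of a valuated matroid projectively equivalent to $(E,\omega)$.
   Context: Matroids may have infinite ground set but finite rank; $\mathcal B$ is the base family of the underlying matroid of $\omega$. A valuated matroid on $(E,\mathcal B)$ of rank $n$ is $\omega:\mathcal B\to\mathbb R$ such that for $B,B'\in\mathcal B$ and $e\in B\setminus B'$ there is $e'\in B'\setminus B$ with $\omega(B)+\omega(B')\le\omega(B+e'-e)+\omega(B'+e-e')$. It is simple if the matroid has no loops and no parallel pairs; a simplification is the restriction to a set containing exactly one element of each parallel class of non-loops. For $x\in\mathbb R^E$, $(\omega+x)(B):=\omega(B)+\sum_{e\in B}x(e)$; $\omega,\omega'$ are projectively equivalent if $\omega'=\omega+x$ for some $x\in\mathbb R^E$. $\mathcal B_{\omega+x}$ is the set of maximizers of $\omega+x$ over $\mathcal B$, and $\mathcal T(\omega):=\{x\in\mathbb R^E:$ the maximum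 is attained and every $e\in E$ lies in some member of $\mathcal B_{\omega+x}\}$. $\mathbf 1$ is the all-one vector. Tight span $\mathcal{TS}(\omega):=\{p: p(e)=\max_{B\ni e}(\omega(B)-\sum_{f\in B\setminus\{e\}}p(f))\ \forall e\}$; for $p\in\mathcal{TS}(\omega)$, $D_p(e,f)=\exp(\max\{\omega(B)-\sum_{g\in B}p(g):\{e,f\}\subseteq B\in\mathcal B\})$ ($e\neq f$), $D_p(e,e)=0$. A simple valuated matroid is complete if $(E,D_p)$ is complete. A completion of a simple $(E,\omega)$ is a complete valuated matroid $(\bar E,\bar\omega)$ of the same rank with $E\subseteq\bar E$ dense and $\omega$ the restriction of $\bar\omega$; a completion of a non-simple one means a completion of a simplification. Lattice notions: lattices satisfy (F) (no infinite chain in any interval); $x\prec_1 y$ means $y$ covers $x$; semimodular: $x\wedge a\prec_1 a\Rightarrow x\prec_1 x\vee a$; $r[x,y]$ is the common length of maximal chains in $[x,y]$; a height function $r$ satisfies $r(y)=r(x)+1$ when $x\prec_1 y$. Ascending operator $(x)^+:=\bigvee\{y: y\text{ covers }x\}$; a uniform semimodular lattice is a semimodular lattice where $(x)^+$ always exists and $(\cdot)^+$ is an automorphism; uniform-rank is $r[x,(x)^+]$; $(x)^{+k}$ denotes iterates, $r_x(y)=r(y)-r(x)$. Segments: chains $e^0\prec\cdots\prec e^s$ with consecutive covers and $e^{\ell+1}\notin[e^{\ell-1},(e^{\ell-1})^+]$; rays: infinite chains whose initial pieces are segments; $x$-ray: ray starting at $x$. For an $x$-ray $(e^\ell)$ and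 $y\succeq x$, with $\ell$ such that $e^\ell\preceq y\not\succeq e^{\ell+1}$, $(e^\ell)\vee y$ is the $y$-ray $e^\ell\vee y\prec e^{\ell+1}\vee y\prec\cdots$. An $x$-ray and a $y$-ray are parallel if their joins with $x\vee y$ coincide; ends are the parallel classes; $E^{\mathcal L}$ is the set of ends; $e_x$ is the unique $x$-ray in end $e$. $I\subseteq E^{\mathcal L}$ is independent at $x$ if $r_x(\bigvee_{e\in I}e_x^1)=|I|$; $\mathcal B^x$: such sets of size equal to the uniform-rank; $\mathcal B^\infty=\bigcup_x\mathcal B^x$. For $B\in\mathcal B^{x'}$, $\mathcal S(B)$ is the union over $k\in\mathbb Z$ of the $(\cdot)^{+k}$-images of the sublattice generated by the elements of the rays $e_{x'}$, $e\in B$. For $x\in\mathcal L$, $B\in\mathcal B^\infty$: $x_B:=\bigvee\{y\in\mathcal S(B):y\preceq x\}$ and $\omega^{\mathcal L,x}(B):=-r[x_B,x]$, a valuated matroid on $(E^{\mathcal L},\mathcal B^\infty)$. In (4), each $e$ in a simplification of $E$ is identified with the end of $\mathcal L(\omega)$ containing the ray with "$\infty$-direction" its parallel class (rays $(a^\ell)$ with $a^{\ell+1}=a^\ell+\mathbf 1_{F_\ell}$ and $\bigcap_\ell F_\ell$ equal to that class).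
   Formalization: Part (4) is stated for rank n ≥ 1 only: for n = 0 with E empty and ω(∅) ≠ 0 it fails, since the lattice valuation of ∅ is 0 while projective equivalence cannot change ω(∅). *)

theory Defs
  imports "HOL-Analysis.Analysis" "HOL-Algebra.Lattice" "HOL-Library.FuncSet"
begin

text \<open>
  A matroid of finite rank is given by its ground set \<open>E\<close> (possibly infinite) and its base
  family \<open>\<B>\<close>; a valuation is a function \<open>\<omega> :: 'a set \<Rightarrow> real\<close> of which only the values on \<open>\<B>\<close>
  matter. Vectors in \<open>\<real>\<^sup>E\<close> are functions in \<^term>\<open>extensional E\<close>, so that equality of vectors is
  equality of functions.
\<close>

definition matroid_bases :: "nat \<Rightarrow> 'a set \<Rightarrow> 'a set set \<Rightarrow> bool" where
  "matroid_bases n E \<B> \<longleftrightarrow>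
     \<B> \<noteq> {} \<and>
     (\<forall>B\<in>\<B>. B \<subseteq> E \<and> finite B \<and> card B = n) \<and>
     (\<forall>B\<in>\<B>. \<forall>B'\<in>\<B>. \<forall>e\<in>B - B'. \<exists>e'\<in>B' - B. insert e' (B - {e}) \<in> \<B>)"

definition valuated_matroid :: "nat \<Rightarrow> 'a set \<Rightarrow> 'a set set \<Rightarrow> ('a set \<Rightarrow> real) \<Rightarrow> bool" where
  "valuated_matroid n E \<B> \<omega> \<longleftrightarrow>
     matroid_bases n E \<B> \<and>
     (\<forall>B\<in>\<B>. \<forall>B'\<in>\<B>. \<forall>e\<in>B - B'. \<exists>e'\<in>B' - B.
        insert e' (B - {e}) \<in> \<B> \<and> insert e (B' - {e'}) \<in> \<B> \<and>
        \<omega> B + \<omega> B' \<le> \<omega> (insert e' (B - {e})) + \<omega> (insert e (B' - {e'})))"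

definition is_loop :: "'a set set \<Rightarrow> 'a \<Rightarrow> bool" where
  "is_loop \<B> e \<longleftrightarrow> (\<forall>B\<in>\<B>. e \<notin> B)"

definition parallel_class :: "'a set \<Rightarrow> 'a set set \<Rightarrow> 'a \<Rightarrow> 'a set" where
  "parallel_class E \<B> e =
     {f \<in> E. \<not> is_loop \<B> f \<and> (f = e \<or> \<not> (\<exists>B\<in>\<B>. {e, f} \<subseteq> B))}"

definition simple_matroid :: "'a set \<Rightarrow> 'a set set \<Rightarrow> bool" where
  "simple_matroid E \<B> \<longleftrightarrow>
     (\<forall>e\<in>E. \<not> is_loop \<B> e) \<and> (\<forall>e\<in>E. \<forall>f\<in>E. e \<noteq> f \<longrightarrow> (\<exists>B\<in>\<B>. {e, f} \<subseteq> B))"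

definition is_simplification :: "'a set \<Rightarrow> 'a set set \<Rightarrow> 'a set \<Rightarrow> bool" where
  "is_simplification E \<B> E' \<longleftrightarrow>
     E' \<subseteq> {e \<in> E. \<not> is_loop \<B> e} \<and>
     (\<forall>e\<in>E. \<not> is_loop \<B> e \<longrightarrow> (\<exists>!f. f \<in> E' \<and> f \<in> parallel_class E \<B> e))"

definition restrict_bases :: "'a set set \<Rightarrow> 'a set \<Rightarrow> 'a set set" where
  "restrict_bases \<B> E' = {B \<in> \<B>. B \<subseteq> E'}"

definition vm_add :: "('a set \<Rightarrow> real) \<Rightarrow> ('a \<Rightarrow> real) \<Rightarrow> 'a set \<Rightarrow> real" where
  "vm_add \<omega> x B = \<omega> B + (\<Sum>e\<in>B. x e)"

definition projectively_equivalent ::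
    "'a set \<Rightarrow> 'a set set \<Rightarrow> ('a set \<Rightarrow> real) \<Rightarrow> ('a set \<Rightarrow> real) \<Rightarrow> bool" where
  "projectively_equivalent E \<B> \<omega> \<omega>' \<longleftrightarrow> (\<exists>x\<in>extensional E. \<forall>B\<in>\<B>. \<omega>' B = vm_add \<omega> x B)"

definition maximizers :: "'a set set \<Rightarrow> ('a set \<Rightarrow> real) \<Rightarrow> 'a set set" where
  "maximizers \<B> \<omega> = {B \<in> \<B>. \<forall>B'\<in>\<B>. \<omega> B' \<le> \<omega> B}"

definition tropical_space :: "'a set \<Rightarrow> 'a set set \<Rightarrow> ('a set \<Rightarrow> real) \<Rightarrow> ('a \<Rightarrow> real) set" where
  "tropical_space E \<B> \<omega> =
     {x \<in> extensional E. maximizers \<B> (vm_add \<omega> x) \<noteq> {} \<and>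
        (\<forall>e\<in>E. \<exists>B\<in>maximizers \<B> (vm_add \<omega> x). e \<in> B)}"

definition is_maximum :: "real set \<Rightarrow> real \<Rightarrow> bool" where
  "is_maximum S m \<longleftrightarrow> m \<in> S \<and> (\<forall>s\<in>S. s \<le> m)"

definition tight_span :: "'a set \<Rightarrow> 'a set set \<Rightarrow> ('a set \<Rightarrow> real) \<Rightarrow> ('a \<Rightarrow> real) set" where
  "tight_span E \<B> \<omega> =
     {p \<in> extensional E. \<forall>e\<in>E.
        is_maximum ((\<lambda>B. \<omega> B - (\<Sum>f\<in>B - {e}. p f)) ` {B \<in> \<B>. e \<in> B}) (p e)}"

text \<open>
  For distinct \<open>e\<close>, \<open>f\<close> in a common base and \<open>p\<close> in the tight span the maximum is attained. If no
  base contains both \<open>e\<close> and \<open>f\<close>, the maximum is \<open>-\<infinity>\<close> and its exponential is \<open>0\<close>; this does not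
  occur for distinct elements of a simple matroid.
\<close>
definition tight_span_dist ::
    "'a set set \<Rightarrow> ('a set \<Rightarrow> real) \<Rightarrow> ('a \<Rightarrow> real) \<Rightarrow> 'a \<Rightarrow> 'a \<Rightarrow> real" where
  "tight_span_dist \<B> \<omega> p e f =
     (if e = f \<or> \<not> (\<exists>B\<in>\<B>. {e, f} \<subseteq> B) then 0
      else exp (GREATEST m. m \<in> (\<lambda>B. \<omega> B - (\<Sum>g\<in>B. p g)) ` {B \<in> \<B>. {e, f} \<subseteq> B}))"

text \<open>
  Any two members of the tight span differ by a bounded function, so their distances are Lipschitz
  equivalent and neither completeness nor density depends on the choice of \<open>p\<close>.
\<close>
definition complete_valuated_matroid ::
    "nat \<Rightarrow> 'a set \<Rightarrow> 'a set set \<Rightarrow> ('a set \<Rightarrow> real) \<Rightarrow> bool" where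
  "complete_valuated_matroid n E \<B> \<omega> \<longleftrightarrow>
     valuated_matroid n E \<B> \<omega> \<and> simple_matroid E \<B> \<and>
     (\<forall>p\<in>tight_span E \<B> \<omega>.
        Metric_space E (tight_span_dist \<B> \<omega> p) \<and>
        Metric_space.mcomplete E (tight_span_dist \<B> \<omega> p))"

definition dense_in_valuated_matroid ::
    "'a set \<Rightarrow> 'a set set \<Rightarrow> ('a set \<Rightarrow> real) \<Rightarrow> 'a set \<Rightarrow> bool" where
  "dense_in_valuated_matroid E \<B> \<omega> S \<longleftrightarrow>
     S \<subseteq> E \<and>
     (\<forall>p\<in>tight_span E \<B> \<omega>.
        Metric_space.mtopology E (tight_span_dist \<B> \<omega> p) closure_of S = E)"

text \<open>
  The inclusion of the ground set into that of its completion is rendered by an explicit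
  injection \<open>\<phi>\<close>.
\<close>
definition is_completion_of_simple ::
    "nat \<Rightarrow> ('a \<Rightarrow> 'c) \<Rightarrow> 'a set \<Rightarrow> 'a set set \<Rightarrow> ('a set \<Rightarrow> real) \<Rightarrow>
     'c set \<Rightarrow> 'c set set \<Rightarrow> ('c set \<Rightarrow> real) \<Rightarrow> bool" where
  "is_completion_of_simple n \<phi> E \<B> \<omega> E' \<B>' \<omega>' \<longleftrightarrow>
     valuated_matroid n E \<B> \<omega> \<and> simple_matroid E \<B> \<and>
     complete_valuated_matroid n E' \<B>' \<omega>' \<and>
     inj_on \<phi> E \<and> \<phi> ` E \<subseteq> E' \<and>
     dense_in_valuated_matroid E' \<B>' \<omega>' (\<phi> ` E) \<and>
     (\<forall>B. B \<subseteq> E \<longrightarrow> (B \<in> \<B> \<longleftrightarrow> \<phi> ` B \<in> \<B>')) \<and>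
     (\<forall>B\<in>\<B>. \<omega> B = \<omega>' (\<phi> ` B))"

definition is_completion ::
    "nat \<Rightarrow> ('a \<Rightarrow> 'c) \<Rightarrow> 'a set \<Rightarrow> 'a set set \<Rightarrow> ('a set \<Rightarrow> real) \<Rightarrow>
     'c set \<Rightarrow> 'c set set \<Rightarrow> ('c set \<Rightarrow> real) \<Rightarrow> bool" where
  "is_completion n \<phi> E \<B> \<omega> E' \<B>' \<omega>' \<longleftrightarrow>
     (\<exists>E0. is_simplification E \<B> E0 \<and>
        is_completion_of_simple n \<phi> E0 (restrict_bases \<B> E0) \<omega> E' \<B>' \<omega>')"

text \<open>\<open>covers L x y\<close> is read ``\<open>y\<close> covers \<open>x\<close>''.\<close>
definition covers :: "('b, 'm) gorder_scheme \<Rightarrow> 'b \<Rightarrow> 'b \<Rightarrow> bool" where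
  "covers L x y \<longleftrightarrow>
     x \<in> carrier L \<and> y \<in> carrier L \<and> x \<sqsubset>\<^bsub>L\<^esub> y \<and>
     \<not> (\<exists>z\<in>carrier L. x \<sqsubset>\<^bsub>L\<^esub> z \<and> z \<sqsubset>\<^bsub>L\<^esub> y)"

definition finite_chains :: "('b, 'm) gorder_scheme \<Rightarrow> bool" where
  "finite_chains L \<longleftrightarrow>
     (\<forall>x\<in>carrier L. \<forall>y\<in>carrier L. \<forall>C.
        pred_on.chain \<lbrace>x..y\<rbrace>\<^bsub>L\<^esub> (\<sqsubset>\<^bsub>L\<^esub>) C \<longrightarrow> finite C)"

definition semimodular_lattice :: "('b, 'm) gorder_scheme \<Rightarrow> bool" where
  "semimodular_lattice L \<longleftrightarrow>
     lattice L \<and> finite_chains L \<and>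
     (\<forall>x\<in>carrier L. \<forall>a\<in>carrier L.
        covers L (x \<sqinter>\<^bsub>L\<^esub> a) a \<longrightarrow> covers L x (x \<squnion>\<^bsub>L\<^esub> a))"

definition height_function :: "('b, 'm) gorder_scheme \<Rightarrow> ('b \<Rightarrow> real) \<Rightarrow> bool" where
  "height_function L r \<longleftrightarrow>
     (\<forall>x\<in>carrier L. r x \<in> \<int>) \<and> (\<forall>x y. covers L x y \<longrightarrow> r y = r x + 1)"

text \<open>The length of a chain is one less than its number of elements.\<close>
definition interval_rank :: "('b, 'm) gorder_scheme \<Rightarrow> 'b \<Rightarrow> 'b \<Rightarrow> nat" where
  "interval_rank L x y =
     (THE k. \<forall>C. pred_on.maxchain \<lbrace>x..y\<rbrace>\<^bsub>L\<^esub> (\<sqsubset>\<^bsub>L\<^esub>) C \<longrightarrow> finite C \<and> card C = Suc k)"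

definition asc :: "('b, 'm) gorder_scheme \<Rightarrow> 'b \<Rightarrow> 'b" where
  "asc L x = \<Squnion>\<^bsub>L\<^esub>{y. covers L x y}"

definition uniform_semimodular_lattice :: "('b, 'm) gorder_scheme \<Rightarrow> bool" where
  "uniform_semimodular_lattice L \<longleftrightarrow>
     semimodular_lattice L \<and>
     (\<forall>x\<in>carrier L. \<exists>s. least L s (Upper L {y. covers L x y})) \<and>
     bij_betw (asc L) (carrier L) (carrier L) \<and> order_emb L L (asc L)"

definition has_uniform_rank :: "('b, 'm) gorder_scheme \<Rightarrow> nat \<Rightarrow> bool" where
  "has_uniform_rank L n \<longleftrightarrow> (\<forall>x\<in>carrier L. interval_rank L x (asc L x) = n)"

definition asc_pow :: "('b, 'm) gorder_scheme \<Rightarrow> int \<Rightarrow> 'b \<Rightarrow> 'b" where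
  "asc_pow L k =
     (if k \<ge> 0 then asc L ^^ nat k else inv_into (carrier L) (asc L) ^^ nat (- k))"

definition is_segment :: "('b, 'm) gorder_scheme \<Rightarrow> (nat \<Rightarrow> 'b) \<Rightarrow> nat \<Rightarrow> bool" where
  "is_segment L a s \<longleftrightarrow>
     (\<forall>l<s. covers L (a l) (a (Suc l))) \<and>
     (\<forall>l. Suc l < s \<longrightarrow> a (Suc (Suc l)) \<notin> \<lbrace>a l .. asc L (a l)\<rbrace>\<^bsub>L\<^esub>)"

definition rays :: "('b, 'm) gorder_scheme \<Rightarrow> (nat \<Rightarrow> 'b) set" where
  "rays L = {a. \<forall>s. is_segment L a s}"

definition ray_join :: "('b, 'm) gorder_scheme \<Rightarrow> (nat \<Rightarrow> 'b) \<Rightarrow> 'b \<Rightarrow> nat \<Rightarrow> 'b" where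
  "ray_join L a y =
     (let l = (THE l. a l \<sqsubseteq>\<^bsub>L\<^esub> y \<and> \<not> a (Suc l) \<sqsubseteq>\<^bsub>L\<^esub> y) in (\<lambda>k. a (l + k) \<squnion>\<^bsub>L\<^esub> y))"

definition parallel_rays :: "('b, 'm) gorder_scheme \<Rightarrow> ((nat \<Rightarrow> 'b) \<times> (nat \<Rightarrow> 'b)) set" where
  "parallel_rays L =
     {(a, b). a \<in> rays L \<and> b \<in> rays L \<and>
        ray_join L a (a 0 \<squnion>\<^bsub>L\<^esub> b 0) = ray_join L b (a 0 \<squnion>\<^bsub>L\<^esub> b 0)}"

definition ends :: "('b, 'm) gorder_scheme \<Rightarrow> (nat \<Rightarrow> 'b) set set" where
  "ends L = rays L // parallel_rays L"

definition end_ray :: "('b, 'm) gorder_scheme \<Rightarrow> 'b \<Rightarrow> (nat \<Rightarrow> 'b) set \<Rightarrow> nat \<Rightarrow> 'b" where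
  "end_ray L x \<epsilon> = (THE a. a \<in> \<epsilon> \<and> a 0 = x)"

text \<open>
  Inserting \<open>x\<close> does not change the join over a nonempty \<open>I\<close>, and makes the join over \<open>I = {}\<close>
  equal to \<open>x\<close>, so that the empty set is independent at every \<open>x\<close>.
\<close>
definition independent_at :: "('b, 'm) gorder_scheme \<Rightarrow> 'b \<Rightarrow> (nat \<Rightarrow> 'b) set set \<Rightarrow> bool" where
  "independent_at L x I \<longleftrightarrow>
     I \<subseteq> ends L \<and> finite I \<and>
     interval_rank L x (\<Squnion>\<^bsub>L\<^esub>(insert x ((\<lambda>\<epsilon>. end_ray L x \<epsilon> 1) ` I))) = card I"

definition end_bases_at :: "('b, 'm) gorder_scheme \<Rightarrow> 'b \<Rightarrow> (nat \<Rightarrow> 'b) set set set" where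
  "end_bases_at L x = {I. independent_at L x I \<and> has_uniform_rank L (card I)}"

definition end_bases :: "('b, 'm) gorder_scheme \<Rightarrow> (nat \<Rightarrow> 'b) set set set" where
  "end_bases L = (\<Union>x\<in>carrier L. end_bases_at L x)"

definition sublattice :: "('b, 'm) gorder_scheme \<Rightarrow> 'b set \<Rightarrow> bool" where
  "sublattice L S \<longleftrightarrow>
     S \<subseteq> carrier L \<and> (\<forall>x\<in>S. \<forall>y\<in>S. x \<squnion>\<^bsub>L\<^esub> y \<in> S \<and> x \<sqinter>\<^bsub>L\<^esub> y \<in> S)"

definition apartment_from ::
    "('b, 'm) gorder_scheme \<Rightarrow> 'b \<Rightarrow> (nat \<Rightarrow> 'b) set set \<Rightarrow> 'b set" where
  "apartment_from L x B =
     (\<Union>k. asc_pow L k ` (sublattice L hull (\<Union>\<epsilon>\<in>B. range (end_ray L x \<epsilon>))))"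

text \<open>The set does not depend on the point \<open>x\<close> at which \<open>B\<close> is a base.\<close>
definition apartment :: "('b, 'm) gorder_scheme \<Rightarrow> (nat \<Rightarrow> 'b) set set \<Rightarrow> 'b set" where
  "apartment L B = apartment_from L (SOME x. x \<in> carrier L \<and> B \<in> end_bases_at L x) B"

definition lattice_valuation ::
    "('b, 'm) gorder_scheme \<Rightarrow> 'b \<Rightarrow> (nat \<Rightarrow> 'b) set set \<Rightarrow> real" where
  "lattice_valuation L x B =
     - real (interval_rank L (\<Squnion>\<^bsub>L\<^esub>{y \<in> apartment L B. y \<sqsubseteq>\<^bsub>L\<^esub> x}) x)"

text \<open>
  If the matroid has a loop, the tropical linear space, hence the carrier, is empty;
  \<^const>\<open>lattice\<close> does not require a nonempty carrier.
\<close>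
definition vm_lattice :: "'a set \<Rightarrow> 'a set set \<Rightarrow> ('a set \<Rightarrow> real) \<Rightarrow> ('a \<Rightarrow> real) gorder" where
  "vm_lattice E \<B> \<omega> =
     \<lparr>carrier = tropical_space E \<B> \<omega> \<inter> (E \<rightarrow>\<^sub>E \<int>), eq = (=), le = (\<lambda>x y. \<forall>e\<in>E. x e \<le> y e)\<rparr>"

definition has_infinity_direction :: "'a set \<Rightarrow> (nat \<Rightarrow> 'a \<Rightarrow> real) \<Rightarrow> 'a set \<Rightarrow> bool" where
  "has_infinity_direction E a D \<longleftrightarrow>
     (\<exists>F. (\<forall>l. F l \<subseteq> E \<and> (\<forall>e\<in>E. a (Suc l) e = a l e + indicat_real (F l) e)) \<and>
          (\<Inter>l. F l) = D)"

definition end_of_element ::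
    "'a set \<Rightarrow> 'a set set \<Rightarrow> ('a set \<Rightarrow> real) \<Rightarrow> 'a \<Rightarrow> (nat \<Rightarrow> 'a \<Rightarrow> real) set" where
  "end_of_element E \<B> \<omega> e =
     (THE \<epsilon>. \<epsilon> \<in> ends (vm_lattice E \<B> \<omega>) \<and>
        (\<exists>a\<in>\<epsilon>. has_infinity_direction E a (parallel_class E \<B> e)))"

end

theory Submission
  imports Defs
begin

text \<open>
  A point \<open>x\<close> of the tropical linear space is determined by its values on any base that is optimal for
  \<open>\<omega> + x\<close>, and it is below every other point \<open>y\<close> with \<open>x \<le> y\<close> on such a base. Membership in
  the space says that a maximum over the bases inside a set of \<open>n + 1\<close> elements is attained at least
  twice, a condition that is stable under infima; this gives the lattice. Its covers are the vectors
  \<open>x + 1\<^bsub>F\<^esub>\<close> with \<open>F\<close> a rank-one flat of the matroid of maximizers of \<open>\<omega> + x\<close>, and the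
  maximum of \<open>\<omega> + x\<close> grows by one along each of them.

  Along a ray the flats \<open>F\<close> decrease, and the rays from \<open>x\<close> correspond to the decreasing sequences
  of balls of the ultrametric on \<open>E\<close> given by the largest value of \<open>\<omega> + x\<close> on a base containing
  two given elements. So ends are the points of the completion of \<open>E\<close>. Every finite
  question about ends is answered by choosing elements of \<open>E\<close> in sufficiently small balls: a set of
  ends is a base if and only if its representatives form a base of finite value, the element \<open>x\<^sub>B\<close>
  of the apartment is the point that agrees with \<open>x\<close> on the representatives, and hence
  \<open>- r[x\<^sub>B, x]\<close> is the value of \<open>\<omega> + x\<close> on the representatives minus its maximum.
\<close>


text \<open>The passage between ends and elements of \<open>E\<close> rests on one integer gap. Two
  elements in a common ball of index \<open>N\<close> occur together only in bases whose value for
  \<open>\<omega> + x\<close> is at most \<open>r x - (N + 1)\<close>. A base of value at least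
  \<open>r x - N\<close> therefore turns into a base of ends, with the same value up to the constant
  \<open>r x\<close>, when its elements are replaced by ends that have them in their balls of index
  \<open>N\<close>. For the exchange property the values of the two new bases are not known
  beforehand, but each is at most \<open>r x\<close> and their sum is bounded below by the old
  values, so a sufficient \<open>N\<close> can be fixed before representatives are chosen. The
  obstacle is the base point: an apartment is generated at a point picked by \<open>SOME\<close>,
  while the valuation is taken at \<open>x\<close>. Changing the base point shifts the index of
  balls by a bounded amount, which is why statements about ends ask for some precision and then hold
  for every choice of representatives of that precision.\<close>

section \<open>Extrema of integer sets and uniform thresholds\<close>

lemma Ints_less_imp_le: "a \<in> \<int> \<Longrightarrow> b \<in> \<int> \<Longrightarrow> a < b \<Longrightarrow> a + 1 \<le> (b::real)"
  by (elim Ints_cases) (simp add: int_less_real_le)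

lemma Ints_min_ex:
  fixes X :: "real set"
  assumes "X \<subseteq> \<int>" "X \<noteq> {}" "\<And>x. x \<in> X \<Longrightarrow> b \<le> x"
  shows "\<exists>m\<in>X. \<forall>x\<in>X. m \<le> x"
proof -
  obtain x0 where "x0 \<in> X" using assms by blast
  then obtain m where m: "m \<in> X" "\<And>y. y \<in> X \<Longrightarrow> nat (\<lfloor>m\<rfloor> - \<lfloor>b\<rfloor>) \<le> nat (\<lfloor>y\<rfloor> - \<lfloor>b\<rfloor>)"
    using ex_has_least_nat[of "\<lambda>x. x \<in> X" x0 "\<lambda>x. nat (\<lfloor>x\<rfloor> - \<lfloor>b\<rfloor>)"] by blast
  have "m \<le> y" if y: "y \<in> X" for y
  proof -
    have "\<lfloor>b\<rfloor> \<le> \<lfloor>m\<rfloor>" "\<lfloor>b\<rfloor> \<le> \<lfloor>y\<rfloor>" using assms(3) m(1) y by (auto intro: floor_mono)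
    then have "\<lfloor>m\<rfloor> \<le> \<lfloor>y\<rfloor>" using m(2)[OF y] by linarith
    moreover have "m = of_int \<lfloor>m\<rfloor>" "y = of_int \<lfloor>y\<rfloor>" using m(1) y assms(1) by (auto elim!: Ints_cases)
    ultimately show ?thesis by (metis of_int_le_iff)
  qed
  with m(1) show ?thesis by blast
qed

lemma Ints_max_ex:
  fixes X :: "real set"
  assumes "X \<subseteq> \<int>" "X \<noteq> {}" "\<And>x. x \<in> X \<Longrightarrow> x \<le> b"
  shows "\<exists>m\<in>X. \<forall>x\<in>X. x \<le> m"
proof -
  have "\<exists>m\<in>uminus ` X. \<forall>x\<in>uminus ` X. m \<le> x"
    by (rule Ints_min_ex[of _ "-b"]) (use assms in auto)
  then show ?thesis by auto
qed

lemma finite_Ints_segment: "finite {k \<in> \<int>. a \<le> k \<and> k \<le> (b::real)}"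
proof (rule finite_subset)
  show "{k \<in> \<int>. a \<le> k \<and> k \<le> b} \<subseteq> of_int ` {\<lfloor>a\<rfloor>..\<lceil>b\<rceil>}"
  proof
    fix k assume k: "k \<in> {k \<in> \<int>. a \<le> k \<and> k \<le> b}"
    then obtain i where i: "k = of_int i" by (auto elim: Ints_cases)
    have "\<lfloor>a\<rfloor> \<le> i" "i \<le> \<lceil>b\<rceil>" using k i by (auto simp: floor_le_iff le_ceiling_iff)
    then show "k \<in> of_int ` {\<lfloor>a\<rfloor>..\<lceil>b\<rceil>}" using i by auto
  qed
qed simp

lemma finite_nat_bound:
  fixes P :: "'c \<Rightarrow> nat \<Rightarrow> bool"
  assumes "finite I" "\<And>i. i \<in> I \<Longrightarrow> \<exists>k. P i k" "\<And>i k k'. i \<in> I \<Longrightarrow> P i k \<Longrightarrow> k \<le> k' \<Longrightarrow> P i k'"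
  shows "\<exists>k. \<forall>i\<in>I. P i k"
proof -
  obtain f where f: "\<And>i. i \<in> I \<Longrightarrow> P i (f i)" using assms(2) by metis
  have "P i (Max (f ` I))" if "i \<in> I" for i
    by (rule assms(3)[OF that f[OF that]]) (use assms(1) that in auto)
  then show ?thesis by blast
qed

lemma exp_diff_nat_less_ex:
  assumes "0 < (d::real)" obtains N :: nat where "exp (c - real N) < d"
proof -
  obtain N :: nat where "c - ln d < real N" using reals_Archimedean2 by blast
  then have "exp (c - real N) < exp (ln d)" by simp
  with assms that show ?thesis by simp
qed

section \<open>Valuated matroids and tropical linear spaces\<close>

locale valuated =
  fixes n :: nat and E :: "'a set" and \<B> :: "'a set set" and \<omega> :: "'a set \<Rightarrow> real"
  assumes vm: "valuated_matroid n E \<B> \<omega>"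
begin

abbreviation "M x \<equiv> maximizers \<B> (vm_add \<omega> x)"
abbreviation "T \<equiv> tropical_space E \<B> \<omega>"

lemma baseD:
  assumes "B \<in> \<B>" shows "B \<subseteq> E" "finite B" "card B = n"
  using vm assms by (auto simp: valuated_matroid_def matroid_bases_def)

lemma bases_nonempty: "\<B> \<noteq> {}"
  using vm by (auto simp: valuated_matroid_def matroid_bases_def)

lemma sum_swap:
  fixes x :: "'a \<Rightarrow> real"
  assumes "A \<in> \<B>" "f \<in> A" "g \<notin> A"
  shows "sum x (insert g (A - {f})) = sum x A - x f + x g"
  using assms baseD(2)[OF assms(1)] by (simp add: sum_diff1)

lemma vm_add_swap:
  assumes "A \<in> \<B>" "f \<in> A" "g \<notin> A"
  shows "vm_add \<omega> x (insert g (A - {f})) = \<omega> (insert g (A - {f})) + (vm_add \<omega> x A - \<omega> A) - x f + x g"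
  using sum_swap[OF assms] by (simp add: vm_add_def)

lemma exchange:
  assumes "A \<in> \<B>" "B \<in> \<B>" "e \<in> A - B"
  obtains f where "f \<in> B - A" "insert f (A - {e}) \<in> \<B>" "insert e (B - {f}) \<in> \<B>"
    "vm_add \<omega> x A + vm_add \<omega> x B
      \<le> vm_add \<omega> x (insert f (A - {e})) + vm_add \<omega> x (insert e (B - {f}))"
proof -
  obtain f where f: "f \<in> B - A" "insert f (A - {e}) \<in> \<B>" "insert e (B - {f}) \<in> \<B>"
    "\<omega> A + \<omega> B \<le> \<omega> (insert f (A - {e})) + \<omega> (insert e (B - {f}))"
    using vm assms unfolding valuated_matroid_def by blast
  have "vm_add \<omega> x A + vm_add \<omega> x B
      \<le> vm_add \<omega> x (insert f (A - {e})) + vm_add \<omega> x (insert e (B - {f}))"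
    using f vm_add_swap[of A e f x] vm_add_swap[of B f e x] assms by auto
  with f that show ?thesis by blast
qed

lemma maximizersD: "A \<in> M x \<Longrightarrow> A \<in> \<B>" "A \<in> M x \<Longrightarrow> B \<in> \<B> \<Longrightarrow> vm_add \<omega> x B \<le> vm_add \<omega> x A"
  by (auto simp: maximizers_def)

lemma maximizersI: "A \<in> M x \<Longrightarrow> B \<in> \<B> \<Longrightarrow> vm_add \<omega> x A \<le> vm_add \<omega> x B \<Longrightarrow> B \<in> M x"
  by (force simp: maximizers_def)

text \<open>Induction on the distance to \<open>A\<close>: exchanging between \<open>B\<close> and
  \<open>A\<close> yields a base nearer to \<open>A\<close> and a neighbour of \<open>A\<close>. The
  neighbour does not beat \<open>A\<close>, so the nearer base is at least as good as
  \<open>B\<close>, and the induction hypothesis bounds it by \<open>A\<close>.\<close>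

lemma local_optimum:
  assumes A: "A \<in> \<B>"
    and loc: "\<And>f g. f \<in> A \<Longrightarrow> g \<in> E - A \<Longrightarrow> insert g (A - {f}) \<in> \<B> \<Longrightarrow>
                vm_add \<omega> x (insert g (A - {f})) \<le> vm_add \<omega> x A"
  shows "A \<in> M x"
proof -
  have "vm_add \<omega> x B \<le> vm_add \<omega> x A" if "B \<in> \<B>" for B
    using that
  proof (induction "card (B - A)" arbitrary: B rule: less_induct)
    case less
    show ?case
    proof (cases "B \<subseteq> A")
      case True
      then have "B = A" using baseD[OF A] baseD[OF less.prems] by (metis card_subset_eq)
      then show ?thesis by simp
    next
      case False
      then obtain e where e: "e \<in> B - A" by blast
      obtain f where f: "f \<in> A - B" "insert f (B - {e}) \<in> \<B>" "insert e (A - {f}) \<in> \<B>"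
        "vm_add \<omega> x B + vm_add \<omega> x A
          \<le> vm_add \<omega> x (insert f (B - {e})) + vm_add \<omega> x (insert e (A - {f}))"
        using exchange[OF less.prems A e] by blast
      have "insert f (B - {e}) - A = (B - A) - {e}" using f by auto
      then have "card (insert f (B - {e}) - A) < card (B - A)"
        using e baseD(2)[OF less.prems] by (metis card_Diff1_less finite_Diff)
      then have "vm_add \<omega> x (insert f (B - {e})) \<le> vm_add \<omega> x A"
        using less.hyps f(2) by blast
      moreover have "vm_add \<omega> x (insert e (A - {f})) \<le> vm_add \<omega> x A"
        using loc[of f e] f e baseD(1)[OF less.prems] by blast
      ultimately show ?thesis using f(4) by linarith
    qed
  qed
  with A show ?thesis by (auto simp: maximizers_def)
qed

lemma tropicalD:
  assumes "x \<in> T"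
  shows "x \<in> extensional E" "M x \<noteq> {}" "e \<in> E \<Longrightarrow> \<exists>B\<in>M x. e \<in> B"
  using assms by (auto simp: tropical_space_def)

text \<open>Exchange \<open>g\<close> out of a maximizer that contains it. The maximizer cannot
  improve, so by the exchange inequality \<open>A\<close> loses nothing.\<close>

lemma swap_in:
  assumes x: "x \<in> T" and A: "A \<in> \<B>" and g: "g \<in> E - A"
  obtains f where "f \<in> A" "insert g (A - {f}) \<in> \<B>" "vm_add \<omega> x A \<le> vm_add \<omega> x (insert g (A - {f}))"
proof -
  obtain B where B: "B \<in> M x" "g \<in> B" using tropicalD(3)[OF x] g by blast
  obtain f where f: "f \<in> A - B" "insert f (B - {g}) \<in> \<B>" "insert g (A - {f}) \<in> \<B>"
     "vm_add \<omega> x B + vm_add \<omega> x A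
          \<le> vm_add \<omega> x (insert f (B - {g})) + vm_add \<omega> x (insert g (A - {f}))"
    using exchange[OF maximizersD(1)[OF B(1)] A, of g] B g by blast
  with maximizersD(2)[OF B(1) f(2)] that show ?thesis by force
qed

text \<open>Together with \<open>swap_in\<close>, this characterises the tropical linear space by the condition that
  every maximum over the bases contained in \<open>A + g\<close> is attained at least twice.\<close>
lemma tropicalI:
  assumes "x \<in> extensional E" "M x \<noteq> {}"
    and "\<And>A g. A \<in> M x \<Longrightarrow> g \<in> E - A \<Longrightarrow>
      \<exists>f\<in>A. insert g (A - {f}) \<in> \<B> \<and> vm_add \<omega> x A \<le> vm_add \<omega> x (insert g (A - {f}))"
  shows "x \<in> T"
  unfolding tropical_space_def
proof (intro CollectI conjI ballI)
  fix e assume e: "e \<in> E"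
  obtain A where A: "A \<in> M x" using assms by blast
  show "\<exists>B\<in>M x. e \<in> B"
  proof (cases "e \<in> A")
    case False
    then obtain f where "insert e (A - {f}) \<in> \<B>" "vm_add \<omega> x A \<le> vm_add \<omega> x (insert e (A - {f}))"
      using assms(3)[OF A, of e] e by blast
    then show ?thesis using maximizersI[OF A] by blast
  qed (use A in blast)
qed (use assms in auto)

text \<open>The swap of \<open>g\<close> into \<open>A\<close> that loses nothing at
  \<open>y\<close> gains nothing at \<open>x\<close>; subtracting the two inequalities cancels
  \<open>\<omega>\<close>. Hence \<open>x - y\<close> is bounded on the possibly infinite
  \<open>E\<close> by its values on the finite set \<open>A\<close>.\<close>

lemma tropical_diff_le:
  assumes x: "x \<in> T" and y: "y \<in> T" and A: "A \<in> M x" and g: "g \<in> E"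
  shows "\<exists>f\<in>A. x g - y g \<le> x f - y f"
proof (cases "g \<in> A")
  case False
  obtain f where f: "f \<in> A" "insert g (A - {f}) \<in> \<B>" "vm_add \<omega> y A \<le> vm_add \<omega> y (insert g (A - {f}))"
    using swap_in[OF y maximizersD(1)[OF A], of g] g False by blast
  have "vm_add \<omega> x (insert g (A - {f})) \<le> vm_add \<omega> x A" using maximizersD(2)[OF A f(2)] .
  then show ?thesis using f vm_add_swap[OF maximizersD(1)[OF A] f(1) False, of x] vm_add_swap[OF maximizersD(1)[OF A] f(1) False, of y]
    by (intro bexI[of _ f]) auto
qed auto

lemma tropical_le:
  assumes "x \<in> T" "y \<in> T" "A \<in> M x" "\<And>f. f \<in> A \<Longrightarrow> x f \<le> y f" "g \<in> E"
  shows "x g \<le> y g"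
  using tropical_diff_le[OF assms(1,2,3,5)] assms(4) by force

text \<open>Outside \<open>A\<close> the value at \<open>g\<close> is forced: it is the largest one
  for which no swap of \<open>g\<close> into \<open>A\<close> beats \<open>A\<close>. Attaining this
  minimum puts \<open>g\<close> into a maximizer, and the absence of loops makes the set of swaps
  nonempty.\<close>

lemma ex_tropical_of_base:
  assumes nl: "\<And>e. e \<in> E \<Longrightarrow> \<not> is_loop \<B> e" and A: "A \<in> \<B>"
  obtains z where "z \<in> T" "A \<in> M z" "\<And>f. f \<in> A \<Longrightarrow> z f = v f"
    "(\<forall>f\<in>A. v f \<in> \<int>) \<Longrightarrow> (\<forall>B\<in>\<B>. \<omega> B \<in> \<int>) \<Longrightarrow> (\<forall>e\<in>E. z e \<in> \<int>)"
proof -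
  define X where "X g = (\<lambda>f. v f + \<omega> A - \<omega> (insert g (A - {f}))) ` {f \<in> A. insert g (A - {f}) \<in> \<B>}" for g
  have X: "finite (X g)" "X g \<noteq> {}" if gA: "g \<in> E - A" for g
  proof -
    show "finite (X g)" using baseD[OF A] by (auto simp: X_def)
    have "\<exists>B\<in>\<B>. g \<in> B" using nl[of g] gA unfolding is_loop_def by blast
    then obtain B where "B \<in> \<B>" "g \<in> B" by blast
    then obtain f where "f \<in> A - B" "insert g (A - {f}) \<in> \<B>" using exchange[of B A g "\<lambda>_. 0"] A gA by blast
    then show "X g \<noteq> {}" by (auto simp: X_def)
  qed
  define z where "z = (\<lambda>e\<in>E. if e \<in> A then v e else Min (X e))"
  have zA: "z f = v f" if "f \<in> A" for f using that baseD[OF A] by (auto simp: z_def)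
  have le: "vm_add \<omega> z (insert g (A - {f})) \<le> vm_add \<omega> z A"
    if "f \<in> A" "g \<in> E - A" "insert g (A - {f}) \<in> \<B>" for f g
  proof -
    have "z g \<le> v f + \<omega> A - \<omega> (insert g (A - {f}))"
      using X[OF that(2)] that by (auto simp: z_def X_def intro!: Min_le)
    then show ?thesis using vm_add_swap[OF A that(1), of g z] that zA by auto
  qed
  have AM: "A \<in> M z" using local_optimum[OF A le] by blast
  have "z \<in> T"
    unfolding tropical_space_def
  proof (intro CollectI conjI ballI)
    show "z \<in> extensional E" by (simp add: z_def)
    show "M z \<noteq> {}" using AM by blast
    fix g assume g: "g \<in> E"
    show "\<exists>B\<in>M z. g \<in> B"
    proof (cases "g \<in> A")
      case False
      then have "Min (X g) \<in> X g" using X[of g] g by auto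
      then obtain f where f: "f \<in> A" "insert g (A - {f}) \<in> \<B>"
        "z g = v f + \<omega> A - \<omega> (insert g (A - {f}))" using g False by (auto simp: X_def z_def)
      then have "vm_add \<omega> z A \<le> vm_add \<omega> z (insert g (A - {f}))"
        using vm_add_swap[OF A f(1) False, of z] zA by auto
      then show ?thesis using maximizersI[OF AM f(2)] by blast
    qed (use AM in blast)
  qed
  moreover have "\<forall>e\<in>E. z e \<in> \<int>" if "\<forall>f\<in>A. v f \<in> \<int>" "\<forall>B\<in>\<B>. \<omega> B \<in> \<int>"
  proof
    fix g assume g: "g \<in> E"
    show "z g \<in> \<int>"
    proof (cases "g \<in> A")
      case False
      then have "Min (X g) \<in> X g" using X[of g] g by auto
      then show ?thesis using that A g False by (auto simp: X_def z_def)
    qed (use zA that in auto)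
  qed
  ultimately show ?thesis using that AM zA by blast
qed

text \<open>Take a member \<open>s\<close> of \<open>S\<close> that attains \<open>z\<close> at
  \<open>g\<close>, and the swap \<open>f\<close> that \<open>s\<close> allows. As
  \<open>z f \<le> s f\<close>, giving up \<open>f\<close> costs no more at \<open>z\<close> than at
  \<open>s\<close>, while the gain at \<open>g\<close> is the same.\<close>

lemma tropical_inf:
  assumes S: "S \<subseteq> T" and z: "z \<in> extensional E" "M z \<noteq> {}"
    and att: "\<And>g. g \<in> E \<Longrightarrow> \<exists>s\<in>S. z g = s g" and lb: "\<And>s g. s \<in> S \<Longrightarrow> g \<in> E \<Longrightarrow> z g \<le> s g"
  shows "z \<in> T"
proof (rule tropicalI[OF z])
  fix A g assume A: "A \<in> M z" and g: "g \<in> E - A"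
  obtain s where s: "s \<in> S" "z g = s g" using att g by blast
  obtain f where f: "f \<in> A" "insert g (A - {f}) \<in> \<B>" "vm_add \<omega> s A \<le> vm_add \<omega> s (insert g (A - {f}))"
    using swap_in[OF _ maximizersD(1)[OF A] g] S s by blast
  have "z f \<le> s f" using lb s f baseD(1)[OF maximizersD(1)[OF A]] by auto
  then show "\<exists>f\<in>A. insert g (A - {f}) \<in> \<B> \<and> vm_add \<omega> z A \<le> vm_add \<omega> z (insert g (A - {f}))"
    using f s g vm_add_swap[OF maximizersD(1)[OF A] f(1), of g z] vm_add_swap[OF maximizersD(1)[OF A] f(1), of g s]
    by (intro bexI[of _ f]) auto
qed

lemma vm_add_mono: "B \<in> \<B> \<Longrightarrow> (\<And>e. e \<in> E \<Longrightarrow> x e \<le> y e) \<Longrightarrow> vm_add \<omega> x B \<le> vm_add \<omega> y B"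
  unfolding vm_add_def using baseD[of B] by (auto intro!: sum_mono)

lemma vm_add_const:
  assumes "B \<in> \<B>" shows "vm_add \<omega> (\<lambda>e\<in>E. x e + c) B = vm_add \<omega> x B + real n * c"
proof -
  have "sum (\<lambda>e\<in>E. x e + c) B = (\<Sum>e\<in>B. x e + c)" using baseD[OF assms] by (intro sum.cong) auto
  then show ?thesis using baseD[OF assms] by (simp add: vm_add_def sum.distrib)
qed

lemma maximizers_const: "M (\<lambda>e\<in>E. x e + c) = M x"
  unfolding maximizers_def
  by (intro Collect_cong conj_cong ball_cong refl) (simp only: vm_add_const add_le_cancel_right)

lemma tropical_const: "x \<in> T \<Longrightarrow> (\<lambda>e\<in>E. x e + c) \<in> T"
  by (simp add: tropical_space_def maximizers_const)

section \<open>The metric of the tight span\<close>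

lemma tight_spanD:
  assumes p: "p \<in> tight_span E \<B> \<omega>" and e: "e \<in> E"
  shows "\<exists>B\<in>\<B>. e \<in> B \<and> \<omega> B = sum p B" "B \<in> \<B> \<Longrightarrow> e \<in> B \<Longrightarrow> \<omega> B \<le> sum p B"
proof -
  have max: "is_maximum ((\<lambda>B. \<omega> B - (\<Sum>f\<in>B - {e}. p f)) ` {B \<in> \<B>. e \<in> B}) (p e)"
    using p e by (simp add: tight_span_def)
  have sum: "sum p B = p e + sum p (B - {e})" if "B \<in> \<B>" "e \<in> B" for B
    using baseD(2)[OF that(1)] that(2) by (rule sum.remove)
  show "\<exists>B\<in>\<B>. e \<in> B \<and> \<omega> B = sum p B" using max sum by (force simp: is_maximum_def)
  show "\<omega> B \<le> sum p B" if B: "B \<in> \<B>" "e \<in> B"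
  proof -
    have "\<omega> B - sum p (B - {e}) \<le> p e" using max B unfolding is_maximum_def by blast
    then show ?thesis using sum[OF B] by simp
  qed
qed

lemma vm_add_uminus:
  assumes "B \<in> \<B>" shows "vm_add \<omega> (\<lambda>e\<in>E. - p e) B = \<omega> B - sum p B"
proof -
  have "sum (\<lambda>e\<in>E. - p e) B = (\<Sum>e\<in>B. - p e)" using baseD(1)[OF assms] by (intro sum.cong) auto
  then show ?thesis by (simp add: vm_add_def sum_negf)
qed

text \<open>The negative of \<open>p\<close> is a point of the tropical linear space normalised so
  that its maximum is 0. Since \<open>n \<ge> 1\<close>, every base has an element at which the
  condition on \<open>p\<close> applies to it.\<close>

lemma tight_span_tropical:
  assumes n: "n \<ge> 1" and p: "p \<in> tight_span E \<B> \<omega>"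
  shows "(\<lambda>e\<in>E. - p e) \<in> T" "B \<in> M (\<lambda>e\<in>E. - p e) \<longleftrightarrow> B \<in> \<B> \<and> \<omega> B = sum p B"
    "B \<in> \<B> \<Longrightarrow> \<omega> B \<le> sum p B"
proof -
  let ?q = "\<lambda>e\<in>E. - p e"
  show le: "\<omega> B \<le> sum p B" if B: "B \<in> \<B>" for B
  proof -
    obtain e where "e \<in> B" using baseD(3)[OF B] n by fastforce
    then show ?thesis using tight_spanD(2)[OF p _ B] baseD(1)[OF B] by blast
  qed
  obtain B0 where B0: "B0 \<in> \<B>" using bases_nonempty by blast
  obtain e where "e \<in> B0" using baseD(3)[OF B0] n by fastforce
  then obtain C where C: "C \<in> \<B>" "\<omega> C = sum p C" using tight_spanD(1)[OF p] baseD(1)[OF B0] by blast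
  show iff: "B \<in> M ?q \<longleftrightarrow> B \<in> \<B> \<and> \<omega> B = sum p B" for B
  proof
    assume B: "B \<in> M ?q"
    have "vm_add \<omega> ?q C \<le> vm_add \<omega> ?q B" by (rule maximizersD(2)[OF B C(1)])
    then show "B \<in> \<B> \<and> \<omega> B = sum p B" using vm_add_uminus maximizersD(1)[OF B] C le[of B] by force
  next
    assume "B \<in> \<B> \<and> \<omega> B = sum p B"
    then show "B \<in> M ?q" using le by (auto simp: maximizers_def vm_add_uminus)
  qed
  show "?q \<in> T" unfolding tropical_space_def
  proof (intro CollectI conjI ballI)
    show "M ?q \<noteq> {}" using iff C by blast
    show "\<exists>B\<in>M ?q. e \<in> B" if "e \<in> E" for e using tight_spanD(1)[OF p that] iff by blast
  qed simp
qed

text \<open>By \<open>tropical_diff_le\<close> the difference is controlled on a finite base, and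
  the sum of absolute values over that base dominates each of its terms.\<close>

lemma tight_span_bounded_diff:
  assumes n: "n \<ge> 1" and p: "p \<in> tight_span E \<B> \<omega>" and p': "p' \<in> tight_span E \<B> \<omega>"
  shows "\<exists>K. \<forall>e\<in>E. p e - p' e \<le> K"
proof -
  let ?q = "\<lambda>e\<in>E. - p e" and ?q' = "\<lambda>e\<in>E. - p' e"
  note q = tight_span_tropical(1)[OF n p] and q' = tight_span_tropical(1)[OF n p']
  obtain A where A: "A \<in> M ?q'" using tropicalD(2)[OF q'] by blast
  note Ab = baseD[OF maximizersD(1)[OF A]]
  have "p e - p' e \<le> (\<Sum>f\<in>A. \<bar>p f - p' f\<bar>)" if e: "e \<in> E" for e
  proof -
    obtain f where f: "f \<in> A" "?q' e - ?q e \<le> ?q' f - ?q f" using tropical_diff_le[OF q' q A e] by blast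
    have "\<bar>p f - p' f\<bar> \<le> (\<Sum>f\<in>A. \<bar>p f - p' f\<bar>)" using Ab(2) f(1) by (intro member_le_sum) auto
    then show ?thesis using f e Ab(1) by auto
  qed
  then show ?thesis by blast
qed

text \<open>The maximum over the bases containing \<open>e\<close> and \<open>f\<close> is attained on one of the finitely many
  bases obtained by swapping \<open>f\<close> into an optimal base containing \<open>e\<close>.\<close>
lemma ex_max_containing_pair:
  assumes x: "x \<in> T" and e: "e \<in> E" and C: "C \<in> \<B>" "e \<in> C" "f \<in> C" and "e \<noteq> f"
  shows "\<exists>B\<in>\<B>. e \<in> B \<and> f \<in> B \<and> (\<forall>B'\<in>\<B>. e \<in> B' \<longrightarrow> f \<in> B' \<longrightarrow> vm_add \<omega> x B' \<le> vm_add \<omega> x B)"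
proof -
  obtain B0 where B0: "B0 \<in> M x" "e \<in> B0" using tropicalD(3)[OF x e] by blast
  note B0B = maximizersD(1)[OF B0(1)]
  show ?thesis
  proof (cases "f \<in> B0")
    case True
    then show ?thesis using B0(2) maximizersD(2)[OF B0(1)] B0B by (intro bexI[of _ B0]) auto
  next
    case False
    define X where "X = {g \<in> B0 - {e}. insert f (B0 - {g}) \<in> \<B>}"
    have dom: "\<exists>g\<in>X. vm_add \<omega> x B' \<le> vm_add \<omega> x (insert f (B0 - {g}))"
      if B': "B' \<in> \<B>" "e \<in> B'" "f \<in> B'" for B'
    proof -
      obtain g where g: "g \<in> B0 - B'" "insert g (B' - {f}) \<in> \<B>" "insert f (B0 - {g}) \<in> \<B>"
        "vm_add \<omega> x B' + vm_add \<omega> x B0 \<le> vm_add \<omega> x (insert g (B' - {f})) + vm_add \<omega> x (insert f (B0 - {g}))"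
        using exchange[OF B'(1) B0B, of f x] B'(3) False by blast
      have "vm_add \<omega> x (insert g (B' - {f})) \<le> vm_add \<omega> x B0" by (rule maximizersD(2)[OF B0(1) g(2)])
      moreover have "g \<in> X" using g B' by (auto simp: X_def)
      ultimately show ?thesis using g(4) by (intro bexI[of _ g]) auto
    qed
    let ?v = "\<lambda>g. vm_add \<omega> x (insert f (B0 - {g}))"
    have fin: "finite (?v ` X)" using baseD(2)[OF B0B] by (simp add: X_def)
    have "?v ` X \<noteq> {}" using dom[OF C] by blast
    then have "Max (?v ` X) \<in> ?v ` X" using fin by (rule Max_in[rotated])
    then obtain g where g: "g \<in> X" "Max (?v ` X) = ?v g" by blast
    have "vm_add \<omega> x B' \<le> ?v g" if B': "B' \<in> \<B>" "e \<in> B'" "f \<in> B'" for B'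
    proof -
      obtain h where h: "h \<in> X" "vm_add \<omega> x B' \<le> ?v h" using dom[OF B'] by blast
      have "?v h \<le> Max (?v ` X)" using fin h(1) by (intro Max_ge) auto
      then show ?thesis using h(2) g(2) by simp
    qed
    then show ?thesis using g(1) B0(2) unfolding X_def by (intro bexI[of _ "insert f (B0 - {g})"]) auto
  qed
qed

lemma tight_span_dist_eq:
  assumes n: "n \<ge> 1" and p: "p \<in> tight_span E \<B> \<omega>" and s: "simple_matroid E \<B>"
    and ef: "e \<in> E" "f \<in> E" "e \<noteq> f"
  shows "\<exists>B\<in>\<B>. e \<in> B \<and> f \<in> B \<and> tight_span_dist \<B> \<omega> p e f = exp (\<omega> B - sum p B) \<and>
    (\<forall>B'\<in>\<B>. e \<in> B' \<longrightarrow> f \<in> B' \<longrightarrow> \<omega> B' - sum p B' \<le> \<omega> B - sum p B)"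
proof -
  have "\<exists>C\<in>\<B>. {e, f} \<subseteq> C" using s ef unfolding simple_matroid_def by blast
  then obtain C where C: "C \<in> \<B>" "e \<in> C" "f \<in> C" by blast
  obtain B where B: "B \<in> \<B>" "e \<in> B" "f \<in> B"
    "\<And>B'. B' \<in> \<B> \<Longrightarrow> e \<in> B' \<Longrightarrow> f \<in> B' \<Longrightarrow> vm_add \<omega> (\<lambda>e\<in>E. - p e) B' \<le> vm_add \<omega> (\<lambda>e\<in>E. - p e) B"
    using ex_max_containing_pair[OF tight_span_tropical(1)[OF n p] ef(1) C ef(3)] by blast
  have max: "\<omega> B' - sum p B' \<le> \<omega> B - sum p B" if "B' \<in> \<B>" "e \<in> B'" "f \<in> B'" for B'
    using B(4)[OF that] vm_add_uminus that(1) B(1) by simp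
  have "(GREATEST m. m \<in> (\<lambda>B. \<omega> B - (\<Sum>g\<in>B. p g)) ` {B \<in> \<B>. {e, f} \<subseteq> B}) = \<omega> B - sum p B"
    by (rule Greatest_equality) (use B(1-3) max in auto)
  moreover have "\<exists>B\<in>\<B>. {e, f} \<subseteq> B" using C by blast
  ultimately have "tight_span_dist \<B> \<omega> p e f = exp (\<omega> B - sum p B)"
    using ef(3) by (simp add: tight_span_dist_def)
  with B(1-3) max show ?thesis by blast
qed

lemma tight_span_dist_commute: "tight_span_dist \<B> \<omega> p e f = tight_span_dist \<B> \<omega> p f e"
  unfolding tight_span_dist_def insert_commute[of e f "{}"] by (simp only: eq_commute[of e f])

lemma tight_span_dist_pos:
  assumes "n \<ge> 1" "p \<in> tight_span E \<B> \<omega>" "simple_matroid E \<B>" "e \<in> E" "f \<in> E" "e \<noteq> f"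
  shows "0 < tight_span_dist \<B> \<omega> p e f"
proof -
  obtain B where "tight_span_dist \<B> \<omega> p e f = exp (\<omega> B - sum p B)"
    using tight_span_dist_eq[OF assms] by blast
  then show ?thesis by simp
qed

text \<open>Swapping \<open>f\<close> into a best base through \<open>e\<close> and \<open>g\<close>
  loses nothing and removes only one element, so the result still contains \<open>e\<close> or
  \<open>g\<close> next to \<open>f\<close>.\<close>

lemma tight_span_dist_ultra:
  assumes n: "n \<ge> 1" and p: "p \<in> tight_span E \<B> \<omega>" and s: "simple_matroid E \<B>"
    and efg: "e \<in> E" "f \<in> E" "g \<in> E" "e \<noteq> f" "f \<noteq> g" "e \<noteq> g"
  shows "tight_span_dist \<B> \<omega> p e g \<le> max (tight_span_dist \<B> \<omega> p e f) (tight_span_dist \<B> \<omega> p f g)"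
proof -
  let ?q = "\<lambda>e\<in>E. - p e"
  note q = tight_span_tropical(1)[OF n p]
  obtain B where B: "B \<in> \<B>" "e \<in> B" "g \<in> B" "tight_span_dist \<B> \<omega> p e g = exp (\<omega> B - sum p B)"
    using tight_span_dist_eq[OF n p s efg(1,3,6)] by blast
  obtain B1 where B1: "tight_span_dist \<B> \<omega> p e f = exp (\<omega> B1 - sum p B1)"
    "\<forall>B'\<in>\<B>. e \<in> B' \<longrightarrow> f \<in> B' \<longrightarrow> \<omega> B' - sum p B' \<le> \<omega> B1 - sum p B1"
    using tight_span_dist_eq[OF n p s efg(1,2,4)] by blast
  obtain B2 where B2: "tight_span_dist \<B> \<omega> p f g = exp (\<omega> B2 - sum p B2)"
    "\<forall>B'\<in>\<B>. f \<in> B' \<longrightarrow> g \<in> B' \<longrightarrow> \<omega> B' - sum p B' \<le> \<omega> B2 - sum p B2"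
    using tight_span_dist_eq[OF n p s efg(2,3,5)] by blast
  have "\<exists>B'. B' \<in> \<B> \<and> f \<in> B' \<and> (e \<in> B' \<or> g \<in> B') \<and> \<omega> B - sum p B \<le> \<omega> B' - sum p B'"
  proof (cases "f \<in> B")
    case True
    then show ?thesis using B by blast
  next
    case False
    obtain h where h: "h \<in> B" "insert f (B - {h}) \<in> \<B>" "vm_add \<omega> ?q B \<le> vm_add \<omega> ?q (insert f (B - {h}))"
      using swap_in[OF q B(1), of f] efg(2) False by blast
    then have "\<omega> B - sum p B \<le> \<omega> (insert f (B - {h})) - sum p (insert f (B - {h}))"
      using vm_add_uminus[OF B(1)] vm_add_uminus[OF h(2)] by simp
    then show ?thesis using h(2) B(2,3) efg(6) by (intro exI[of _ "insert f (B - {h})"]) auto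
  qed
  then obtain C where C: "C \<in> \<B>" "f \<in> C" "e \<in> C \<or> g \<in> C" "\<omega> B - sum p B \<le> \<omega> C - sum p C" by blast
  then have "\<omega> C - sum p C \<le> \<omega> B1 - sum p B1 \<or> \<omega> C - sum p C \<le> \<omega> B2 - sum p B2"
    using B1(2) B2(2) by blast
  then have "\<omega> B - sum p B \<le> \<omega> B1 - sum p B1 \<or> \<omega> B - sum p B \<le> \<omega> B2 - sum p B2"
    using C(4) by linarith
  then show ?thesis using B(4) B1(1) B2(1) by (auto simp: max_def)
qed

lemma Metric_space_tight_span_dist:
  assumes n: "n \<ge> 1" and p: "p \<in> tight_span E \<B> \<omega>" and s: "simple_matroid E \<B>"
  shows "Metric_space E (tight_span_dist \<B> \<omega> p)"
proof
  let ?d = "tight_span_dist \<B> \<omega> p"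
  show nonneg: "0 \<le> ?d e f" for e f by (simp add: tight_span_dist_def)
  show "?d e f = ?d f e" for e f by (rule tight_span_dist_commute)
  have self: "?d e e = 0" for e by (simp add: tight_span_dist_def)
  show "?d e f = 0 \<longleftrightarrow> e = f" if "e \<in> E" "f \<in> E" for e f
    using tight_span_dist_pos[OF n p s that] self by fastforce
  show "?d e g \<le> ?d e f + ?d f g" if "e \<in> E" "f \<in> E" "g \<in> E" for e f g
  proof (cases "e = f \<or> f = g \<or> e = g")
    case True
    then show ?thesis using self nonneg by auto
  next
    case False
    then have "?d e g \<le> max (?d e f) (?d f g)" using tight_span_dist_ultra[OF n p s that] by blast
    then show ?thesis using nonneg[of e f] nonneg[of f g] by (auto simp: max_def split: if_splits)
  qed
qed

end

section \<open>The lattice of integer points\<close>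

locale int_valuated = valuated +
  assumes int: "\<And>B. B \<in> \<B> \<Longrightarrow> \<omega> B \<in> \<int>"
begin

abbreviation "L \<equiv> vm_lattice E \<B> \<omega>"

definition r :: "('a \<Rightarrow> real) \<Rightarrow> real" where
  "r x = (GREATEST m. m \<in> vm_add \<omega> x ` \<B>)"

lemma carrier_L: "x \<in> carrier L \<longleftrightarrow> x \<in> T \<and> (\<forall>e\<in>E. x e \<in> \<int>)"
  by (auto simp: vm_lattice_def tropical_space_def PiE_iff)

lemma carrierD:
  assumes "x \<in> carrier L" shows "x \<in> T" "x \<in> extensional E" "e \<in> E \<Longrightarrow> x e \<in> \<int>" "M x \<noteq> {}"
    "e \<in> E \<Longrightarrow> \<exists>B\<in>M x. e \<in> B"
  using assms tropicalD[of x] by (auto simp: carrier_L)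

lemma le_L: "x \<sqsubseteq>\<^bsub>L\<^esub> y \<longleftrightarrow> (\<forall>e\<in>E. x e \<le> y e)"
  by (simp add: vm_lattice_def)

lemma eq_L: "x .=\<^bsub>L\<^esub> y \<longleftrightarrow> x = y"
  by (simp add: vm_lattice_def)

lemma less_L: "x \<sqsubset>\<^bsub>L\<^esub> y \<longleftrightarrow> (\<forall>e\<in>E. x e \<le> y e) \<and> x \<noteq> y"
  by (simp add: lless_def le_L eq_L)

lemma carrier_eqI:
  assumes "x \<in> carrier L" "y \<in> carrier L" "\<And>e. e \<in> E \<Longrightarrow> x e = y e" shows "x = y"
  by (rule extensionalityI[of _ E]) (use assms carrierD in auto)

lemma partial_order_L: "partial_order L"
proof unfold_locales
  fix x y assume "x \<sqsubseteq>\<^bsub>L\<^esub> y" "y \<sqsubseteq>\<^bsub>L\<^esub> x" "x \<in> carrier L" "y \<in> carrier L"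
  then show "x .=\<^bsub>L\<^esub> y" using carrier_eqI[of x y] by (force simp: le_L eq_L)
qed (auto simp: le_L eq_L fun_eq_iff intro: order_trans)

sublocale L: partial_order L
  by (rule partial_order_L)

lemma r_eq: "A \<in> M x \<Longrightarrow> r x = vm_add \<omega> x A"
  unfolding r_def by (rule Greatest_equality) (auto simp: maximizers_def)

lemma maximizers_iff:
  assumes "x \<in> carrier L" shows "A \<in> M x \<longleftrightarrow> A \<in> \<B> \<and> vm_add \<omega> x A = r x"
proof -
  obtain B where B: "B \<in> M x" using carrierD(4)[OF assms] by blast
  show ?thesis
  proof
    assume "A \<in> M x"
    then show "A \<in> \<B> \<and> vm_add \<omega> x A = r x" using r_eq[of A x] maximizersD(1)[of A x] by simp
  next
    assume "A \<in> \<B> \<and> vm_add \<omega> x A = r x"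
    then show "A \<in> M x" using maximizersI[OF B, of A] r_eq[OF B] by simp
  qed
qed

lemma le_r: assumes "x \<in> carrier L" "B \<in> \<B>" shows "vm_add \<omega> x B \<le> r x"
proof -
  obtain A where A: "A \<in> M x" using carrierD(4)[OF assms(1)] by blast
  then show ?thesis using r_eq[OF A] maximizersD(2)[OF A assms(2)] by simp
qed

lemma vm_add_Ints: "(\<And>e. e \<in> E \<Longrightarrow> x e \<in> \<int>) \<Longrightarrow> B \<in> \<B> \<Longrightarrow> vm_add \<omega> x B \<in> \<int>"
  unfolding vm_add_def using int baseD(1) by (auto intro!: Ints_add Ints_sum)

lemma r_Ints: assumes "x \<in> carrier L" shows "r x \<in> \<int>"
proof -
  obtain A where A: "A \<in> M x" using carrierD(4)[OF assms(1)] by blast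
  then show ?thesis using r_eq[OF A] vm_add_Ints[OF carrierD(3)[OF assms] maximizersD(1)[OF A]] by simp
qed

lemma r_mono:
  assumes "x \<in> carrier L" "y \<in> carrier L" "x \<sqsubseteq>\<^bsub>L\<^esub> y" shows "r x \<le> r y"
proof -
  obtain A where A: "A \<in> M x" using carrierD(4)[OF assms(1)] by blast
  have "vm_add \<omega> x A \<le> vm_add \<omega> y A" using vm_add_mono[OF maximizersD(1)[OF A]] assms(3) by (simp add: le_L)
  then show ?thesis using r_eq[OF A] le_r[OF assms(2) maximizersD(1)[OF A]] by simp
qed

text \<open>A base optimal at \<open>x\<close> through a coordinate that grows becomes strictly
  heavier at \<open>y\<close>; integrality turns the strict inequality into a gap of one.\<close>

lemma r_strict_mono:
  assumes x: "x \<in> carrier L" and y: "y \<in> carrier L" and "x \<sqsubset>\<^bsub>L\<^esub> y" shows "r x + 1 \<le> r y"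
proof -
  have le: "\<And>e. e \<in> E \<Longrightarrow> x e \<le> y e" and "x \<noteq> y" using assms by (auto simp: less_L)
  then obtain e where e: "e \<in> E" "x e < y e" using carrier_eqI[OF x y] by (metis order_less_le)
  obtain A where A: "A \<in> M x" "e \<in> A" using carrierD(5)[OF x e(1)] by blast
  have "sum x A < sum y A"
    using baseD[OF maximizersD(1)[OF A(1)]] e A le by (intro sum_strict_mono_ex1) auto
  then have "r x < r y"
    using r_eq[OF A(1)] le_r[OF y maximizersD(1)[OF A(1)]] by (simp add: vm_add_def)
  then show ?thesis using Ints_less_imp_le r_Ints x y by blast
qed

section \<open>Infima, meets and joins\<close>

text \<open>Integrality does two jobs: the bounded coordinate sets have minima, so \<open>z\<close>
  is attained by members of \<open>S\<close>, and the values of \<open>\<omega> + z\<close>, bounded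
  by \<open>r s\<close> for some \<open>s\<close>, have a maximum even when \<open>E\<close> is
  infinite. This is what \<open>tropical_inf\<close> requires.\<close>

lemma ex_inf:
  assumes S: "S \<subseteq> carrier L" "S \<noteq> {}" and lb: "\<And>s e. s \<in> S \<Longrightarrow> e \<in> E \<Longrightarrow> b e \<le> s e"
  obtains z where "z \<in> carrier L" "\<And>e. e \<in> E \<Longrightarrow> \<exists>s\<in>S. z e = s e" "\<And>s e. s \<in> S \<Longrightarrow> e \<in> E \<Longrightarrow> z e \<le> s e"
proof -
  have "\<exists>m. m \<in> (\<lambda>s. s e) ` S \<and> (\<forall>y\<in>(\<lambda>s. s e) ` S. m \<le> y)" if "e \<in> E" for e
    using Ints_min_ex[of "(\<lambda>s. s e) ` S" "b e"] S lb that carrierD(3) by blast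
  then obtain f where f: "\<And>e. e \<in> E \<Longrightarrow> f e \<in> (\<lambda>s. s e) ` S \<and> (\<forall>y\<in>(\<lambda>s. s e) ` S. f e \<le> y)"
    by metis
  define z where "z = restrict f E"
  have att: "\<exists>s\<in>S. z e = s e" if "e \<in> E" for e using f[OF that] that by (auto simp: z_def)
  have le: "z e \<le> s e" if "s \<in> S" "e \<in> E" for s e using f[OF that(2)] that by (auto simp: z_def)
  have zi: "z e \<in> \<int>" if e: "e \<in> E" for e
  proof -
    obtain s where "s \<in> S" "z e = s e" using att[OF e] by blast
    then show ?thesis using carrierD(3)[of s e] S(1) e by auto
  qed
  obtain s where s: "s \<in> S" using S by blast
  have "vm_add \<omega> z B \<le> r s" if "B \<in> \<B>" for B
    using vm_add_mono[OF that, of z s] le[OF s] le_r[of s B] s S(1) that by fastforce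
  moreover have "vm_add \<omega> z ` \<B> \<subseteq> \<int>" using vm_add_Ints[of z, OF zi] by blast
  ultimately have "\<exists>m\<in>vm_add \<omega> z ` \<B>. \<forall>y\<in>vm_add \<omega> z ` \<B>. y \<le> m"
    using bases_nonempty by (intro Ints_max_ex[of _ "r s"]) auto
  then have "M z \<noteq> {}" by (auto simp: maximizers_def)
  moreover have "S \<subseteq> T" using S(1) carrierD(1) by blast
  ultimately have "z \<in> T" using tropical_inf[of S z] att le by (simp add: z_def)
  then have "z \<in> carrier L" using zi by (simp add: carrier_L)
  with att le that show ?thesis by blast
qed

lemma min_carrier:
  assumes "x \<in> carrier L" "y \<in> carrier L" shows "(\<lambda>e\<in>E. min (x e) (y e)) \<in> carrier L"
proof -
  obtain z where z: "z \<in> carrier L" "\<And>e. e \<in> E \<Longrightarrow> \<exists>s\<in>{x,y}. z e = s e"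
      "\<And>s e. s \<in> {x,y} \<Longrightarrow> e \<in> E \<Longrightarrow> z e \<le> s e"
    by (rule ex_inf[of "{x,y}" "\<lambda>e. min (x e) (y e)"]) (use assms in auto)
  have "z = (\<lambda>e\<in>E. min (x e) (y e))"
  proof (rule extensionalityI[of _ E])
    fix e assume e: "e \<in> E"
    show "z e = (\<lambda>e\<in>E. min (x e) (y e)) e" using z(2)[OF e] z(3)[OF _ e, of x] z(3)[OF _ e, of y] e by auto
  qed (use carrierD[OF z(1)] in auto)
  with z show ?thesis by simp
qed

lemma inf_eqI: "greatest L g (Lower L A) \<Longrightarrow> \<Sqinter>\<^bsub>L\<^esub>A = g"
  unfolding inf_def by (rule some_equality) (auto intro: L.greatest_unique)

lemma sup_eqI: "least L g (Upper L A) \<Longrightarrow> \<Squnion>\<^bsub>L\<^esub>A = g"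
  unfolding sup_def by (rule some_equality) (auto intro: L.least_unique)

lemma greatest_min:
  assumes "x \<in> carrier L" "y \<in> carrier L"
  shows "greatest L (\<lambda>e\<in>E. min (x e) (y e)) (Lower L {x, y})"
  using assms min_carrier[OF assms] by (auto simp: greatest_def Lower_def le_L)

lemma meet_eq:
  assumes "x \<in> carrier L" "y \<in> carrier L" shows "x \<sqinter>\<^bsub>L\<^esub> y = (\<lambda>e\<in>E. min (x e) (y e))"
  unfolding meet_def by (rule inf_eqI[OF greatest_min[OF assms]])

lemma const_carrier:
  assumes "x \<in> carrier L" "c \<in> \<int>" shows "(\<lambda>e\<in>E. x e + c) \<in> carrier L"
  using assms tropical_const by (auto simp: carrier_L)

lemma r_const:
  assumes "x \<in> carrier L" shows "r (\<lambda>e\<in>E. x e + c) = r x + real n * c"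
proof -
  obtain A where A: "A \<in> M x" using carrierD(4)[OF assms] by blast
  then have "A \<in> M (\<lambda>e\<in>E. x e + c)" unfolding maximizers_const .
  then show ?thesis using r_eq[OF A] r_eq[of A "\<lambda>e\<in>E. x e + c"] vm_add_const[OF maximizersD(1)[OF A], of x c] by metis
qed

text \<open>A single finite base controls the difference, by \<open>tropical_diff_le\<close>. The
  shifted point is what makes the set of common upper bounds in \<open>ex_join\<close>
  nonempty.\<close>

lemma ex_shift_le:
  assumes x: "x \<in> carrier L" and y: "y \<in> carrier L"
  obtains c :: nat where "\<And>e. e \<in> E \<Longrightarrow> y e \<le> x e + c"
proof -
  obtain A where A: "A \<in> M y" using carrierD(4)[OF y] by blast
  have fin: "finite A" using baseD maximizersD(1)[OF A] by blast
  define c where "c = nat \<lceil>\<Sum>f\<in>A. \<bar>y f - x f\<bar>\<rceil>"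
  have "y e \<le> x e + c" if e: "e \<in> E" for e
  proof -
    obtain f where f: "f \<in> A" "y e - x e \<le> y f - x f"
      using tropical_diff_le[of y x A e] x y A e carrier_L by auto
    have "\<bar>y f - x f\<bar> \<le> (\<Sum>f\<in>A. \<bar>y f - x f\<bar>)" using fin f(1) by (intro member_le_sum) auto
    then have "\<bar>y f - x f\<bar> \<le> c" unfolding c_def by linarith
    with f(2) show ?thesis by linarith
  qed
  with that show ?thesis by blast
qed

text \<open>The infimum of all common upper bounds is attained coordinatewise by upper bounds, so it
  is an upper bound itself.\<close>

lemma ex_join:
  assumes x: "x \<in> carrier L" and y: "y \<in> carrier L"
  obtains z where "least L z (Upper L {x, y})"
    "z = \<Sqinter>\<^bsub>L\<^esub>{z \<in> carrier L. x \<sqsubseteq>\<^bsub>L\<^esub> z \<and> y \<sqsubseteq>\<^bsub>L\<^esub> z}"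
proof -
  let ?S = "{z \<in> carrier L. x \<sqsubseteq>\<^bsub>L\<^esub> z \<and> y \<sqsubseteq>\<^bsub>L\<^esub> z}"
  obtain c :: nat where "\<And>e. e \<in> E \<Longrightarrow> y e \<le> x e + c" using ex_shift_le[OF x y] by blast
  then have "(\<lambda>e\<in>E. x e + c) \<in> ?S" using const_carrier[OF x, of "real c"] by (auto simp: le_L)
  then have ne: "?S \<noteq> {}" by blast
  obtain z where z: "z \<in> carrier L" "\<And>e. e \<in> E \<Longrightarrow> \<exists>s\<in>?S. z e = s e"
     "\<And>s e. s \<in> ?S \<Longrightarrow> e \<in> E \<Longrightarrow> z e \<le> s e"
  proof (rule ex_inf[of ?S x])
    show "?S \<noteq> {}" by (rule ne)
    show "x e \<le> s e" if "s \<in> ?S" "e \<in> E" for s e using that by (simp add: le_L)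
  qed auto
  have "z \<in> ?S"
  proof -
    have "x e \<le> z e \<and> y e \<le> z e" if "e \<in> E" for e using z(2)[OF that] that by (auto simp: le_L)
    then show ?thesis using z(1) by (simp add: le_L)
  qed
  then have "least L z (Upper L {x, y})" using x y z by (auto simp: least_def Upper_def le_L)
  moreover have "greatest L z (Lower L ?S)"
    using \<open>z \<in> ?S\<close> z(3) by (auto simp: greatest_def Lower_def le_L)
  then have "\<Sqinter>\<^bsub>L\<^esub>?S = z" by (rule inf_eqI)
  ultimately show ?thesis using that by metis
qed

lemma lattice_L: "lattice L"
proof -
  interpret lattice L
    proof unfold_locales
    fix x y assume xy: "x \<in> carrier L" "y \<in> carrier L"
    show "\<exists>s. least L s (Upper L {x, y})" using ex_join[OF xy] by blast
    show "\<exists>s. greatest L s (Lower L {x, y})" using greatest_min[OF xy] by blast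
  qed
  show ?thesis by unfold_locales
qed

sublocale L: lattice L
  by (rule lattice_L)

lemma join_eq_inf:
  assumes "x \<in> carrier L" "y \<in> carrier L"
  shows "x \<squnion>\<^bsub>L\<^esub> y = \<Sqinter>\<^bsub>L\<^esub>{z \<in> carrier L. x \<sqsubseteq>\<^bsub>L\<^esub> z \<and> y \<sqsubseteq>\<^bsub>L\<^esub> z}"
proof -
  obtain z where z: "least L z (Upper L {x, y})"
    "z = \<Sqinter>\<^bsub>L\<^esub>{z \<in> carrier L. x \<sqsubseteq>\<^bsub>L\<^esub> z \<and> y \<sqsubseteq>\<^bsub>L\<^esub> z}"
    using ex_join[OF assms] .
  then show ?thesis using sup_eqI[OF z(1)] by (simp add: join_def)
qed

lemma join_eqI:
  assumes "x \<in> carrier L" "y \<in> carrier L" "z \<in> carrier L" "x \<sqsubseteq>\<^bsub>L\<^esub> z" "y \<sqsubseteq>\<^bsub>L\<^esub> z"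
    "\<And>u. u \<in> carrier L \<Longrightarrow> x \<sqsubseteq>\<^bsub>L\<^esub> u \<Longrightarrow> y \<sqsubseteq>\<^bsub>L\<^esub> u \<Longrightarrow> z \<sqsubseteq>\<^bsub>L\<^esub> u"
  shows "x \<squnion>\<^bsub>L\<^esub> y = z"
  by (rule L.le_antisym) (use assms L.join_le L.join_left L.join_right in auto)

section \<open>Rank-one flats and the covering relation\<close>

text \<open>The rank-one flat spanned by \<open>e\<close> in the matroid of maximizers of \<open>\<omega> + x\<close>.\<close>
definition atom :: "('a \<Rightarrow> real) \<Rightarrow> 'a \<Rightarrow> 'a set" where
  "atom x e = {g \<in> E. g = e \<or> \<not> (\<exists>B\<in>M x. e \<in> B \<and> g \<in> B)}"

definition step :: "('a \<Rightarrow> real) \<Rightarrow> 'a \<Rightarrow> 'a \<Rightarrow> real" where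
  "step x e = (\<lambda>g\<in>E. x g + indicat_real (atom x e) g)"

lemma atom_self: "e \<in> E \<Longrightarrow> e \<in> atom x e"
  by (simp add: atom_def)

lemma pcD: "g \<in> atom x e \<Longrightarrow> g \<noteq> e \<Longrightarrow> B \<in> M x \<Longrightarrow> e \<in> B \<Longrightarrow> g \<in> B \<Longrightarrow> False"
  by (auto simp: atom_def)

lemma atom_sym: "g \<in> atom x e \<Longrightarrow> e \<in> E \<Longrightarrow> e \<in> atom x g"
  by (auto simp: atom_def)

text \<open>Transitivity of parallelism among maximizers. If an optimal base contained both
  \<open>g\<close> and \<open>h\<close>, exchanging \<open>e\<close> into it would remove only one
  element and leave \<open>e\<close> next to \<open>g\<close> or \<open>h\<close> in an optimal
  base.\<close>

lemma atom_trans: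
  assumes x: "x \<in> carrier L" and "g \<in> atom x e" "h \<in> atom x e" "e \<in> E" shows "g \<in> atom x h"
proof (rule ccontr)
  assume "g \<notin> atom x h"
  then obtain A where A: "A \<in> M x" "h \<in> A" "g \<in> A" and "g \<noteq> h" using assms by (auto simp: atom_def)
  obtain A' where A': "A' \<in> M x" "e \<in> A'" using carrierD(5)[OF x] assms by blast
  have "e \<notin> A"
    using assms A \<open>g \<noteq> h\<close> by (auto simp: atom_def)
  then obtain f where f: "f \<in> A - A'" "insert f (A' - {e}) \<in> \<B>" "insert e (A - {f}) \<in> \<B>"
    "vm_add \<omega> x A' + vm_add \<omega> x A
      \<le> vm_add \<omega> x (insert f (A' - {e})) + vm_add \<omega> x (insert e (A - {f}))"
    using exchange[OF maximizersD(1)[OF A'(1)] maximizersD(1)[OF A(1)], of e] A' by blast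
  have "vm_add \<omega> x (insert f (A' - {e})) \<le> vm_add \<omega> x A'" using maximizersD(2)[OF A'(1) f(2)] .
  then have "insert e (A - {f}) \<in> M x" using maximizersI[OF A(1) f(3)] f(4) by simp
  moreover have "g \<in> A - {f} \<or> h \<in> A - {f}" using A \<open>g \<noteq> h\<close> by blast
  moreover have "g \<noteq> e" "h \<noteq> e" using \<open>e \<notin> A\<close> A(2,3) by auto
  ultimately show False using pcD[OF assms(2), of "insert e (A - {f})"] pcD[OF assms(3), of "insert e (A - {f})"] by blast
qed

lemma atom_cong:
  assumes x: "x \<in> carrier L" and "g \<in> atom x e" "e \<in> E" shows "atom x g = atom x e"
proof -
  have g: "g \<in> E" "e \<in> atom x g" using assms atom_sym by (auto simp: atom_def)
  then show ?thesis using atom_trans[OF x] atom_self assms by blast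
qed

lemma atom_base:
  assumes "A \<in> M x" "e \<in> A" shows "A \<inter> atom x e = {e}"
  using assms baseD(1)[OF maximizersD(1)[OF assms(1)]] by (auto simp: atom_def)

lemma card_atom_base:
  assumes x: "x \<in> carrier L" and e: "e \<in> E" and A: "A \<in> M x" shows "card (A \<inter> atom x e) \<le> 1"
proof (cases "A \<inter> atom x e = {}")
  case False
  then obtain g where g: "g \<in> A" "g \<in> atom x e" by blast
  then show ?thesis using atom_base[OF A g(1)] atom_cong[OF x g(2) e] by simp
qed simp

lemma vm_add_step:
  assumes "B \<in> \<B>" shows "vm_add \<omega> (step x e) B = vm_add \<omega> x B + card (B \<inter> atom x e)"
proof -
  have "sum (step x e) B = (\<Sum>g\<in>B. x g + indicat_real (atom x e) g)"
    unfolding step_def using baseD[OF assms] by (intro sum.cong) auto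
  moreover have "sum (indicat_real (atom x e)) B = card (B \<inter> atom x e)"
    using baseD(2)[OF assms] by (simp add: indicator_def sum.If_cases)
  ultimately show ?thesis by (simp add: vm_add_def sum.distrib)
qed

text \<open>The base \<open>A\<close> meets the flat once and gains 1. A neighbour that is optimal
  at \<open>x\<close> also meets the flat at most once; a neighbour that is not has lost at least 1
  by integrality, and has at most two elements in the flat because a swap adds only one. So no
  neighbour overtakes \<open>A\<close>.\<close>

lemma step_M:
  assumes x: "x \<in> carrier L" and e: "e \<in> E" and A: "A \<in> M x" "A \<inter> atom x e \<noteq> {}"
  shows "A \<in> M (step x e)" "vm_add \<omega> (step x e) A = r x + 1"
proof -
  have fin: "finite A" using baseD maximizersD(1)[OF A(1)] by blast
  have "card (A \<inter> atom x e) \<noteq> 0" using fin A(2) by simp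
  then have c1: "card (A \<inter> atom x e) = 1" using card_atom_base[OF x e A(1)] by linarith
  then obtain a where a: "A \<inter> atom x e = {a}" by (metis card_1_singletonE)
  show val: "vm_add \<omega> (step x e) A = r x + 1"
    using vm_add_step[OF maximizersD(1)[OF A(1)]] c1 r_eq[OF A(1)] by simp
  show "A \<in> M (step x e)"
  proof (rule local_optimum[OF maximizersD(1)[OF A(1)]])
    fix f g assume f: "f \<in> A" and g: "g \<in> E - A" and B: "insert g (A - {f}) \<in> \<B>"
    let ?B = "insert g (A - {f})"
    show "vm_add \<omega> (step x e) ?B \<le> vm_add \<omega> (step x e) A"
    proof (cases "?B \<in> M x")
      case True
      then show ?thesis using vm_add_step[OF B] card_atom_base[OF x e True] val r_eq[OF True] by simp
    next
      case False
      then have "vm_add \<omega> x ?B < r x" using maximizers_iff[OF x] le_r[OF x B] B by force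
      then have "vm_add \<omega> x ?B + 1 \<le> r x"
        using Ints_less_imp_le[OF vm_add_Ints[of x, OF carrierD(3)[OF x] B] r_Ints[OF x]] by blast
      moreover have "?B \<inter> atom x e \<subseteq> {a, g}" using a by auto
      then have "card (?B \<inter> atom x e) \<le> 2"
        using card_mono[of "{a,g}" "?B \<inter> atom x e"] card_insert_le_m1[of 2 "{g}" a] by (auto simp: card_insert_if split: if_splits)
      ultimately show ?thesis using vm_add_step[OF B, of x e] val by simp
    qed
  qed
qed

lemma step_carrier:
  assumes x: "x \<in> carrier L" and e: "e \<in> E"
  shows "step x e \<in> carrier L" "r (step x e) = r x + 1"
proof -
  obtain A where A: "A \<in> M x" "e \<in> A" using carrierD(5)[OF x] e by blast
  have AS: "A \<in> M (step x e)" using step_M(1)[OF x e A(1)] A(2) atom_self[OF e] by blast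
  show "r (step x e) = r x + 1"
    using r_eq[OF AS] step_M(2)[OF x e A(1)] A(2) atom_self[OF e] by auto
  have "\<exists>B\<in>M (step x e). g \<in> B" if g: "g \<in> E" for g
  proof (cases "g \<in> atom x e")
    case True
    obtain B where B: "B \<in> M x" "g \<in> B" using carrierD(5)[OF x] g by blast
    then show ?thesis using step_M(1)[OF x e B(1)] True by blast
  next
    case False
    then obtain B where B: "B \<in> M x" "g \<in> B" "e \<in> B" using g by (auto simp: atom_def)
    then show ?thesis using step_M(1)[OF x e B(1)] atom_self[OF e] by blast
  qed
  then have "step x e \<in> T" using AS by (auto simp: tropical_space_def step_def)
  then show "step x e \<in> carrier L" using carrierD(3)[OF x] by (auto simp: carrier_L step_def indicator_def)
qed

lemma step_ge: "x \<sqsubseteq>\<^bsub>L\<^esub> step x e"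
  by (simp add: le_L step_def indicator_def)

lemma step_apply: "e \<in> E \<Longrightarrow> step x e e = x e + 1"
  by (simp add: step_def atom_self)

text \<open>Suppose \<open>y\<close> does not exceed \<open>x\<close> at some \<open>g\<close> in
  the flat of \<open>e\<close>. A swap of \<open>g\<close> into an optimal base through
  \<open>e\<close> that loses nothing at \<open>y\<close> then loses nothing at \<open>x\<close>,
  and it removes an element where \<open>x\<close> and \<open>y\<close> agree. That element is not
  \<open>e\<close>, so \<open>e\<close> and \<open>g\<close> would share an optimal base.\<close>

lemma step_le:
  assumes x: "x \<in> carrier L" and y: "y \<in> carrier L" and le: "x \<sqsubseteq>\<^bsub>L\<^esub> y" and e: "e \<in> E" "x e < y e"
  shows "step x e \<sqsubseteq>\<^bsub>L\<^esub> y"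
proof -
  have "x g + 1 \<le> y g" if g: "g \<in> atom x e" for g
  proof (rule ccontr)
    have gE: "g \<in> E" using g by (simp add: atom_def)
    assume "\<not> ?thesis"
    then have gy: "y g = x g" using Ints_less_imp_le[OF carrierD(3)[OF x gE] carrierD(3)[OF y gE]] le gE
      by (force simp: le_L)
    then have "g \<noteq> e" using e by auto
    obtain A where A: "A \<in> M x" "e \<in> A" using carrierD(5)[OF x] e by blast
    then have gA: "g \<notin> A" using g \<open>g \<noteq> e\<close> by (auto simp: atom_def)
    obtain f where f: "f \<in> A" "insert g (A - {f}) \<in> \<B>" "vm_add \<omega> y A \<le> vm_add \<omega> y (insert g (A - {f}))"
      using swap_in[OF carrierD(1)[OF y] maximizersD(1)[OF A(1)], of g] gA gE by blast
    note sw = vm_add_swap[OF maximizersD(1)[OF A(1)] f(1) gA, of x] vm_add_swap[OF maximizersD(1)[OF A(1)] f(1) gA, of y]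
    have "x f \<le> y f" using le f(1) baseD(1)[OF maximizersD(1)[OF A(1)]] by (auto simp: le_L)
    then have M: "insert g (A - {f}) \<in> M x" and "x f = y f"
      using maximizersI[OF A(1) f(2)] maximizersD(2)[OF A(1) f(2)] f(3) sw gy by auto
    then have "f \<noteq> e" using e by auto
    then show False using pcD[OF g \<open>g \<noteq> e\<close> M] A(2) by blast
  qed
  then show ?thesis using le by (auto simp: le_L step_def indicator_def)
qed

text \<open>By \<open>step_le\<close> a point strictly above \<open>x\<close> is above some step,
  and a step raises \<open>r\<close> by exactly 1, which leaves no room for a point strictly in
  between.\<close>

lemma covers_iff: "covers L x y \<longleftrightarrow> x \<in> carrier L \<and> (\<exists>e\<in>E. y = step x e)"
proof
  assume c: "covers L x y"
  then have xy: "x \<in> carrier L" "y \<in> carrier L" "x \<sqsubset>\<^bsub>L\<^esub> y"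
    and no: "\<And>z. z \<in> carrier L \<Longrightarrow> x \<sqsubset>\<^bsub>L\<^esub> z \<Longrightarrow> \<not> z \<sqsubset>\<^bsub>L\<^esub> y" by (auto simp: covers_def)
  then obtain e where e: "e \<in> E" "x e < y e"
    using carrier_eqI[of x y] by (metis less_L order_less_le)
  have "step x e \<sqsubseteq>\<^bsub>L\<^esub> y" using step_le xy e by (auto simp: less_L le_L)
  moreover have "x \<sqsubset>\<^bsub>L\<^esub> step x e" using step_ge step_apply[OF e(1), of x] by (auto simp: L.lless_eq)
  ultimately have "step x e = y" using no step_carrier[OF xy(1) e(1)] by (auto simp: L.lless_eq)
  with xy e show "x \<in> carrier L \<and> (\<exists>e\<in>E. y = step x e)" by blast
next
  assume "x \<in> carrier L \<and> (\<exists>e\<in>E. y = step x e)"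
  then obtain e where x: "x \<in> carrier L" and e: "e \<in> E" "y = step x e" by blast
  have "x \<sqsubset>\<^bsub>L\<^esub> y" using step_ge step_apply[OF e(1), of x] e by (auto simp: L.lless_eq)
  moreover have False if "z \<in> carrier L" "x \<sqsubset>\<^bsub>L\<^esub> z" "z \<sqsubset>\<^bsub>L\<^esub> y" for z
    using r_strict_mono[OF x that(1,2)] r_strict_mono[OF that(1) _ that(3)] step_carrier[OF x e(1)] e(2)
    by simp
  ultimately show "covers L x y" using x e step_carrier[OF x e(1)] by (auto simp: covers_def)
qed

lemma ex_step_below:
  assumes "x \<in> carrier L" "y \<in> carrier L" "x \<sqsubset>\<^bsub>L\<^esub> y"
  obtains e where "e \<in> E" "x e < y e" "step x e \<sqsubseteq>\<^bsub>L\<^esub> y"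
proof -
  obtain e where e: "e \<in> E" "x e < y e"
    using assms carrier_eqI[of x y] by (metis less_L order_less_le)
  with that show ?thesis using step_le[of x y e] assms by (auto simp: less_L le_L)
qed

text \<open>The step from the meet to \<open>a\<close> along \<open>e\<close> shows that the meet
  takes its value at \<open>e\<close> from \<open>x\<close>. So \<open>x e + 1 = a e\<close>, and
  the step from \<open>x\<close> along the same \<open>e\<close> is the join.\<close>

lemma covers_join:
  assumes x: "x \<in> carrier L" and a: "a \<in> carrier L" and c: "covers L (x \<sqinter>\<^bsub>L\<^esub> a) a"
  shows "covers L x (x \<squnion>\<^bsub>L\<^esub> a)"
proof -
  let ?z = "x \<sqinter>\<^bsub>L\<^esub> a"
  have z: "?z \<in> carrier L" using x a by simp
  obtain e where e: "e \<in> E" "a = step ?z e" using c by (auto simp: covers_iff)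
  have ae: "a e = ?z e + 1" using step_apply[OF e(1), of ?z] e(2) by simp
  have xe: "x e + 1 = a e" using ae e(1) by (auto simp: meet_eq[OF x a] min_def split: if_splits)
  let ?w = "step x e"
  note w = step_carrier[OF x e(1)]
  have zw: "?z \<sqsubseteq>\<^bsub>L\<^esub> ?w" using L.meet_left[OF x a] step_ge[of x e] by (auto simp: le_L intro: order_trans)
  have "?z e < ?w e" using ae xe step_apply[OF e(1), of x] by simp
  then have aw: "a \<sqsubseteq>\<^bsub>L\<^esub> ?w" using step_le[OF z w(1) zw e(1)] e(2) by simp
  have "?w \<sqsubseteq>\<^bsub>L\<^esub> u" if u: "u \<in> carrier L" "x \<sqsubseteq>\<^bsub>L\<^esub> u" "a \<sqsubseteq>\<^bsub>L\<^esub> u" for u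
  proof (rule step_le[OF x u(1,2) e(1)])
    show "x e < u e" using u(3) e(1) xe by (auto simp: le_L)
  qed
  then have "x \<squnion>\<^bsub>L\<^esub> a = ?w" using join_eqI[OF x a w(1) step_ge aw] by blast
  then show ?thesis using x e(1) covers_iff by auto
qed

section \<open>Chains and the rank of intervals\<close>

lemma chain_inj_r:
  assumes C: "pred_on.chain \<lbrace>x..y\<rbrace>\<^bsub>L\<^esub> (\<sqsubset>\<^bsub>L\<^esub>) C"
  shows "inj_on r C" "C \<subseteq> carrier L"
    "\<And>u v. u \<in> C \<Longrightarrow> v \<in> C \<Longrightarrow> r u < r v \<Longrightarrow> u \<sqsubset>\<^bsub>L\<^esub> v"
proof -
  have sub: "C \<subseteq> \<lbrace>x..y\<rbrace>\<^bsub>L\<^esub>" and tot: "\<And>u v. u \<in> C \<Longrightarrow> v \<in> C \<Longrightarrow> u = v \<or> u \<sqsubset>\<^bsub>L\<^esub> v \<or> v \<sqsubset>\<^bsub>L\<^esub> u"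
    using C by (auto simp: pred_on.chain_def)
  show carr: "C \<subseteq> carrier L" using sub by (auto simp: at_least_at_most_def)
  show "inj_on r C"
  proof (rule inj_onI)
    fix u v assume uv: "u \<in> C" "v \<in> C" "r u = r v"
    then have "u \<in> carrier L" "v \<in> carrier L" using carr by auto
    then have "\<not> u \<sqsubset>\<^bsub>L\<^esub> v" "\<not> v \<sqsubset>\<^bsub>L\<^esub> u" using r_strict_mono[of u v] r_strict_mono[of v u] uv(3) by force+
    then show "u = v" using tot[OF uv(1,2)] by blast
  qed
  show "u \<sqsubset>\<^bsub>L\<^esub> v" if "u \<in> C" "v \<in> C" "r u < r v" for u v
  proof -
    have "u \<in> carrier L" "v \<in> carrier L" using that carr by auto
    then have "\<not> v \<sqsubset>\<^bsub>L\<^esub> u" using r_strict_mono[of v u] that(3) by force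
    then show ?thesis using tot[OF that(1,2)] that(3) by blast
  qed
qed

lemma interval_r:
  assumes x: "x \<in> carrier L" and y: "y \<in> carrier L" and C: "C \<subseteq> \<lbrace>x..y\<rbrace>\<^bsub>L\<^esub>"
  shows "r ` C \<subseteq> {k \<in> \<int>. r x \<le> k \<and> k \<le> r y}"
proof
  fix k assume "k \<in> r ` C"
  then obtain u where "u \<in> C" and k: "k = r u" by blast
  then have u: "u \<in> carrier L" "x \<sqsubseteq>\<^bsub>L\<^esub> u" "u \<sqsubseteq>\<^bsub>L\<^esub> y" using C by (auto simp: at_least_at_most_def)
  then show "k \<in> {k \<in> \<int>. r x \<le> k \<and> k \<le> r y}"
    using r_mono[OF x u(1,2)] r_mono[OF u(1) y u(3)] r_Ints[OF u(1)] k by simp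
qed

lemma chain_finite:
  assumes x: "x \<in> carrier L" and y: "y \<in> carrier L" and C: "pred_on.chain \<lbrace>x..y\<rbrace>\<^bsub>L\<^esub> (\<sqsubset>\<^bsub>L\<^esub>) C"
  shows "finite C"
proof -
  have "C \<subseteq> \<lbrace>x..y\<rbrace>\<^bsub>L\<^esub>" using C by (simp add: pred_on.chain_def)
  then have "finite (r ` C)" by (rule finite_subset[OF interval_r[OF x y] finite_Ints_segment])
  then show ?thesis using chain_inj_r(1)[OF C] by (simp add: finite_image_iff)
qed

lemma finite_chains_L: "finite_chains L"
  unfolding finite_chains_def using chain_finite by blast

lemma semimodular_L: "semimodular_lattice L"
  unfolding semimodular_lattice_def using lattice_L finite_chains_L covers_join by blast

text \<open>The map \<open>r\<close> sends a maximal chain onto all integers between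
  \<open>r x\<close> and \<open>r y\<close>. If \<open>k\<close> were missed, the step from the
  highest member below \<open>k\<close> towards the lowest member above \<open>k\<close> would be
  comparable to the whole chain, hence a member, and its rank would contradict the choice of the
  former.\<close>

lemma maxchain_card:
  assumes x: "x \<in> carrier L" and y: "y \<in> carrier L" and le: "x \<sqsubseteq>\<^bsub>L\<^esub> y"
    and C: "pred_on.maxchain \<lbrace>x..y\<rbrace>\<^bsub>L\<^esub> (\<sqsubset>\<^bsub>L\<^esub>) C"
  shows "card C = Suc (nat \<lfloor>r y - r x\<rfloor>)"
proof -
  have ch: "pred_on.chain \<lbrace>x..y\<rbrace>\<^bsub>L\<^esub> (\<sqsubset>\<^bsub>L\<^esub>) C"
    and max: "\<And>D. pred_on.chain \<lbrace>x..y\<rbrace>\<^bsub>L\<^esub> (\<sqsubset>\<^bsub>L\<^esub>) D \<Longrightarrow> \<not> C \<subset> D"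
    using C by (auto simp: pred_on.maxchain_def)
  note inj = chain_inj_r(1)[OF ch] and carr = chain_inj_r(2)[OF ch] and lt = chain_inj_r(3)[OF ch]
  have sub: "C \<subseteq> \<lbrace>x..y\<rbrace>\<^bsub>L\<^esub>" and tot: "\<And>u v. u \<in> C \<Longrightarrow> v \<in> C \<Longrightarrow> u = v \<or> u \<sqsubset>\<^bsub>L\<^esub> v \<or> v \<sqsubset>\<^bsub>L\<^esub> u"
    using ch by (auto simp: pred_on.chain_def)
  have ins: "z \<in> C" if z: "z \<in> \<lbrace>x..y\<rbrace>\<^bsub>L\<^esub>" and cmp: "\<And>u. u \<in> C \<Longrightarrow> u \<sqsubseteq>\<^bsub>L\<^esub> z \<or> z \<sqsubseteq>\<^bsub>L\<^esub> u" for z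
  proof (rule ccontr)
    assume "z \<notin> C"
    moreover have "pred_on.chain \<lbrace>x..y\<rbrace>\<^bsub>L\<^esub> (\<sqsubset>\<^bsub>L\<^esub>) (insert z C)"
      unfolding pred_on.chain_def
    proof (intro conjI ballI)
      show "insert z C \<subseteq> \<lbrace>x..y\<rbrace>\<^bsub>L\<^esub>" using z sub by blast
      fix u v assume "u \<in> insert z C" "v \<in> insert z C"
      then show "(\<sqsubset>\<^bsub>L\<^esub>)\<^sup>=\<^sup>= u v \<or> (\<sqsubset>\<^bsub>L\<^esub>)\<^sup>=\<^sup>= v u"
        using tot[of u v] cmp[of u] cmp[of v] by (auto simp: L.lless_eq)
    qed
    ultimately show False using max[of "insert z C"] by blast
  qed
  have bd: "x \<sqsubseteq>\<^bsub>L\<^esub> u" "u \<sqsubseteq>\<^bsub>L\<^esub> y" if "u \<in> C" for u using sub that by (auto simp: at_least_at_most_def)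
  have xC: "x \<in> C" by (rule ins) (use bd x y le in \<open>auto simp: at_least_at_most_def\<close>)
  have yC: "y \<in> C" by (rule ins) (use bd x y le in \<open>auto simp: at_least_at_most_def\<close>)
  have "k \<in> r ` C" if k: "k \<in> \<int>" "r x \<le> k" "k \<le> r y" for k
  proof (rule ccontr)
    assume nk: "k \<notin> r ` C"
    have fin: "finite C" using chain_finite[OF x y ch] .
    define U where "U = {u \<in> C. r u < k}"
    define V where "V = {u \<in> C. k < r u}"
    have "x \<in> U" "y \<in> V" using k nk xC yC by (auto simp: U_def V_def less_le)
    have finU: "finite U" and finV: "finite V" using fin by (auto simp: U_def V_def)
    have "Max (r ` U) \<in> r ` U" using finU \<open>x \<in> U\<close> by (intro Max_in) auto
    then obtain u where u0: "u \<in> U" "Max (r ` U) = r u" by blast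
    have u: "u \<in> U" "\<And>u'. u' \<in> U \<Longrightarrow> r u' \<le> r u"
      using u0(1) Max_ge[of "r ` U"] finU unfolding u0(2)[symmetric] by auto
    have "Min (r ` V) \<in> r ` V" using finV \<open>y \<in> V\<close> by (intro Min_in) auto
    then obtain v where v0: "v \<in> V" "Min (r ` V) = r v" by blast
    have v: "v \<in> V" "\<And>v'. v' \<in> V \<Longrightarrow> r v \<le> r v'"
      using v0(1) Min_le[of "r ` V"] finV unfolding v0(2)[symmetric] by auto
    have uC: "u \<in> C" "r u < k" and vC: "v \<in> C" "k < r v" using u v by (auto simp: U_def V_def)
    have uv: "u \<sqsubset>\<^bsub>L\<^esub> v" using lt uC vC by force
    have uc: "u \<in> carrier L" and vc: "v \<in> carrier L" using uC vC carr by auto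
    obtain e where e: "e \<in> E" "u e < v e" "step u e \<sqsubseteq>\<^bsub>L\<^esub> v"
      by (rule ex_step_below[OF uc vc uv])
    note s = step_carrier[OF uc e(1)]
    have us: "u \<sqsubseteq>\<^bsub>L\<^esub> step u e" by (rule step_ge)
    have "r u + 1 \<le> k" using Ints_less_imp_le[OF r_Ints[OF uc] k(1) uC(2)] .
    have "step u e \<in> C"
    proof (rule ins)
      show "step u e \<in> \<lbrace>x..y\<rbrace>\<^bsub>L\<^esub>"
        using sub uC(1) vC(1) s(1) us e(3) uc vc x y L.le_trans[of x u "step u e"] L.le_trans[of "step u e" v y]
        by (auto simp: at_least_at_most_def)
      fix c assume c: "c \<in> C"
      then have cc: "c \<in> carrier L" using carr by blast
      have "r c \<noteq> k" using nk c by blast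
      then consider "c \<in> U" | "c \<in> V" using c by (force simp: U_def V_def)
      then show "c \<sqsubseteq>\<^bsub>L\<^esub> step u e \<or> step u e \<sqsubseteq>\<^bsub>L\<^esub> c"
      proof cases
        case 1
        then have "c = u \<or> c \<sqsubset>\<^bsub>L\<^esub> u"
          using u(2)[OF 1] lt[of c u] inj c uC(1) by (force simp: inj_on_def less_le)
        then show ?thesis using us cc uc s L.le_trans[of c u "step u e"] by (auto simp: L.lless_eq)
      next
        case 2
        then have "c = v \<or> v \<sqsubset>\<^bsub>L\<^esub> c"
          using v(2)[OF 2] lt[of v c] inj c vC(1) by (force simp: inj_on_def less_le)
        then show ?thesis using e(3) cc vc s L.le_trans[of "step u e" v c] by (auto simp: L.lless_eq)
      qed
    qed
    then have "step u e \<in> U \<or> step u e \<in> V" using nk by (force simp: U_def V_def)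
    then show False using u(2)[of "step u e"] v(1) s(2) nk \<open>r u + 1 \<le> k\<close> \<open>step u e \<in> C\<close>
      by (auto simp: U_def V_def)
  qed
  then have img: "r ` C = {k \<in> \<int>. r x \<le> k \<and> k \<le> r y}" using interval_r[OF x y sub] by blast
  obtain i j where ij: "r x = of_int i" "r y = of_int j" using r_Ints x y by (metis Ints_cases)
  have "i \<le> j" using r_mono[OF x y le] ij by simp
  have "{k \<in> \<int>. r x \<le> k \<and> k \<le> r y} = of_int ` {i..j}" using ij by (auto elim!: Ints_cases)
  then have "card (r ` C) = nat (j - i + 1)" using img by (simp add: card_image[of real_of_int] inj_on_def)
  then have "card C = nat (j - i + 1)" using card_image[OF inj] by simp
  moreover have "\<lfloor>r y - r x\<rfloor> = j - i" using ij by (metis floor_of_int of_int_diff)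
  ultimately show ?thesis using \<open>i \<le> j\<close> by simp
qed

lemma interval_rank_eq:
  assumes x: "x \<in> carrier L" and y: "y \<in> carrier L" and le: "x \<sqsubseteq>\<^bsub>L\<^esub> y"
  shows "real (interval_rank L x y) = r y - r x"
proof -
  \<comment> \<open>Without a maximal chain every number would satisfy the condition in
    \<open>interval_rank\<close>; its existence makes the number unique.\<close>
  obtain C where C: "pred_on.maxchain \<lbrace>x..y\<rbrace>\<^bsub>L\<^esub> (\<sqsubset>\<^bsub>L\<^esub>) C"
    using pred_on.Hausdorff by blast
  have fin: "finite D" if "pred_on.maxchain \<lbrace>x..y\<rbrace>\<^bsub>L\<^esub> (\<sqsubset>\<^bsub>L\<^esub>) D" for D
    using chain_finite[OF x y] that by (auto simp: pred_on.maxchain_def)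
  have "interval_rank L x y = nat \<lfloor>r y - r x\<rfloor>"
    unfolding interval_rank_def
    by (rule the_equality) (use maxchain_card[OF x y le] C fin in force)+
  moreover have "r y - r x \<in> \<int>" using r_Ints x y by simp
  moreover have "0 \<le> r y - r x" using r_mono[OF x y le] by simp
  ultimately show ?thesis by (auto elim!: Ints_cases)
qed

section \<open>The ascending operator, uniformity and height\<close>

lemma asc_least:
  assumes x: "x \<in> carrier L" shows "least L (\<lambda>e\<in>E. x e + 1) (Upper L {y. covers L x y})"
  unfolding least_def
proof (intro conjI ballI)
  have "step x e \<sqsubseteq>\<^bsub>L\<^esub> (\<lambda>e\<in>E. x e + 1)" for e by (auto simp: le_L step_def indicator_def)
  then show "(\<lambda>e\<in>E. x e + 1) \<in> Upper L {y. covers L x y}"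
    using const_carrier[OF x, of 1] by (auto simp: Upper_def covers_iff)
  fix u assume u: "u \<in> Upper L {y. covers L x y}"
  have "x e + 1 \<le> u e" if e: "e \<in> E" for e
  proof -
    have "step x e \<sqsubseteq>\<^bsub>L\<^esub> u" using u x e step_carrier[OF x e] by (auto simp: Upper_def covers_iff)
    then show ?thesis using step_apply[OF e, of x] e by (auto simp: le_L)
  qed
  then show "(\<lambda>e\<in>E. x e + 1) \<sqsubseteq>\<^bsub>L\<^esub> u" by (simp add: le_L)
qed (auto simp: Upper_def)

lemma asc_eq: "x \<in> carrier L \<Longrightarrow> asc L x = (\<lambda>e\<in>E. x e + 1)"
  unfolding asc_def by (rule sup_eqI[OF asc_least])

lemma asc_inverse:
  assumes x: "x \<in> carrier L" shows "asc L (\<lambda>e\<in>E. x e + - 1) = x"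
proof -
  have "(\<lambda>e\<in>E. x e + - 1) \<in> carrier L" using const_carrier[OF x, of "-1"] by simp
  then show ?thesis using asc_eq carrierD(2)[OF x] by (auto simp: fun_eq_iff extensional_def)
qed

lemma asc_bij: "bij_betw (asc L) (carrier L) (carrier L)"
  unfolding bij_betw_def
proof
  show "inj_on (asc L) (carrier L)"
  proof (rule inj_onI)
    fix x y assume xy: "x \<in> carrier L" "y \<in> carrier L" "asc L x = asc L y"
    show "x = y"
    proof (rule carrier_eqI[OF xy(1,2)])
      fix e assume "e \<in> E"
      then show "x e = y e" using xy asc_eq by (metis add_right_cancel restrict_apply')
    qed
  qed
  show "asc L ` carrier L = carrier L"
  proof
    show "asc L ` carrier L \<subseteq> carrier L" using asc_eq const_carrier[of _ 1] by auto
    show "carrier L \<subseteq> asc L ` carrier L"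
    proof
      fix x assume x: "x \<in> carrier L"
      then show "x \<in> asc L ` carrier L" using asc_inverse[OF x] const_carrier[OF x, of "-1"] by (metis Ints_1 Ints_minus imageI)
    qed
  qed
qed

lemma uniform_L: "uniform_semimodular_lattice L"
  unfolding uniform_semimodular_lattice_def
proof (intro conjI ballI)
  show "order_emb L L (asc L)"
    unfolding order_emb_def using L.weak_partial_order_axioms asc_eq by (simp add: le_L)
qed (use semimodular_L asc_least asc_bij in blast)+

lemma uniform_rank_L: "has_uniform_rank L n"
  unfolding has_uniform_rank_def
proof
  fix x assume x: "x \<in> carrier L"
  have "real (interval_rank L x (asc L x)) = n"
    using interval_rank_eq[OF x, of "asc L x"] const_carrier[OF x, of 1] r_const[OF x, of 1]
    by (simp add: asc_eq[OF x] le_L)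
  then show "interval_rank L x (asc L x) = n" by simp
qed

lemma height_L: "height_function L r"
  unfolding height_function_def using r_Ints step_carrier(2) by (auto simp: covers_iff)

lemma carrier_nonempty:
  assumes nl: "\<And>e. e \<in> E \<Longrightarrow> \<not> is_loop \<B> e" shows "carrier L \<noteq> {}"
proof -
  obtain A where A: "A \<in> \<B>" using bases_nonempty by blast
  obtain z where "z \<in> T" "(\<forall>f\<in>A. (0::real) \<in> \<int>) \<Longrightarrow> (\<forall>B\<in>\<B>. \<omega> B \<in> \<int>) \<Longrightarrow> (\<forall>e\<in>E. z e \<in> \<int>)"
    using ex_tropical_of_base[OF nl A, of "\<lambda>_. 0"] by metis
  then have "z \<in> carrier L" using int by (simp add: carrier_L)
  then show ?thesis by blast
qed

section \<open>Rays\<close>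

text \<open>The ray towards the element \<open>e\<close> of \<open>E\<close>. Every ray coincides
  with one of these up to any given index, so they serve as finite approximations of arbitrary
  rays.\<close>

definition eray :: "('a \<Rightarrow> real) \<Rightarrow> 'a \<Rightarrow> nat \<Rightarrow> 'a \<Rightarrow> real" where
  "eray x e k = ((\<lambda>y. step y e) ^^ k) x"

text \<open>For a ray this is the flat raised at index \<open>l\<close>. Reading it off the
  coordinates makes it independent of the choice of a spanning element.\<close>

definition directions :: "(nat \<Rightarrow> 'a \<Rightarrow> real) \<Rightarrow> nat \<Rightarrow> 'a set" where
  "directions a l = {g \<in> E. a l g < a (Suc l) g}"

lemma eray_0 [simp]: "eray x e 0 = x"
  by (simp add: eray_def)

lemma eray_Suc: "eray x e (Suc k) = step (eray x e k) e"
  by (simp add: eray_def)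

lemma eray_carrier:
  assumes "x \<in> carrier L" "e \<in> E"
  shows "eray x e k \<in> carrier L" "r (eray x e k) = r x + k"
proof -
  have "eray x e k \<in> carrier L \<and> r (eray x e k) = r x + k"
    by (induction k) (use assms step_carrier in \<open>auto simp: eray_Suc\<close>)
  then show "eray x e k \<in> carrier L" "r (eray x e k) = r x + k" by auto
qed

lemma eray_apply: "e \<in> E \<Longrightarrow> eray x e k e = x e + k"
  by (induction k) (auto simp: eray_Suc step_apply)

lemma eray_ge: "g \<in> E \<Longrightarrow> x g \<le> eray x e k g"
proof (induction k)
  case (Suc k)
  then show ?case using step_ge[of "eray x e k" e] by (force simp: eray_Suc le_L)
qed simp

text \<open>Thus \<open>eray x e k\<close> is the least point above \<open>x\<close> whose value at
  \<open>e\<close> is at least \<open>x e + k\<close>; joins with rays are computed from this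
  property.\<close>

lemma eray_le:
  assumes x: "x \<in> carrier L" and u: "u \<in> carrier L" and le: "x \<sqsubseteq>\<^bsub>L\<^esub> u" and e: "e \<in> E"
  shows "x e + real k \<le> u e \<Longrightarrow> eray x e k \<sqsubseteq>\<^bsub>L\<^esub> u"
proof (induction k)
  case (Suc k)
  then show ?case
    using step_le[OF eray_carrier(1)[OF x e] u _ e] eray_apply[OF e, of x k] by (simp add: eray_Suc)
qed (use le in simp)

lemma less_step_iff: "g \<in> E \<Longrightarrow> x g < step x e g \<longleftrightarrow> g \<in> atom x e"
  by (simp add: step_def indicator_def)

lemma directions_eray: "directions (eray x e) l = atom (eray x e l) e"
  unfolding directions_def eray_Suc using less_step_iff by (auto simp: atom_def)

lemma step_cong: "x \<in> carrier L \<Longrightarrow> h \<in> atom x e \<Longrightarrow> e \<in> E \<Longrightarrow> step x h = step x e"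
  unfolding step_def using atom_cong by simp

lemma rays_iff:
  "a \<in> rays L \<longleftrightarrow> (\<forall>l. covers L (a l) (a (Suc l))) \<and>
     (\<forall>l. a (Suc (Suc l)) \<notin> \<lbrace>a l .. asc L (a l)\<rbrace>\<^bsub>L\<^esub>)"
  unfolding rays_def is_segment_def by blast

lemma rayD:
  assumes a: "a \<in> rays L"
  shows "a l \<in> carrier L" "r (a l) = r (a 0) + l" "directions a l \<noteq> {}"
    "h \<in> directions a l \<Longrightarrow> a (Suc l) = step (a l) h" "h \<in> directions a l \<Longrightarrow> directions a l = atom (a l) h"
proof -
  have "covers L (a l) (a (Suc l))" for l using a by (simp add: rays_iff)
  then have st: "a l \<in> carrier L \<and> (\<exists>e\<in>E. a (Suc l) = step (a l) e)" for l by (simp add: covers_iff)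
  show "a l \<in> carrier L" using st by blast
  show "r (a l) = r (a 0) + l"
  proof (induction l)
    case (Suc l)
    obtain e where "e \<in> E" "a (Suc l) = step (a l) e" using st[of l] by blast
    then show ?case using step_carrier(2)[of "a l" e] st[of l] Suc by simp
  qed simp
  obtain e where e: "e \<in> E" "a (Suc l) = step (a l) e" using st[of l] by blast
  have F: "directions a l = atom (a l) e"
    unfolding directions_def e(2) using less_step_iff by (auto simp: atom_def)
  then show "directions a l \<noteq> {}" using atom_self[OF e(1)] by blast
  show "a (Suc l) = step (a l) h" "directions a l = atom (a l) h" if "h \<in> directions a l"
    using that F e step_cong[of "a l" h e] atom_cong[of "a l" h e] st[of l] by auto
qed

text \<open>The segment condition says that some \<open>h\<close> rises in both steps, so both flats
  are spanned by \<open>h\<close>. An element outside the first flat shares an optimal base with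
  \<open>h\<close>; that base stays optimal after the step, so the element is outside the second
  flat too.\<close>

lemma directions_Suc:
  assumes a: "a \<in> rays L" shows "directions a (Suc l) \<subseteq> directions a l"
proof
  fix g assume g: "g \<in> directions a (Suc l)"
  have c: "a l \<in> carrier L" "a (Suc l) \<in> carrier L" "a (Suc (Suc l)) \<in> carrier L" using rayD(1)[OF a] by auto
  obtain e e' where e: "e \<in> directions a l" "e' \<in> directions a (Suc l)" using rayD(3)[OF a] by (meson ex_in_conv)
  have s1: "a (Suc l) = step (a l) e" and s2: "a (Suc (Suc l)) = step (a (Suc l)) e'"
    using rayD(4)[OF a] e by auto
  have up: "a l h \<le> a (Suc (Suc l)) h" if "h \<in> E" for h
    using step_ge[of "a l" e] step_ge[of "a (Suc l)" e'] that s1 s2 by (force simp: le_L)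
  have "\<not> a (Suc (Suc l)) \<sqsubseteq>\<^bsub>L\<^esub> asc L (a l)"
    using a c up by (auto simp: rays_iff at_least_at_most_def le_L)
  then obtain h where h: "h \<in> E" "a l h + 1 < a (Suc (Suc l)) h" by (auto simp: asc_eq[OF c(1)] le_L not_le)
  have "step y d h \<le> y h + 1" for y d using h(1) by (simp add: step_def indicator_def)
  then have "a (Suc l) h \<le> a l h + 1" "a (Suc (Suc l)) h \<le> a (Suc l) h + 1" using s1 s2 by metis+
  then have "h \<in> directions a l \<inter> directions a (Suc l)" using h by (simp add: directions_def)
  then have hF: "h \<in> directions a l" "h \<in> directions a (Suc l)" by auto
  have gE: "g \<in> E" using g by (simp add: directions_def)
  note F1 = rayD(5)[OF a hF(1)] and F2 = rayD(5)[OF a hF(2)] and s = rayD(4)[OF a hF(1)]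
  show "g \<in> directions a l"
  proof (rule ccontr)
    assume "g \<notin> directions a l"
    then have "g \<notin> atom (a l) h" using F1 by simp
    then obtain B where B: "B \<in> M (a l)" "h \<in> B" "g \<in> B" and "g \<noteq> h" using gE by (auto simp: atom_def)
    have "B \<in> M (a (Suc l))" using step_M(1)[OF c(1) h(1) B(1)] atom_self[OF h(1)] B(2) s by auto
    then show False using pcD[of g "a (Suc l)" h B] g F2 B \<open>g \<noteq> h\<close> by auto
  qed
qed

lemma directions_antimono:
  assumes a: "a \<in> rays L" shows "i \<le> j \<Longrightarrow> directions a j \<subseteq> directions a i"
  by (rule lift_Suc_antimono_le[of "directions a"]) (rule directions_Suc[OF a])

text \<open>The flats decrease, so an element of the flat at \<open>l\<close> lies in all earlier
  ones and each of these steps is the step along it. The last of them leads to index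
  \<open>l + 1\<close>.\<close>

lemma ray_approx:
  assumes a: "a \<in> rays L" and e: "e \<in> directions a l" shows "j \<le> Suc l \<Longrightarrow> a j = eray (a 0) e j"
proof (induction j)
  case (Suc j)
  then have "e \<in> directions a j" using directions_antimono[OF a, of j l] e by auto
  then show ?case using Suc rayD(4)[OF a] by (simp add: eray_Suc)
qed simp

lemma directions_approx:
  assumes "a \<in> rays L" "e \<in> directions a l" "j \<le> l" shows "directions a j = directions (eray (a 0) e) j"
proof -
  have "a j = eray (a 0) e j" "a (Suc j) = eray (a 0) e (Suc j)"
    using assms(3) by (intro ray_approx[OF assms(1,2)]; simp)+
  then show ?thesis unfolding directions_def by metis
qed

lemma directions_E: "directions a l \<subseteq> E" by (auto simp: directions_def)

lemma eray_ray:
  assumes x: "x \<in> carrier L" and e: "e \<in> E" shows "eray x e \<in> rays L"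
  unfolding rays_iff
proof (intro conjI allI)
  fix l
  note c = eray_carrier(1)[OF x e]
  show "covers L (eray x e l) (eray x e (Suc l))" using c e by (auto simp: covers_iff eray_Suc)
  have "\<not> eray x e (Suc (Suc l)) \<sqsubseteq>\<^bsub>L\<^esub> asc L (eray x e l)"
    using e eray_apply[OF e] by (force simp: asc_eq[OF c] le_L)
  then show "eray x e (Suc (Suc l)) \<notin> \<lbrace>eray x e l .. asc L (eray x e l)\<rbrace>\<^bsub>L\<^esub>"
    by (simp add: at_least_at_most_def)
qed

text \<open>The ray conditions concern three consecutive points at a time, so agreement with known
  rays on every finite stretch suffices, even if the approximating elements vary.\<close>

lemma rayI:
  assumes x: "a 0 \<in> carrier L" and ap: "\<And>l. \<exists>e\<in>E. \<forall>j\<le>l. a j = eray (a 0) e j"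
  shows "a \<in> rays L"
  unfolding rays_iff
proof (intro conjI allI)
  fix l
  obtain e where e: "e \<in> E" "\<forall>j\<le>Suc (Suc l). a j = eray (a 0) e j" using ap by blast
  have eqs: "a l = eray (a 0) e l" "a (Suc l) = eray (a 0) e (Suc l)"
    "a (Suc (Suc l)) = eray (a 0) e (Suc (Suc l))" using e(2) by (meson le_SucI order_refl)+
  show "covers L (a l) (a (Suc l))" "a (Suc (Suc l)) \<notin> \<lbrace>a l .. asc L (a l)\<rbrace>\<^bsub>L\<^esub>"
    using eray_ray[OF x e(1)] unfolding eqs rays_iff by auto
qed

lemma rays_eqI:
  assumes a: "a \<in> rays L" and b: "b \<in> rays L" and "a 0 = b 0" and int: "\<And>l. directions a l \<inter> directions b l \<noteq> {}"
  shows "a = b"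
proof
  fix l
  obtain e where "e \<in> directions a l" "e \<in> directions b l" using int by blast
  then show "a l = b l" using ray_approx[OF a, of e l l] ray_approx[OF b, of e l l] assms(3) by simp
qed

lemma directions_eq_of_inter:
  assumes a: "a \<in> rays L" and b: "b \<in> rays L" and "a 0 = b 0" and "directions a l \<inter> directions b l \<noteq> {}" "j \<le> l"
  shows "directions a j = directions b j"
proof -
  obtain e where "e \<in> directions a l" "e \<in> directions b l" using assms(4) by blast
  then show ?thesis using directions_approx[OF a _ assms(5), of e] directions_approx[OF b _ assms(5), of e] assms(3) by simp
qed

text \<open>The sets of directions of the rays from \<open>x\<close> are the balls of the ultrametric whose exponent
  is the largest value of \<open>\<omega> + x\<close> on the bases containing two given elements.\<close>
lemma directions_eray_le:
  assumes x: "x \<in> carrier L" and e: "e \<in> E" and g: "g \<in> directions (eray x e) l" "g \<noteq> e"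
    and B: "B \<in> \<B>" "e \<in> B" "g \<in> B"
  shows "vm_add \<omega> x B \<le> r x - (real l + 1)"
proof -
  let ?y = "eray x e (Suc l)"
  note ray = eray_ray[OF x e]
  have gl: "j \<le> Suc l \<Longrightarrow> eray x e j g = x g + j" for j
  proof (induction j)
    case (Suc j)
    then have "g \<in> directions (eray x e) j" using directions_antimono[OF ray, of j l] g(1) by auto
    then have "g \<in> atom (eray x e j) e" by (simp add: directions_eray)
    moreover from this have "g \<in> E" by (simp add: atom_def)
    ultimately show ?case using Suc by (simp add: eray_Suc step_def)
  qed simp
  have fin: "finite B" and BE: "B \<subseteq> E" using baseD B(1) by auto
  \<comment> \<open>Both \<open>e\<close> and \<open>g\<close> rise by \<open>l + 1\<close> on the
    way to \<open>?y\<close>, whereas the maximum over all bases rises by \<open>l + 1\<close> only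
    once; the surplus is what \<open>B\<close> lacks at \<open>x\<close>.\<close>
  have "(\<Sum>h\<in>{e,g}. ?y h - x h) \<le> (\<Sum>h\<in>B. ?y h - x h)"
    using B fin BE eray_ge by (intro sum_mono2) (auto simp: subset_eq)
  then have "2 * (real l + 1) \<le> sum ?y B - sum x B"
    using g(2) gl[of "Suc l"] eray_apply[OF e, of x "Suc l"] by (simp add: sum_subtractf)
  moreover have "vm_add \<omega> ?y B \<le> r x + Suc l"
    using le_r[OF eray_carrier(1)[OF x e] B(1), of "Suc l"] eray_carrier(2)[OF x e, of "Suc l"] by simp
  ultimately show ?thesis by (simp add: vm_add_def)
qed

text \<open>Let \<open>j\<close> be the first index whose flat omits \<open>g\<close>. Exchange
  \<open>g\<close> from a base through \<open>e\<close> and \<open>g\<close> that is optimal at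
  \<open>?a j\<close> into a base through \<open>e\<close> that is optimal along the whole ray. In
  the result only \<open>e\<close> and \<open>g\<close> have moved since \<open>x\<close>, by
  \<open>j\<close> each, while the maximum grew by \<open>j\<close>; so its value at
  \<open>x\<close> is \<open>r x - j\<close>.\<close>

lemma ex_base_not_directions_eray:
  assumes x: "x \<in> carrier L" and e: "e \<in> E" and g: "g \<in> E" "g \<notin> directions (eray x e) l" "g \<noteq> e"
  shows "\<exists>B\<in>\<B>. e \<in> B \<and> g \<in> B \<and> r x - real l \<le> vm_add \<omega> x B"
proof -
  note ray = eray_ray[OF x e]
  define j where "j = (LEAST j. g \<notin> directions (eray x e) j)"
  have j: "g \<notin> directions (eray x e) j" unfolding j_def by (rule LeastI, rule g(2))
  have jl: "j \<le> l" unfolding j_def by (rule Least_le, rule g(2))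
  have lt: "g \<in> directions (eray x e) i" if "i < j" for i using not_less_Least that unfolding j_def by blast
  let ?a = "eray x e"
  have c: "?a i \<in> carrier L" for i by (rule eray_carrier(1)[OF x e])
  have Fsub: "directions ?a i \<subseteq> directions ?a 0" for i by (rule directions_antimono[OF ray]) simp
  have gj: "i \<le> j \<Longrightarrow> ?a i g = x g + i" for i
  proof (induction i)
    case (Suc i)
    then have "g \<in> atom (?a i) e" using lt[of i] by (simp add: directions_eray)
    with Suc g(1) show ?case by (simp add: eray_Suc step_def)
  qed simp
  have outside: "h \<in> E \<Longrightarrow> h \<notin> directions ?a 0 \<Longrightarrow> ?a i h = x h" for i h
  proof (induction i)
    case (Suc i)
    then have "h \<notin> atom (?a i) e" using Fsub[of i] by (auto simp: directions_eray)
    with Suc show ?case by (simp add: eray_Suc step_def)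
  qed simp
  obtain A where A: "A \<in> M x" "e \<in> A" using carrierD(5)[OF x e] by blast
  have AF: "A \<inter> directions ?a 0 = {e}" using atom_base[OF A] by (simp add: directions_eray)
  have AM: "A \<in> M (?a i)" for i
  proof (induction i)
    case (Suc i)
    then show ?case using step_M(1)[OF c e Suc] A(2) atom_self[OF e] by (auto simp: eray_Suc)
  qed (use A in simp)
  obtain B where B: "B \<in> M (?a j)" "e \<in> B" "g \<in> B"
    using j g(1,3) by (auto simp: directions_eray atom_def)
  have AB: "A \<in> \<B>" "B \<in> \<B>" using maximizersD(1) A(1) B(1) by auto
  show ?thesis
  proof (cases "g \<in> A")
    case True
    then have "vm_add \<omega> x A = r x" using r_eq[OF A(1)] by simp
    then show ?thesis using True A AB by (intro bexI[of _ A]) auto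
  next
    case False
    obtain f where f: "f \<in> A - B" "insert f (B - {g}) \<in> \<B>" "insert g (A - {f}) \<in> \<B>"
      "vm_add \<omega> (?a j) B + vm_add \<omega> (?a j) A
        \<le> vm_add \<omega> (?a j) (insert f (B - {g})) + vm_add \<omega> (?a j) (insert g (A - {f}))"
      using exchange[OF AB(2,1), of g "?a j"] B False by blast
    let ?C = "insert g (A - {f})"
    have fe: "f \<noteq> e" using f B by auto
    have CM: "?C \<in> M (?a j)" using maximizersI[OF AM f(3)] maximizersD(2)[OF B(1) f(2)] f(4) by simp
    have "vm_add \<omega> (?a j) ?C = r x + j"
      using r_eq[OF CM] eray_carrier(2)[OF x e, of j] by simp
    moreover have "sum (?a j) ?C = sum x ?C + 2 * j"
    proof -
      have fin: "finite (A - {f})" using baseD(2)[OF AB(1)] by simp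
      have "sum (?a j) (A - {f} - {e}) = sum x (A - {f} - {e})"
        using outside AF baseD(1)[OF AB(1)] by (intro sum.cong) auto
      moreover have "sum z ?C = z g + z e + sum z (A - {f} - {e})" for z :: "'a \<Rightarrow> real"
        using fin False A(2) fe by (simp add: sum.remove[of "A - {f}" e])
      ultimately show ?thesis using gj[of j] eray_apply[OF e, of x j] by simp
    qed
    ultimately have "vm_add \<omega> x ?C = r x - j" by (simp add: vm_add_def)
    then show ?thesis using f(3) fe A(2) jl by (intro bexI[of _ ?C]) auto
  qed
qed

section \<open>Parallel rays and ends\<close>

lemma ex_nat_increment:
  assumes "x \<in> carrier L" "y \<in> carrier L" "e \<in> E" "x e \<le> y e"
  obtains l :: nat where "y e = x e + l"
proof -
  have "y e - x e \<in> \<int>" "0 \<le> y e - x e" using assms carrierD(3) by auto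
  then obtain i where i: "y e - x e = of_int i" "0 \<le> i" by (auto elim: Ints_cases)
  then have "y e = x e + nat i" by simp
  with that show ?thesis by blast
qed

lemma eray_join:
  assumes x: "x \<in> carrier L" and y: "y \<in> carrier L" and le: "x \<sqsubseteq>\<^bsub>L\<^esub> y" and e: "e \<in> E"
    and l: "y e = x e + real l"
  shows "eray x e (l + k) \<squnion>\<^bsub>L\<^esub> y = eray y e k"
proof (rule join_eqI)
  note cx = eray_carrier(1)[OF x e] and cy = eray_carrier(1)[OF y e]
  show "eray x e (l + k) \<in> carrier L" "y \<in> carrier L" "eray y e k \<in> carrier L" using cx cy y by auto
  show yk: "y \<sqsubseteq>\<^bsub>L\<^esub> eray y e k" using eray_ge by (auto simp: le_L)
  have xk: "x \<sqsubseteq>\<^bsub>L\<^esub> eray y e k" using L.le_trans[OF le yk x y cy] .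
  show "eray x e (l + k) \<sqsubseteq>\<^bsub>L\<^esub> eray y e k"
    by (rule eray_le[OF x cy xk e]) (use eray_apply[OF e, of y k] l in simp)
  fix u assume u: "u \<in> carrier L" "eray x e (l + k) \<sqsubseteq>\<^bsub>L\<^esub> u" "y \<sqsubseteq>\<^bsub>L\<^esub> u"
  have "eray x e (l + k) e \<le> u e" using u(2) e by (simp add: le_L)
  then show "eray y e k \<sqsubseteq>\<^bsub>L\<^esub> u"
    using eray_le[OF y u(1,3) e, of k] eray_apply[OF e, of x "l + k"] l by simp
qed

lemma ray_mono: "a \<in> rays L \<Longrightarrow> i \<le> j \<Longrightarrow> e \<in> E \<Longrightarrow> a i e \<le> a j e"
proof (induction j)
  case (Suc j)
  obtain h where "h \<in> directions a j" using rayD(3)[OF Suc.prems(1)] by blast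
  then have "a j e \<le> a (Suc j) e" using rayD(4)[OF Suc.prems(1)] step_ge[of "a j" h] Suc.prems(3) by (simp add: le_L)
  moreover have "i = Suc j \<or> a i e \<le> a j e" using Suc by (metis le_Suc_eq)
  ultimately show ?case by auto
qed simp

text \<open>The join of an \<open>x\<close>-ray with some \<open>y \<ge> x\<close> starts at the index \<open>l\<close> at which \<open>y\<close> leaves
  the ray, and this index is the increment \<open>y - x\<close> near the end.\<close>
lemma ray_join_approx:
  assumes a: "a \<in> rays L" and y: "y \<in> carrier L" and le: "a 0 \<sqsubseteq>\<^bsub>L\<^esub> y"
  obtains l where "\<And>e. e \<in> directions a l \<Longrightarrow> y e = a 0 e + real l"
    "\<And>k e j. e \<in> directions a (l + k) \<Longrightarrow> j \<le> Suc k \<Longrightarrow> ray_join L a y j = eray y e j"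
proof -
  note c = rayD(1)[OF a]
  define P where "P l \<longleftrightarrow> \<not> a (Suc l) \<sqsubseteq>\<^bsub>L\<^esub> y" for l
  obtain N :: nat where N: "r y - r (a 0) < N" using reals_Archimedean2 by blast
  \<comment> \<open>The rank along the ray is unbounded, so the ray cannot stay below
    \<open>y\<close>.\<close>
  have "P N"
  proof (rule ccontr)
    assume "\<not> P N"
    then have "r (a (Suc N)) \<le> r y" unfolding P_def using r_mono[OF c y] by blast
    then show False using rayD(2)[OF a, of "Suc N"] N by simp
  qed
  define l where "l = (LEAST l. P l)"
  have Pl: "P l" unfolding l_def by (rule LeastI, rule \<open>P N\<close>)
  have al: "a l \<sqsubseteq>\<^bsub>L\<^esub> y"
  proof (cases l)
    case 0
    then show ?thesis using le by simp
  next
    case (Suc m)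
    then have "\<not> P m" using not_less_Least[of m P] unfolding l_def by auto
    then show ?thesis using Suc by (simp add: P_def)
  qed
  have l_un: "l' = l" if "a l' \<sqsubseteq>\<^bsub>L\<^esub> y" "\<not> a (Suc l') \<sqsubseteq>\<^bsub>L\<^esub> y" for l'
  proof (rule antisym; rule ccontr)
    assume "\<not> l' \<le> l"
    then have "a (Suc l) \<sqsubseteq>\<^bsub>L\<^esub> y" using ray_mono[OF a, of "Suc l" l'] that(1) by (force simp: le_L intro: order_trans)
    then show False using Pl by (simp add: P_def)
  next
    assume "\<not> l \<le> l'"
    then have "a (Suc l') \<sqsubseteq>\<^bsub>L\<^esub> y" using ray_mono[OF a, of "Suc l'" l] al by (force simp: le_L intro: order_trans)
    then show False using that by simp
  qed
  have "(THE l. a l \<sqsubseteq>\<^bsub>L\<^esub> y \<and> \<not> a (Suc l) \<sqsubseteq>\<^bsub>L\<^esub> y) = l"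
    using al Pl unfolding P_def by (intro the_equality) (simp, rule l_un, simp_all)
  then have rj: "ray_join L a y j = a (l + j) \<squnion>\<^bsub>L\<^esub> y" for j by (simp add: ray_join_def Let_def)
  have ye: "y e = a 0 e + real l" if e: "e \<in> directions a l" for e
  proof -
    have eE: "e \<in> E" using e directions_E by blast
    have ap: "a l = eray (a 0) e l" "a (Suc l) = eray (a 0) e (Suc l)"
      by (rule ray_approx[OF a e], simp)+
    have "a 0 e \<le> y e" using le eE by (simp add: le_L)
    then obtain m :: nat where m: "y e = a 0 e + m" by (rule ex_nat_increment[OF c y eE])
    have "a l e \<le> y e" using al eE by (simp add: le_L)
    then have "l \<le> m" using ap(1) eray_apply[OF eE, of "a 0" l] m by simp
    moreover have "\<not> Suc l \<le> m"
    proof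
      assume "Suc l \<le> m"
      then have "eray (a 0) e (Suc l) \<sqsubseteq>\<^bsub>L\<^esub> y" using eray_le[OF c y le eE, of "Suc l"] m by simp
      then show False using Pl ap(2) by (simp add: P_def)
    qed
    ultimately show ?thesis using m by simp
  qed
  moreover have "ray_join L a y j = eray y e j" if e: "e \<in> directions a (l + k)" and j: "j \<le> Suc k" for k e j
  proof -
    have eE: "e \<in> E" and el: "e \<in> directions a l" using e directions_E directions_antimono[OF a, of l "l + k"] by auto
    have "a (l + j) = eray (a 0) e (l + j)" using ray_approx[OF a e, of "l + j"] j by simp
    then show ?thesis using rj eray_join[OF c y le eE ye[OF el], of j] by simp
  qed
  ultimately show ?thesis using that by blast
qed

lemma ray_join_ray:
  assumes a: "a \<in> rays L" and y: "y \<in> carrier L" and le: "a 0 \<sqsubseteq>\<^bsub>L\<^esub> y"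
  obtains l where "ray_join L a y \<in> rays L" "ray_join L a y 0 = y" "\<And>k. directions a (l + k) \<subseteq> directions (ray_join L a y) k"
proof -
  obtain l where "\<And>e. e \<in> directions a l \<Longrightarrow> y e = a 0 e + real l"
    and ap: "\<And>k e j. e \<in> directions a (l + k) \<Longrightarrow> j \<le> Suc k \<Longrightarrow> ray_join L a y j = eray y e j"
    using ray_join_approx[OF assms] by blast
  obtain e where "e \<in> directions a (l + 0)" using rayD(3)[OF a] by blast
  then have y0: "ray_join L a y 0 = y" using ap[of e 0 0] by simp
  have "ray_join L a y \<in> rays L"
  proof (rule rayI)
    show "ray_join L a y 0 \<in> carrier L" using y y0 by simp
    fix k
    obtain e where "e \<in> directions a (l + k)" using rayD(3)[OF a] by blast
    then show "\<exists>e\<in>E. \<forall>j\<le>k. ray_join L a y j = eray (ray_join L a y 0) e j"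
      unfolding y0 using ap[of e k] directions_E by (intro bexI[of _ e]) auto
  qed
  moreover have "directions a (l + k) \<subseteq> directions (ray_join L a y) k" for k
  proof
    fix e assume e: "e \<in> directions a (l + k)"
    then have eE: "e \<in> E" using directions_E by blast
    show "e \<in> directions (ray_join L a y) k"
      unfolding directions_def using ap[OF e, of k] ap[OF e, of "Suc k"] eray_apply[OF eE, of y] eE by simp
  qed
  ultimately show ?thesis using that y0 by blast
qed

text \<open>Moving the base point from \<open>y\<close> to \<open>x\<close> distorts the exponent of the ultrametric by at most \<open>c\<close>.\<close>
lemma directions_change_base:
  assumes x: "x \<in> carrier L" and y: "y \<in> carrier L"
  obtains c where "\<And>e f l. e \<in> E \<Longrightarrow> f \<in> directions (eray y e) (c + l) \<Longrightarrow> f \<in> directions (eray x e) l"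
proof -
  obtain d :: nat where d: "\<And>e. e \<in> E \<Longrightarrow> x e \<le> y e + d" using ex_shift_le[OF y x] by blast
  \<comment> \<open>Shifting by \<open>d\<close> adds \<open>n * d\<close> on every base, and the
    maxima at \<open>x\<close> and \<open>y\<close> differ by \<open>r y - r x\<close>. The absolute
    value keeps the ceiling nonnegative, so \<open>nat\<close> does not truncate it.\<close>
  define c where "c = nat \<lceil>real n * d + \<bar>r y - r x\<bar>\<rceil>"
  have cd: "real n * d + (r y - r x) \<le> c" unfolding c_def by linarith
  have "f \<in> directions (eray x e) l" if e: "e \<in> E" and f: "f \<in> directions (eray y e) (c + l)" for e f l
  proof (rule ccontr)
    assume nf: "f \<notin> directions (eray x e) l"
    have fe: "f \<noteq> e" using nf e atom_self by (auto simp: directions_eray)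
    have "f \<in> E" using f directions_E by blast
    then obtain B where B: "B \<in> \<B>" "e \<in> B" "f \<in> B" "r x - real l \<le> vm_add \<omega> x B"
      using ex_base_not_directions_eray[OF x e _ nf fe] by blast
    have "vm_add \<omega> y B \<le> r y - (real (c + l) + 1)"
      by (rule directions_eray_le[OF y e f fe B(1-3)])
    moreover have "vm_add \<omega> x B \<le> vm_add \<omega> (\<lambda>e\<in>E. y e + d) B" using d by (intro vm_add_mono[OF B(1)]) simp
    then have "vm_add \<omega> x B \<le> vm_add \<omega> y B + real n * d" using vm_add_const[OF B(1), of y d] by simp
    ultimately show False using B(4) cd by simp
  qed
  with that show ?thesis by blast
qed

text \<open>Choose a common element deep in both sequences. Up to its index both rays follow it, so
  the two flats are balls around the same element seen from two base points, and
  \<open>directions_change_base\<close> applies.\<close>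

lemma directions_sub_of_inter:
  assumes a: "a \<in> rays L" and b: "b \<in> rays L" and int: "\<And>l. directions a l \<inter> directions b l \<noteq> {}"
  shows "\<exists>k. directions b k \<subseteq> directions a l"
proof -
  obtain c where c: "\<And>e f l. e \<in> E \<Longrightarrow> f \<in> directions (eray (b 0) e) (c + l) \<Longrightarrow> f \<in> directions (eray (a 0) e) l"
    using directions_change_base[OF rayD(1)[OF a, of 0] rayD(1)[OF b, of 0]] by blast
  obtain e where e: "e \<in> directions a (c + l)" "e \<in> directions b (c + l)" using int by blast
  have eE: "e \<in> E" using e directions_E by blast
  have "directions b (c + l) = directions (eray (b 0) e) (c + l)" by (rule directions_approx[OF b e(2)]) simp
  moreover have "directions a l = directions (eray (a 0) e) l" by (rule directions_approx[OF a e(1)]) simp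
  ultimately show ?thesis using c[OF eE] by blast
qed

text \<open>A criterion free of joins and base points. The flats of a ray lie in those of its join
  with \<open>?y\<close> after an index shift, and \<open>directions_sub_of_inter\<close> supplies
  the reverse nesting; on the other hand, two rays from the same point are equal as soon as their
  flats always meet.\<close>

lemma parallel_iff:
  "(a, b) \<in> parallel_rays L \<longleftrightarrow> a \<in> rays L \<and> b \<in> rays L \<and> (\<forall>l. directions a l \<inter> directions b l \<noteq> {})"
proof -
  have "ray_join L a (a 0 \<squnion>\<^bsub>L\<^esub> b 0) = ray_join L b (a 0 \<squnion>\<^bsub>L\<^esub> b 0) \<longleftrightarrow> (\<forall>l. directions a l \<inter> directions b l \<noteq> {})"
    if a: "a \<in> rays L" and b: "b \<in> rays L"
  proof -
    let ?y = "a 0 \<squnion>\<^bsub>L\<^esub> b 0"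
    have c: "a 0 \<in> carrier L" "b 0 \<in> carrier L" using rayD(1) a b by auto
    have y: "?y \<in> carrier L" and ay: "a 0 \<sqsubseteq>\<^bsub>L\<^esub> ?y" and byy: "b 0 \<sqsubseteq>\<^bsub>L\<^esub> ?y"
      using c L.join_left L.join_right by auto
    obtain i where i: "ray_join L a ?y \<in> rays L" "ray_join L a ?y 0 = ?y" "\<And>k. directions a (i + k) \<subseteq> directions (ray_join L a ?y) k"
      using ray_join_ray[OF a y ay] by blast
    obtain j where j: "ray_join L b ?y \<in> rays L" "ray_join L b ?y 0 = ?y" "\<And>k. directions b (j + k) \<subseteq> directions (ray_join L b ?y) k"
      using ray_join_ray[OF b y byy] by blast
    have sub: "\<exists>k. directions (ray_join L d ?y) k \<subseteq> directions d l"
      if d: "d \<in> rays L" and J: "ray_join L d ?y \<in> rays L" "\<And>k. directions d (m + k) \<subseteq> directions (ray_join L d ?y) k" for d m l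
    proof (rule directions_sub_of_inter[OF d J(1)])
      fix l
      have "directions d (m + l) \<subseteq> directions d l" by (rule directions_antimono[OF d]) simp
      then show "directions d l \<inter> directions (ray_join L d ?y) l \<noteq> {}" using J(2)[of l] rayD(3)[OF d, of "m + l"] by blast
    qed
    show ?thesis
    proof
      assume eq: "ray_join L a ?y = ray_join L b ?y"
      show "\<forall>l. directions a l \<inter> directions b l \<noteq> {}"
      proof
        fix l
        obtain k where k: "directions (ray_join L a ?y) k \<subseteq> directions a l" using sub[OF a i(1,3)] by blast
        obtain k' where k': "directions (ray_join L b ?y) k' \<subseteq> directions b l" using sub[OF b j(1,3)] by blast
        have "directions (ray_join L a ?y) (max k k') \<subseteq> directions a l" using k directions_antimono[OF i(1), of k "max k k'"] by auto
        moreover have "directions (ray_join L a ?y) (max k k') \<subseteq> directions b l" using k' eq directions_antimono[OF j(1), of k' "max k k'"] by auto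
        ultimately show "directions a l \<inter> directions b l \<noteq> {}" using rayD(3)[OF i(1), of "max k k'"] by blast
      qed
    next
      assume int: "\<forall>l. directions a l \<inter> directions b l \<noteq> {}"
      show "ray_join L a ?y = ray_join L b ?y"
      proof (rule rays_eqI[OF i(1) j(1)])
        show "ray_join L a ?y 0 = ray_join L b ?y 0" using i(2) j(2) by simp
        fix l
        obtain e where e: "e \<in> directions a (i + j + l)" "e \<in> directions b (i + j + l)" using int by blast
        have "e \<in> directions a (i + l)" using e(1) directions_antimono[OF a, of "i + l" "i + j + l"] by auto
        moreover have "e \<in> directions b (j + l)" using e(2) directions_antimono[OF b, of "j + l" "i + j + l"] by auto
        ultimately show "directions (ray_join L a ?y) l \<inter> directions (ray_join L b ?y) l \<noteq> {}" using i(3) j(3) by blast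
      qed
    qed
  qed
  then show ?thesis by (auto simp: parallel_rays_def)
qed

lemma equiv_parallel: "equiv (rays L) (parallel_rays L)"
proof (rule equivI)
  show "refl_on (rays L) (parallel_rays L)"
    using rayD(3) by (auto simp: refl_on_def parallel_iff)
  show "sym (parallel_rays L)" by (auto simp: sym_def parallel_iff Int_commute)
  show "trans (parallel_rays L)"
  proof (rule transI)
    fix a b c assume "(a, b) \<in> parallel_rays L" "(b, c) \<in> parallel_rays L"
    then have a: "a \<in> rays L" and b: "b \<in> rays L" and c: "c \<in> rays L"
      and ab: "\<And>l. directions a l \<inter> directions b l \<noteq> {}" and cb: "\<And>l. directions c l \<inter> directions b l \<noteq> {}"
      by (auto simp: parallel_iff Int_commute)
    have "directions a l \<inter> directions c l \<noteq> {}" for l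
    proof -
      obtain k where k: "directions b k \<subseteq> directions a l" using directions_sub_of_inter[OF a b ab] by blast
      obtain k' where k': "directions b k' \<subseteq> directions c l" using directions_sub_of_inter[OF c b cb] by blast
      have "directions b (max k k') \<subseteq> directions b k" "directions b (max k k') \<subseteq> directions b k'"
        by (rule directions_antimono[OF b], simp)+
      then show ?thesis using k k' rayD(3)[OF b, of "max k k'"] by blast
    qed
    with a c show "(a, c) \<in> parallel_rays L" by (simp add: parallel_iff)
  qed
qed (auto simp: parallel_iff)

text \<open>A diagonal construction: the point at index \<open>l\<close> is taken from the ray
  towards an element of the flat of \<open>b\<close> at \<open>c + l\<close>. The offset
  \<open>c\<close> from the change of base point makes these choices agree with each other on
  initial pieces.\<close>

lemma ex_parallel_ray:
  assumes x: "x \<in> carrier L" and b: "b \<in> rays L"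
  shows "\<exists>a. (b, a) \<in> parallel_rays L \<and> a 0 = x"
proof -
  obtain c where c: "\<And>e f l. e \<in> E \<Longrightarrow> f \<in> directions (eray (b 0) e) (c + l) \<Longrightarrow> f \<in> directions (eray x e) l"
    using directions_change_base[OF x rayD(1)[OF b, of 0]] by blast
  have "\<forall>l. \<exists>e. e \<in> directions b (c + l)" using rayD(3)[OF b] by blast
  then obtain s where s: "\<And>l. s l \<in> directions b (c + l)" by metis
  have sE: "s l \<in> E" for l using s directions_E by blast
  define a where "a l = eray x (s l) l" for l
  have agree: "eray x (s l) j = eray x f j" if "f \<in> directions b (c + l)" "j \<le> Suc l" for f l j
  proof -
    have "directions b (c + l) = directions (eray (b 0) (s l)) (c + l)" by (rule directions_approx[OF b s]) simp
    then have "f \<in> directions (eray x (s l)) l" using c[OF sE] that(1) by blast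
    then show ?thesis using ray_approx[OF eray_ray[OF x sE] _ that(2), of f] by simp
  qed
  have aj: "a j = eray x f j" if "f \<in> directions b (c + l)" "j \<le> l" for f j l
    unfolding a_def using agree[of f j j] that directions_antimono[OF b, of "c + j" "c + l"] by auto
  have a0: "a 0 = x" by (simp add: a_def)
  have ray: "a \<in> rays L"
  proof (rule rayI)
    show "a 0 \<in> carrier L" using a0 x by simp
    show "\<exists>e\<in>E. \<forall>j\<le>l. a j = eray (a 0) e j" for l
      unfolding a0 using aj[OF s] sE by (intro bexI[of _ "s l"]) auto
  qed
  have "directions b l \<inter> directions a l \<noteq> {}" for l
  proof -
    have f: "s (Suc l) \<in> directions b (c + Suc l)" by (rule s)
    have "s (Suc l) \<in> directions a l"
      unfolding directions_def using aj[OF f, of l] aj[OF f, of "Suc l"] eray_apply[OF sE, of x] sE by simp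
    then show ?thesis using f directions_antimono[OF b, of l "c + Suc l"] by auto
  qed
  then have "(b, a) \<in> parallel_rays L" using ray b by (simp add: parallel_iff)
  then show ?thesis using a0 by blast
qed

lemma end_ray_props:
  assumes x: "x \<in> carrier L" and \<epsilon>: "\<epsilon> \<in> ends L"
  shows "end_ray L x \<epsilon> \<in> \<epsilon>" "end_ray L x \<epsilon> 0 = x" "end_ray L x \<epsilon> \<in> rays L"
    "a \<in> \<epsilon> \<Longrightarrow> a 0 = x \<Longrightarrow> end_ray L x \<epsilon> = a"
proof -
  obtain b where b: "b \<in> rays L" "\<epsilon> = parallel_rays L `` {b}" using \<epsilon> by (auto simp: ends_def elim: quotientE)
  obtain a0 where a0: "(b, a0) \<in> parallel_rays L" "a0 0 = x" using ex_parallel_ray[OF x b(1)] by blast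
  have un: "a = a'" if a: "a \<in> \<epsilon>" "a' \<in> \<epsilon>" "a 0 = x" "a' 0 = x" for a a'
  proof -
    have "(a, a') \<in> parallel_rays L"
      using equiv_parallel b a by (metis Image_singleton_iff equiv_def symD transD)
    then show ?thesis using rays_eqI[of a a'] a by (simp add: parallel_iff)
  qed
  have ex: "\<exists>!a. a \<in> \<epsilon> \<and> a 0 = x" using a0 b un by blast
  have *: "end_ray L x \<epsilon> \<in> \<epsilon> \<and> end_ray L x \<epsilon> 0 = x" unfolding end_ray_def by (rule theI'[OF ex])
  then show "end_ray L x \<epsilon> \<in> \<epsilon>" "end_ray L x \<epsilon> 0 = x" by auto
  show "end_ray L x \<epsilon> \<in> rays L" using * b(2) by (auto simp: parallel_iff)
  show "end_ray L x \<epsilon> = a" if "a \<in> \<epsilon>" "a 0 = x" using un * that by blast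
qed

lemma ends_parallel:
  assumes "\<epsilon> \<in> ends L" "a \<in> \<epsilon>" "b \<in> \<epsilon>" shows "(a, b) \<in> parallel_rays L"
  using quotient_eq_iff[OF equiv_parallel, of \<epsilon> \<epsilon> a b] assms by (auto simp: ends_def)

lemma ends_eqI:
  assumes "\<epsilon> \<in> ends L" "\<epsilon>' \<in> ends L" "a \<in> \<epsilon>" "a \<in> \<epsilon>'" shows "\<epsilon> = \<epsilon>'"
  using quotient_disj[OF equiv_parallel, of \<epsilon> \<epsilon>'] assms by (auto simp: ends_def)

definition end_of_ray :: "(nat \<Rightarrow> 'a \<Rightarrow> real) \<Rightarrow> (nat \<Rightarrow> 'a \<Rightarrow> real) set" where
  "end_of_ray a = parallel_rays L `` {a}"

lemma end_of_ray:
  assumes "a \<in> rays L" shows "end_of_ray a \<in> ends L" "a \<in> end_of_ray a"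
  using assms equiv_class_self[OF equiv_parallel] by (auto simp: end_of_ray_def ends_def quotientI)

section \<open>Bases of ends\<close>

text \<open>The elements of \<open>E\<close> that represent the end up to precision \<open>l\<close>
  seen from \<open>x\<close>: the trace on \<open>E\<close> of a ball around the end.\<close>

definition nbhd :: "('a \<Rightarrow> real) \<Rightarrow> (nat \<Rightarrow> 'a \<Rightarrow> real) set \<Rightarrow> nat \<Rightarrow> 'a set" where
  "nbhd x \<epsilon> l = directions (end_ray L x \<epsilon>) l"

lemma nbhd_E: "nbhd x \<epsilon> l \<subseteq> E"
  unfolding nbhd_def by (rule directions_E)

lemma nbhd_nonempty: "x \<in> carrier L \<Longrightarrow> \<epsilon> \<in> ends L \<Longrightarrow> nbhd x \<epsilon> l \<noteq> {}"
  unfolding nbhd_def using rayD(3) end_ray_props(3) by blast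

lemma nbhd_antimono: "x \<in> carrier L \<Longrightarrow> \<epsilon> \<in> ends L \<Longrightarrow> i \<le> j \<Longrightarrow> nbhd x \<epsilon> j \<subseteq> nbhd x \<epsilon> i"
  unfolding nbhd_def by (rule directions_antimono[OF end_ray_props(3)])

lemma end_rays_parallel:
  assumes "x \<in> carrier L" "y \<in> carrier L" "\<epsilon> \<in> ends L"
  shows "(end_ray L x \<epsilon>, end_ray L y \<epsilon>) \<in> parallel_rays L"
  using ends_parallel[OF assms(3)] end_ray_props(1) assms by blast

lemma nbhd_inter:
  assumes "x \<in> carrier L" "y \<in> carrier L" "\<epsilon> \<in> ends L"
  shows "nbhd x \<epsilon> l \<inter> nbhd y \<epsilon> l' \<noteq> {}"
proof -
  have "nbhd x \<epsilon> (max l l') \<inter> nbhd y \<epsilon> (max l l') \<noteq> {}"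
    using end_rays_parallel[OF assms] by (simp add: parallel_iff nbhd_def)
  moreover have "nbhd x \<epsilon> (max l l') \<subseteq> nbhd x \<epsilon> l" "nbhd y \<epsilon> (max l l') \<subseteq> nbhd y \<epsilon> l'"
    using nbhd_antimono assms by simp_all
  ultimately show ?thesis by blast
qed

lemma nbhd_change_base:
  assumes "x \<in> carrier L" "y \<in> carrier L" "\<epsilon> \<in> ends L"
  shows "\<exists>k. nbhd y \<epsilon> k \<subseteq> nbhd x \<epsilon> l"
  using directions_sub_of_inter[OF end_ray_props(3)[OF assms(1,3)] end_ray_props(3)[OF assms(2,3)]] nbhd_inter[OF assms]
  by (simp add: nbhd_def)

lemma nbhd_approx:
  assumes "x \<in> carrier L" "\<epsilon> \<in> ends L" "e \<in> nbhd x \<epsilon> l"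
  shows "j \<le> Suc l \<Longrightarrow> end_ray L x \<epsilon> j = eray x e j" "j \<le> l \<Longrightarrow> nbhd x \<epsilon> j = directions (eray x e) j"
  using ray_approx[OF end_ray_props(3)[OF assms(1,2)], of e l j]
    directions_approx[OF end_ray_props(3)[OF assms(1,2)], of e l j] end_ray_props(2)[OF assms(1,2)] assms(3)
  by (simp_all add: nbhd_def)

lemma nbhd_diam:
  assumes x: "x \<in> carrier L" and \<epsilon>: "\<epsilon> \<in> ends L" and ef: "e \<in> nbhd x \<epsilon> l" "f \<in> nbhd x \<epsilon> l" "e \<noteq> f"
    and B: "B \<in> \<B>" "e \<in> B" "f \<in> B"
  shows "vm_add \<omega> x B \<le> r x - (real l + 1)"
proof -
  have eE: "e \<in> E" using ef(1) nbhd_E by blast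
  have "f \<in> directions (eray x e) l" using nbhd_approx(2)[OF x \<epsilon> ef(1), of l] ef(2) by simp
  then show ?thesis using directions_eray_le[OF x eE _ _ B] ef(3) by blast
qed

lemma nbhd_0:
  assumes "x \<in> carrier L" "\<epsilon> \<in> ends L" "e \<in> nbhd x \<epsilon> 0"
  shows "nbhd x \<epsilon> 0 = atom x e" "end_ray L x \<epsilon> 1 = step x e"
proof -
  show "nbhd x \<epsilon> 0 = atom x e" using nbhd_approx(2)[OF assms, of 0] by (simp add: directions_eray)
  have "end_ray L x \<epsilon> 1 = eray x e (Suc 0)" using nbhd_approx(1)[OF assms, of 1] by simp
  then show "end_ray L x \<epsilon> 1 = step x e" unfolding eray_Suc by simp
qed

lemma ends_eq_of_nbhd_inter:
  assumes x: "x \<in> carrier L" and \<epsilon>: "\<epsilon> \<in> ends L" and \<epsilon>': "\<epsilon>' \<in> ends L"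
    and "\<And>l. nbhd x \<epsilon> l \<inter> nbhd x \<epsilon>' l \<noteq> {}"
  shows "\<epsilon> = \<epsilon>'"
proof -
  have "end_ray L x \<epsilon> = end_ray L x \<epsilon>'"
    using rays_eqI[OF end_ray_props(3)[OF x \<epsilon>] end_ray_props(3)[OF x \<epsilon>']] assms(4)
      end_ray_props(2)[OF x \<epsilon>] end_ray_props(2)[OF x \<epsilon>'] by (simp add: nbhd_def)
  then show ?thesis using ends_eqI[OF \<epsilon> \<epsilon>'] end_ray_props(1)[OF x \<epsilon>] end_ray_props(1)[OF x \<epsilon>'] by simp
qed

text \<open>Facts about ends are stated for all choices of representatives of some precision
  \<open>N\<close>. They can then be combined by taking the larger precision, and moved to another
  base point by enlarging it.\<close>

definition approx :: "('a \<Rightarrow> real) \<Rightarrow> (nat \<Rightarrow> 'a \<Rightarrow> real) set set \<Rightarrow> nat \<Rightarrow>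
    ((nat \<Rightarrow> 'a \<Rightarrow> real) set \<Rightarrow> 'a) \<Rightarrow> bool" where
  "approx x I N s \<longleftrightarrow> (\<forall>\<epsilon>\<in>I. s \<epsilon> \<in> nbhd x \<epsilon> N)"

lemma approx_mono:
  "x \<in> carrier L \<Longrightarrow> I \<subseteq> ends L \<Longrightarrow> N \<le> N' \<Longrightarrow> approx x I N' s \<Longrightarrow> approx x I N s"
  unfolding approx_def using nbhd_antimono by (meson subsetD)

lemma approx_ex:
  assumes "x \<in> carrier L" "I \<subseteq> ends L" shows "\<exists>s. approx x I N s"
proof -
  have "\<forall>\<epsilon>\<in>I. \<exists>e. e \<in> nbhd x \<epsilon> N" using nbhd_nonempty assms by blast
  then show ?thesis unfolding approx_def by (rule bchoice)
qed

lemma approx_change_base: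
  assumes "x \<in> carrier L" "y \<in> carrier L" "I \<subseteq> ends L" "finite I"
  shows "\<exists>N'. \<forall>s. approx y I N' s \<longrightarrow> approx x I N s"
proof -
  have "\<exists>k. \<forall>\<epsilon>\<in>I. nbhd y \<epsilon> k \<subseteq> nbhd x \<epsilon> N"
  proof (rule finite_nat_bound[OF assms(4)])
    show "\<exists>k. nbhd y \<epsilon> k \<subseteq> nbhd x \<epsilon> N" if "\<epsilon> \<in> I" for \<epsilon>
      using nbhd_change_base[OF assms(1,2)] assms(3) that by blast
    show "nbhd y \<epsilon> k' \<subseteq> nbhd x \<epsilon> N" if "\<epsilon> \<in> I" "nbhd y \<epsilon> k \<subseteq> nbhd x \<epsilon> N" "k \<le> k'" for \<epsilon> k k'
      using nbhd_antimono[OF assms(2), of \<epsilon> k k'] assms(3) that by blast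
  qed
  then show ?thesis unfolding approx_def by blast
qed

lemma ex_carrier_of_base:
  assumes x: "x \<in> carrier L" and A: "A \<in> \<B>" and v: "\<And>f. f \<in> A \<Longrightarrow> v f \<in> \<int>"
  obtains z where "z \<in> carrier L" "A \<in> M z" "\<And>f. f \<in> A \<Longrightarrow> z f = v f"
proof -
  have nl: "\<not> is_loop \<B> e" if "e \<in> E" for e
    using carrierD(5)[OF x that] maximizersD(1) unfolding is_loop_def by blast
  show ?thesis
  proof (rule ex_tropical_of_base[OF nl A, of v])
    fix z assume z: "z \<in> T" "A \<in> M z" "\<And>f. f \<in> A \<Longrightarrow> z f = v f"
      "(\<forall>f\<in>A. v f \<in> \<int>) \<Longrightarrow> (\<forall>B\<in>\<B>. \<omega> B \<in> \<int>) \<Longrightarrow> (\<forall>e\<in>E. z e \<in> \<int>)"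
    have "\<forall>f\<in>A. v f \<in> \<int>" "\<forall>B\<in>\<B>. \<omega> B \<in> \<int>" using v int by auto
    then have "z \<in> carrier L" using z(1) z(4) unfolding carrier_L by blast
    then show thesis by (rule that[OF _ z(2,3)])
  qed
qed

lemma carrier_le:
  assumes "x \<in> carrier L" "y \<in> carrier L" "A \<in> M x" "\<And>f. f \<in> A \<Longrightarrow> x f \<le> y f"
  shows "x \<sqsubseteq>\<^bsub>L\<^esub> y"
  unfolding le_L using tropical_le[OF carrierD(1)[OF assms(1)] carrierD(1)[OF assms(2)] assms(3,4)] by blast

lemma card_base_inter_max:
  assumes "x \<in> carrier L"
  obtains A where "A \<in> M x" "\<And>A'. A' \<in> M x \<Longrightarrow> card (A' \<inter> S) \<le> card (A \<inter> S)"
proof -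
  obtain A0 where A0: "A0 \<in> M x" using carrierD(4)[OF assms] by blast
  have "card (A \<inter> S) < Suc n" if "A \<in> M x" for A
    using baseD[OF maximizersD(1)[OF that]] card_mono[of A "A \<inter> S"] by simp
  then have "\<exists>A. A \<in> M x \<and> (\<forall>A'. A' \<in> M x \<longrightarrow> card (A' \<inter> S) \<le> card (A \<inter> S))"
    by (intro ex_has_greatest_nat[of "\<lambda>A. A \<in> M x" A0 "\<lambda>A. card (A \<inter> S)" "Suc n"]) (use A0 in auto)
  then show ?thesis using that by blast
qed

section \<open>Independence read off from the first steps of rays\<close>

text \<open>If \<open>S\<close> is optimal at \<open>x\<close>, comparing on \<open>S\<close> shows
  that the join is \<open>x + 1\<close>. Conversely, let \<open>A\<close> be an optimal base with as
  many elements in \<open>S\<close> as possible, and \<open>z\<close> the point that has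
  \<open>A\<close> optimal and exceeds \<open>x\<close> on \<open>A\<close> exactly at
  \<open>A \<inter> S\<close>, by 1. If \<open>z\<close> did not exceed \<open>x\<close> at some
  element of \<open>S\<close>, a swap would enlarge the intersection. So the join is below
  \<open>z\<close>, whose rank is \<open>r x + card (A \<inter> S)\<close>, and this forces
  \<open>A = S\<close>.\<close>

lemma independent_iff_base:
  assumes x: "x \<in> carrier L" and S: "finite S" "S \<subseteq> E" "card S \<le> n"
  shows "r (\<Squnion>\<^bsub>L\<^esub>(insert x (step x ` S))) = r x + n \<longleftrightarrow> S \<in> M x"
proof -
  let ?X = "insert x (step x ` S)"
  let ?U = "\<Squnion>\<^bsub>L\<^esub>?X"
  let ?x1 = "\<lambda>e\<in>E. x e + 1"
  have Xc: "?X \<subseteq> carrier L" using x step_carrier(1)[OF x] S(2) by auto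
  have lst: "least L ?U (Upper L ?X)" using L.finite_sup_least[OF _ Xc] S(1) by simp
  then have UU: "?U \<in> Upper L ?X" and low: "\<And>z. z \<in> Upper L ?X \<Longrightarrow> ?U \<sqsubseteq>\<^bsub>L\<^esub> z"
    unfolding least_def by blast+
  have Uc: "?U \<in> carrier L" and up: "\<And>u. u \<in> ?X \<Longrightarrow> u \<sqsubseteq>\<^bsub>L\<^esub> ?U"
    using UU Xc unfolding Upper_def by blast+
  have lub: "?U \<sqsubseteq>\<^bsub>L\<^esub> z" if "z \<in> carrier L" "\<And>u. u \<in> ?X \<Longrightarrow> u \<sqsubseteq>\<^bsub>L\<^esub> z" for z
    by (rule low) (use that in \<open>unfold Upper_def, blast\<close>)
  show ?thesis
  proof
    assume SM: "S \<in> M x"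
    have x1: "?x1 \<in> carrier L" using const_carrier[OF x, of 1] by simp
    have "u \<sqsubseteq>\<^bsub>L\<^esub> ?x1" if "u \<in> ?X" for u using that by (auto simp: le_L step_def indicator_def)
    then have "?U \<sqsubseteq>\<^bsub>L\<^esub> ?x1" using lub[OF x1] by blast
    moreover have "?x1 \<sqsubseteq>\<^bsub>L\<^esub> ?U"
    proof (rule carrier_le[OF x1 Uc])
      show "S \<in> M ?x1" using SM unfolding maximizers_const .
      fix f assume f: "f \<in> S"
      then have fE: "f \<in> E" using S(2) by blast
      have "step x f f \<le> ?U f" using up[of "step x f"] f fE by (simp add: le_L)
      then show "?x1 f \<le> ?U f" using step_apply[OF fE, of x] fE by simp
    qed
    ultimately have "?U = ?x1" using L.le_antisym[OF _ _ Uc x1] by blast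
    then show "r ?U = r x + n" using r_const[OF x, of 1] by simp
  next
    assume rU: "r ?U = r x + n"
    obtain A where A: "A \<in> M x" "\<And>A'. A' \<in> M x \<Longrightarrow> card (A' \<inter> S) \<le> card (A \<inter> S)"
      using card_base_inter_max[OF x, of S] by blast
    have AB: "A \<in> \<B>" using maximizersD(1)[OF A(1)] .
    note Ab = baseD[OF AB]
    obtain z where z: "z \<in> carrier L" "A \<in> M z" "\<And>f. f \<in> A \<Longrightarrow> z f = x f + indicat_real (A \<inter> S) f"
    proof (rule ex_carrier_of_base[OF x AB, of "\<lambda>f. x f + indicat_real (A \<inter> S) f"])
      show "x f + indicat_real (A \<inter> S) f \<in> \<int>" if "f \<in> A" for f
        using carrierD(3)[OF x, of f] Ab(1) that by (auto simp: indicator_def)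
    qed blast
    have xz: "x \<sqsubseteq>\<^bsub>L\<^esub> z" by (rule carrier_le[OF x z(1) A(1)]) (simp add: z(3))
    have "step x g \<sqsubseteq>\<^bsub>L\<^esub> z" if g: "g \<in> S" for g
    proof (rule step_le[OF x z(1) xz])
      show gE: "g \<in> E" using g S(2) by blast
      show "x g < z g"
      proof (cases "g \<in> A")
        case True
        then show ?thesis using g z(3) by simp
      next
        case False
        show ?thesis
        proof (rule ccontr)
          assume "\<not> ?thesis"
          then have zg: "z g = x g" using xz gE by (force simp: le_L)
          obtain f where f: "f \<in> A" "insert g (A - {f}) \<in> \<B>" "vm_add \<omega> z A \<le> vm_add \<omega> z (insert g (A - {f}))"
            using swap_in[OF carrierD(1)[OF z(1)] AB, of g] gE False by blast
          note sw = vm_add_swap[OF AB f(1) False, of x] vm_add_swap[OF AB f(1) False, of z]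
          have "x f \<le> z f" using z(3)[OF f(1)] by simp
          moreover have "vm_add \<omega> x (insert g (A - {f})) \<le> vm_add \<omega> x A" using maximizersD(2)[OF A(1) f(2)] .
          ultimately have M: "insert g (A - {f}) \<in> M x" and "z f = x f"
            using maximizersI[OF A(1) f(2)] f(3) sw zg by auto
          then have "f \<notin> S" using z(3)[OF f(1)] f(1) by (auto simp: indicator_def)
          then have "insert g (A - {f}) \<inter> S = insert g (A \<inter> S)" using g by auto
          then have "card (insert g (A - {f}) \<inter> S) = Suc (card (A \<inter> S))" using False Ab(2) by simp
          then show False using A(2)[OF M] by simp
        qed
      qed
    qed
    then have "?U \<sqsubseteq>\<^bsub>L\<^esub> z" using lub[OF z(1)] xz by blast
    then have "r x + n \<le> r z" using r_mono[OF Uc z(1)] rU by simp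
    moreover have "r z = r x + card (A \<inter> S)"
    proof -
      have "sum z A = (\<Sum>f\<in>A. x f + indicat_real (A \<inter> S) f)" by (rule sum.cong) (use z(3) in auto)
      also have "\<dots> = sum x A + card (A \<inter> S)" using Ab(2) by (simp add: sum.distrib indicator_def sum.If_cases)
      finally show ?thesis using r_eq[OF z(2)] r_eq[OF A(1)] by (simp add: vm_add_def)
    qed
    ultimately have "n \<le> card (A \<inter> S)" by simp
    then have "A \<inter> S = A" using Ab card_seteq[of A "A \<inter> S"] by auto
    then have "A = S" using card_seteq[OF S(1), of A] S(3) Ab(3) by auto
    then show "S \<in> M x" using A(1) by simp
  qed
qed

lemma has_uniform_rank_iff: "x \<in> carrier L \<Longrightarrow> has_uniform_rank L k \<longleftrightarrow> k = n"
  using uniform_rank_L unfolding has_uniform_rank_def by auto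

text \<open>Precision 0 suffices: independence looks only at the first step of each ray, which is
  determined by any element of the first flat.\<close>

lemma end_bases_at_iff:
  assumes x: "x \<in> carrier L"
  shows "I \<in> end_bases_at L x \<longleftrightarrow> I \<subseteq> ends L \<and> finite I \<and> card I = n \<and> (\<forall>s. approx x I 0 s \<longrightarrow> s ` I \<in> M x)"
proof -
  have key: "interval_rank L x (\<Squnion>\<^bsub>L\<^esub>(insert x ((\<lambda>\<epsilon>. end_ray L x \<epsilon> 1) ` I))) = n \<longleftrightarrow> s ` I \<in> M x"
    if I: "I \<subseteq> ends L" "finite I" "card I = n" and s: "approx x I 0 s" for s
  proof -
    have eq: "(\<lambda>\<epsilon>. end_ray L x \<epsilon> 1) ` I = step x ` s ` I"
      unfolding image_image using nbhd_0(2)[OF x] I(1) s by (intro image_cong) (auto simp: approx_def)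
    have "s ` I \<subseteq> E" using s nbhd_E unfolding approx_def by blast
    then have S: "finite (s ` I)" "s ` I \<subseteq> E" "card (s ` I) \<le> n"
      using I card_image_le[of I s] by auto
    let ?X = "insert x (step x ` s ` I)"
    have Xc: "?X \<subseteq> carrier L" using x step_carrier(1)[OF x] S(2) by auto
    have lst: "least L (\<Squnion>\<^bsub>L\<^esub>?X) (Upper L ?X)" using L.finite_sup_least[OF _ Xc] S(1) by simp
    then have "\<Squnion>\<^bsub>L\<^esub>?X \<in> Upper L ?X" unfolding least_def by blast
    then have Uc: "\<Squnion>\<^bsub>L\<^esub>?X \<in> carrier L" and "x \<sqsubseteq>\<^bsub>L\<^esub> \<Squnion>\<^bsub>L\<^esub>?X" using x unfolding Upper_def by blast+
    then have "real (interval_rank L x (\<Squnion>\<^bsub>L\<^esub>?X)) = r (\<Squnion>\<^bsub>L\<^esub>?X) - r x" by (rule interval_rank_eq[OF x])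
    then have "interval_rank L x (\<Squnion>\<^bsub>L\<^esub>?X) = n \<longleftrightarrow> r (\<Squnion>\<^bsub>L\<^esub>?X) = r x + n" by linarith
    then show ?thesis unfolding eq using independent_iff_base[OF x S] by simp
  qed
  show ?thesis
    unfolding end_bases_at_def independent_at_def has_uniform_rank_iff[OF x] mem_Collect_eq
  proof (intro iffI conjI allI impI)
    assume "I \<subseteq> ends L \<and> finite I \<and> card I = n \<and> (\<forall>s. approx x I 0 s \<longrightarrow> s ` I \<in> M x)"
    moreover from this obtain s where "approx x I 0 s" using approx_ex[OF x] by blast
    ultimately show "interval_rank L x (\<Squnion>\<^bsub>L\<^esub>(insert x ((\<lambda>\<epsilon>. end_ray L x \<epsilon> 1) ` I))) = card I"
      using key by simp
  qed (use key in auto)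
qed

text \<open>Whether a point with \<open>A\<close> optimal lies below another point is decided on
  \<open>A\<close>. The point that has \<open>A\<close> optimal and takes the larger of the two
  values on \<open>A\<close> is therefore the least upper bound.\<close>

lemma join_base:
  assumes u: "u \<in> carrier L" and v: "v \<in> carrier L" and A: "A \<in> M u" "A \<in> M v"
  shows "A \<in> M (u \<squnion>\<^bsub>L\<^esub> v)" "f \<in> A \<Longrightarrow> (u \<squnion>\<^bsub>L\<^esub> v) f = max (u f) (v f)"
proof -
  have AB: "A \<in> \<B>" using maximizersD(1)[OF A(1)] .
  obtain z where z: "z \<in> carrier L" "A \<in> M z" "\<And>f. f \<in> A \<Longrightarrow> z f = max (u f) (v f)"
  proof (rule ex_carrier_of_base[OF u AB, of "\<lambda>f. max (u f) (v f)"])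
    show "max (u f) (v f) \<in> \<int>" if "f \<in> A" for f
      using carrierD(3)[OF u, of f] carrierD(3)[OF v, of f] baseD(1)[OF AB] that by (auto simp: max_def)
  qed blast
  have "u \<squnion>\<^bsub>L\<^esub> v = z"
  proof (rule join_eqI[OF u v z(1)])
    show "u \<sqsubseteq>\<^bsub>L\<^esub> z" by (rule carrier_le[OF u z(1) A(1)]) (simp add: z(3))
    show "v \<sqsubseteq>\<^bsub>L\<^esub> z" by (rule carrier_le[OF v z(1) A(2)]) (simp add: z(3))
    fix w assume w: "w \<in> carrier L" "u \<sqsubseteq>\<^bsub>L\<^esub> w" "v \<sqsubseteq>\<^bsub>L\<^esub> w"
    show "z \<sqsubseteq>\<^bsub>L\<^esub> w"
      by (rule carrier_le[OF z(1) w(1) z(2)]) (use w(2,3) z(3) baseD(1)[OF AB] in \<open>auto simp: le_L\<close>)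
  qed
  then show "A \<in> M (u \<squnion>\<^bsub>L\<^esub> v)" "f \<in> A \<Longrightarrow> (u \<squnion>\<^bsub>L\<^esub> v) f = max (u f) (v f)" using z by auto
qed

text \<open>Local optimality of \<open>A\<close> bounds differences \<open>z g - z f\<close> of
  coordinates by constants, and such bounds survive coordinatewise minima.\<close>

lemma meet_base:
  assumes u: "u \<in> carrier L" and v: "v \<in> carrier L" and A: "A \<in> M u" "A \<in> M v"
  shows "A \<in> M (u \<sqinter>\<^bsub>L\<^esub> v)"
  unfolding meet_eq[OF u v]
proof (rule local_optimum)
  show AB: "A \<in> \<B>" using maximizersD(1)[OF A(1)] .
  fix f g assume f: "f \<in> A" and g: "g \<in> E - A" and B: "insert g (A - {f}) \<in> \<B>"
  then have gA: "g \<notin> A" "g \<in> E" "f \<in> E" using baseD(1)[OF AB] by auto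
  note sw = vm_add_swap[OF AB f gA(1)]
  show "vm_add \<omega> (\<lambda>e\<in>E. min (u e) (v e)) (insert g (A - {f})) \<le> vm_add \<omega> (\<lambda>e\<in>E. min (u e) (v e)) A"
    using maximizersD(2)[OF A(1) B] maximizersD(2)[OF A(2) B] sw[of u] sw[of v] sw[of "\<lambda>e\<in>E. min (u e) (v e)"] gA(2,3)
    by (simp add: min_def)
qed

lemma asc_pow_eq:
  assumes z: "z \<in> carrier L" shows "asc_pow L k z = (\<lambda>e\<in>E. z e + of_int k)"
proof -
  have up: "(asc L ^^ m) z = (\<lambda>e\<in>E. z e + real m)" for m
  proof (induction m)
    case (Suc m)
    have "(asc L ^^ Suc m) z = asc L (\<lambda>e\<in>E. z e + real m)" by (simp only: funpow.simps comp_apply Suc)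
    also have "\<dots> = (\<lambda>e\<in>E. z e + real (Suc m))"
      using asc_eq[OF const_carrier[OF z Ints_of_nat, of m]] by (auto simp: fun_eq_iff)
    finally show ?case .
  qed (use carrierD(2)[OF z] in \<open>auto simp: fun_eq_iff extensional_def\<close>)
  have inv: "inv_into (carrier L) (asc L) y = (\<lambda>e\<in>E. y e + - 1)" if y: "y \<in> carrier L" for y
    using inv_into_f_eq[of "asc L" "carrier L"] asc_bij asc_inverse[OF y] const_carrier[OF y, of "-1"]
    by (simp add: bij_betw_def)
  have down: "(inv_into (carrier L) (asc L) ^^ m) z = (\<lambda>e\<in>E. z e + - real m)" for m
  proof (induction m)
    case (Suc m)
    have c: "(\<lambda>e\<in>E. z e + - real m) \<in> carrier L" by (rule const_carrier[OF z]) simp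
    have "(inv_into (carrier L) (asc L) ^^ Suc m) z = inv_into (carrier L) (asc L) (\<lambda>e\<in>E. z e + - real m)"
      by (simp only: funpow.simps comp_apply Suc)
    also have "\<dots> = (\<lambda>e\<in>E. z e + - real (Suc m))"
      unfolding inv[OF c] by (auto simp: fun_eq_iff)
    finally show ?case .
  qed (use carrierD(2)[OF z] in \<open>auto simp: fun_eq_iff extensional_def\<close>)
  show ?thesis using up[of "nat k"] down[of "nat (- k)"] by (auto simp: asc_pow_def)
qed

section \<open>Apartments and the valuation on ends\<close>

text \<open>Representatives in \<open>E\<close> that are close enough to the ends in \<open>I\<close> form a base that is optimal
  at \<open>z\<close>. This holds on the whole apartment of \<open>I\<close>, and reduces the computation of \<open>x\<^sub>I\<close> to
  comparing coordinates on such a base.\<close>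
definition adapted :: "('a \<Rightarrow> real) \<Rightarrow> (nat \<Rightarrow> 'a \<Rightarrow> real) set set \<Rightarrow> ('a \<Rightarrow> real) \<Rightarrow> bool" where
  "adapted x I z \<longleftrightarrow> z \<in> carrier L \<and> (\<exists>N. \<forall>s. approx x I N s \<longrightarrow> s ` I \<in> M z)"

lemma eray_base:
  assumes x: "x \<in> carrier L" and A: "A \<in> M x" and e: "e \<in> A"
  shows "A \<in> M (eray x e l)" "f \<in> A \<Longrightarrow> f \<noteq> e \<Longrightarrow> eray x e l f = x f"
proof -
  have AE: "A \<subseteq> E" using baseD(1)[OF maximizersD(1)[OF A]] .
  then have eE: "e \<in> E" using e by blast
  show AM: "A \<in> M (eray x e l)" for l
  proof (induction l)
    case (Suc l)
    have "A \<in> M (step (eray x e l) e)"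
      by (rule step_M(1)[OF eray_carrier(1)[OF x eE] eE Suc]) (use e atom_self[OF eE] in blast)
    then show ?case by (simp only: eray_Suc)
  qed (use A in simp)
  show "eray x e l f = x f" if "f \<in> A" "f \<noteq> e"
  proof (induction l)
    case (Suc l)
    have "f \<notin> atom (eray x e l) e" using atom_base[OF AM e] that by blast
    then show ?case using Suc that AE by (auto simp: eray_Suc step_def)
  qed simp
qed

lemma end_bases_atD:
  assumes "x \<in> carrier L" "I \<in> end_bases_at L x"
  shows "I \<subseteq> ends L" "finite I" "card I = n" "approx x I N s \<Longrightarrow> s ` I \<in> M x"
    "approx x I N s \<Longrightarrow> inj_on s I"
proof -
  show I: "I \<subseteq> ends L" "finite I" "card I = n" using end_bases_at_iff assms by auto
  show M: "s ` I \<in> M x" if "approx x I N s"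
    using that approx_mono[OF assms(1) I(1), of 0 N s] end_bases_at_iff[OF assms(1)] assms(2) by simp
  show "inj_on s I" if "approx x I N s"
    using baseD(3)[OF maximizersD(1)[OF M[OF that]]] I by (intro eq_card_imp_inj_on) auto
qed

lemma adapted_end_ray:
  assumes x: "x \<in> carrier L" and I: "I \<in> end_bases_at L x" and \<epsilon>: "\<epsilon> \<in> I" and s: "approx x I l s"
  shows "s ` I \<in> M (end_ray L x \<epsilon> l)" "end_ray L x \<epsilon> l (s \<epsilon>) = x (s \<epsilon>) + l"
    "\<epsilon>' \<in> I \<Longrightarrow> \<epsilon>' \<noteq> \<epsilon> \<Longrightarrow> end_ray L x \<epsilon> l (s \<epsilon>') = x (s \<epsilon>')"
proof -
  note D = end_bases_atD[OF x I]
  have \<epsilon>L: "\<epsilon> \<in> ends L" and sb: "s \<epsilon> \<in> nbhd x \<epsilon> l" using D(1) \<epsilon> s by (auto simp: approx_def)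
  have eq: "end_ray L x \<epsilon> l = eray x (s \<epsilon>) l" using nbhd_approx(1)[OF x \<epsilon>L sb, of l] by simp
  have sE: "s \<epsilon> \<in> E" using sb nbhd_E by blast
  have in1: "s \<epsilon> \<in> s ` I" using \<epsilon> by blast
  show "s ` I \<in> M (end_ray L x \<epsilon> l)" unfolding eq by (rule eray_base(1)[OF x D(4)[OF s] in1])
  show "end_ray L x \<epsilon> l (s \<epsilon>) = x (s \<epsilon>) + l" unfolding eq by (rule eray_apply[OF sE])
  show "end_ray L x \<epsilon> l (s \<epsilon>') = x (s \<epsilon>')" if "\<epsilon>' \<in> I" "\<epsilon>' \<noteq> \<epsilon>"
  proof -
    have "s \<epsilon>' \<noteq> s \<epsilon>" using inj_onD[OF D(5)[OF s]] that \<epsilon> by blast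
    then show ?thesis unfolding eq using eray_base(2)[OF x D(4)[OF s] in1, of "s \<epsilon>'"] that by blast
  qed
qed

lemma end_ray_carrier:
  assumes "x \<in> carrier L" "\<epsilon> \<in> ends L" shows "end_ray L x \<epsilon> l \<in> carrier L"
  by (rule rayD(1)[OF end_ray_props(3)[OF assms]])

text \<open>The adapted points form a sublattice through the generating rays; two precisions are
  reconciled by their maximum.\<close>

lemma hull_adapted:
  assumes x: "x \<in> carrier L" and I: "I \<in> end_bases_at L x"
    and z: "z \<in> sublattice L hull (\<Union>\<epsilon>\<in>I. range (end_ray L x \<epsilon>))"
  shows "adapted x I z"
proof -
  note D = end_bases_atD[OF x I]
  have "sublattice L hull (\<Union>\<epsilon>\<in>I. range (end_ray L x \<epsilon>)) \<subseteq> {z. adapted x I z}"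
  proof (rule hull_minimal)
    show "(\<Union>\<epsilon>\<in>I. range (end_ray L x \<epsilon>)) \<subseteq> {z. adapted x I z}"
    proof
      fix z assume "z \<in> (\<Union>\<epsilon>\<in>I. range (end_ray L x \<epsilon>))"
      then obtain \<epsilon> l where z: "\<epsilon> \<in> I" "z = end_ray L x \<epsilon> l" by blast
      have "\<forall>s. approx x I l s \<longrightarrow> s ` I \<in> M z" unfolding z(2) using adapted_end_ray(1)[OF x I z(1)] by blast
      moreover have "z \<in> carrier L" unfolding z(2) using end_ray_carrier[OF x] D(1) z(1) by blast
      ultimately show "z \<in> {z. adapted x I z}" unfolding adapted_def by blast
    qed
    show "sublattice L {z. adapted x I z}"
      unfolding sublattice_def
    proof (intro conjI ballI)
      show "{z. adapted x I z} \<subseteq> carrier L" unfolding adapted_def by blast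
      fix u v assume "u \<in> {z. adapted x I z}" "v \<in> {z. adapted x I z}"
      then obtain N N' where u: "u \<in> carrier L" "\<And>s. approx x I N s \<Longrightarrow> s ` I \<in> M u"
        and v: "v \<in> carrier L" "\<And>s. approx x I N' s \<Longrightarrow> s ` I \<in> M v"
        unfolding adapted_def by blast
      have uv: "s ` I \<in> M u" "s ` I \<in> M v" if "approx x I (max N N') s" for s
        using u(2) v(2) approx_mono[OF x D(1) _ that] by simp_all
      have "\<forall>s. approx x I (max N N') s \<longrightarrow> s ` I \<in> M (u \<squnion>\<^bsub>L\<^esub> v)"
        using join_base(1)[OF u(1) v(1)] uv by blast
      then show "u \<squnion>\<^bsub>L\<^esub> v \<in> {z. adapted x I z}" unfolding adapted_def using L.join_closed[OF u(1) v(1)] by blast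
      have "\<forall>s. approx x I (max N N') s \<longrightarrow> s ` I \<in> M (u \<sqinter>\<^bsub>L\<^esub> v)"
        using meet_base[OF u(1) v(1)] uv by blast
      then show "u \<sqinter>\<^bsub>L\<^esub> v \<in> {z. adapted x I z}" unfolding adapted_def using L.meet_closed[OF u(1) v(1)] by blast
    qed
  qed
  then show ?thesis using z by blast
qed

lemma apartment_adapted:
  assumes x: "x \<in> carrier L" and I: "I \<in> end_bases_at L x" and y: "y \<in> apartment_from L x I"
  shows "adapted x I y"
proof -
  obtain k z where z: "z \<in> sublattice L hull (\<Union>\<epsilon>\<in>I. range (end_ray L x \<epsilon>))" "y = asc_pow L k z"
    using y unfolding apartment_from_def by blast
  have a: "adapted x I z" by (rule hull_adapted[OF x I z(1)])
  then have zc: "z \<in> carrier L" unfolding adapted_def by blast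
  have yz: "y = (\<lambda>e\<in>E. z e + of_int k)" using z(2) asc_pow_eq[OF zc] by simp
  have "y \<in> carrier L" unfolding yz by (rule const_carrier[OF zc]) simp
  moreover have "M y = M z" unfolding yz by (rule maximizers_const)
  ultimately show ?thesis using a by (simp add: adapted_def)
qed

lemma diff_const_near_end:
  assumes x: "x \<in> carrier L" and y: "y \<in> carrier L" and \<epsilon>: "\<epsilon> \<in> ends L" and le: "x \<sqsubseteq>\<^bsub>L\<^esub> y"
  shows "\<exists>l. \<forall>e\<in>nbhd x \<epsilon> l. y e = x e + real l"
proof -
  obtain l where "\<And>e. e \<in> directions (end_ray L x \<epsilon>) l \<Longrightarrow> y e = end_ray L x \<epsilon> 0 e + real l"
    using ray_join_approx[OF end_ray_props(3)[OF x \<epsilon>] y] end_ray_props(2)[OF x \<epsilon>] le by metis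
  then show ?thesis using end_ray_props(2)[OF x \<epsilon>] by (auto simp: nbhd_def)
qed

text \<open>Among the representatives, a point on the ray of an end raises only that of this end, so
  joining one such point for each end of \<open>J\<close> produces prescribed increments. The
  generating family stays \<open>I\<close> throughout the induction on \<open>J\<close>; the base
  case is \<open>x\<close> itself, the initial point of some ray, whence
  \<open>I \<noteq> {}\<close>.\<close>

lemma ex_hull_element:
  assumes x: "x \<in> carrier L" and I: "I \<in> end_bases_at L x" and "I \<noteq> {}" and J: "J \<subseteq> I"
  shows "\<exists>h\<in>sublattice L hull (\<Union>\<epsilon>\<in>I. range (end_ray L x \<epsilon>)). \<exists>N. \<forall>s. approx x I N s \<longrightarrow>
    s ` I \<in> M h \<and> (\<forall>\<epsilon>\<in>I. h (s \<epsilon>) = x (s \<epsilon>) + (if \<epsilon> \<in> J then real (l \<epsilon>) else 0))"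
proof -
  let ?R = "\<Union>\<epsilon>\<in>I. range (end_ray L x \<epsilon>)"
  let ?H = "sublattice L hull ?R"
  note D = end_bases_atD[OF x I]
  have sub: "?R \<subseteq> ?H" by (rule hull_subset)
  have join: "u \<squnion>\<^bsub>L\<^esub> v \<in> ?H" if "u \<in> ?H" "v \<in> ?H" for u v
    using that unfolding hull_def sublattice_def by blast
  have "finite J" using J D(2) finite_subset by blast
  then show ?thesis using J
  proof (induction J)
    case empty
    obtain \<epsilon>\<^sub>0 where e0: "\<epsilon>\<^sub>0 \<in> I" using \<open>I \<noteq> {}\<close> by blast
    have "end_ray L x \<epsilon>\<^sub>0 0 = x" using end_ray_props(2)[OF x] D(1) e0 by blast
    then have "x \<in> ?R" using e0 by (metis UN_iff rangeI)
    then have "x \<in> ?H" using sub by blast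
    then show ?case using D(4)[of 0] by (intro bexI[of _ x] exI[of _ 0]) auto
  next
    case (insert \<epsilon> J)
    then obtain h N where h: "h \<in> ?H" and hN: "\<And>s. approx x I N s \<Longrightarrow>
      s ` I \<in> M h \<and> (\<forall>\<epsilon>\<in>I. h (s \<epsilon>) = x (s \<epsilon>) + (if \<epsilon> \<in> J then real (l \<epsilon>) else 0))" by auto
    have \<epsilon>: "\<epsilon> \<in> I" using insert by simp
    have hc: "h \<in> carrier L" using hull_adapted[OF x I h] by (simp add: adapted_def)
    let ?a = "end_ray L x \<epsilon> (l \<epsilon>)"
    have ac: "?a \<in> carrier L" using end_ray_carrier[OF x] D(1) \<epsilon> by blast
    have "?a \<in> ?R" using \<epsilon> by blast
    then have aH: "?a \<in> ?H" using sub by blast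
    have "s ` I \<in> M (h \<squnion>\<^bsub>L\<^esub> ?a) \<and>
        (\<forall>\<epsilon>'\<in>I. (h \<squnion>\<^bsub>L\<^esub> ?a) (s \<epsilon>') = x (s \<epsilon>') + (if \<epsilon>' \<in> insert \<epsilon> J then real (l \<epsilon>') else 0))"
      if s: "approx x I (max N (l \<epsilon>)) s" for s
    proof -
      have s1: "approx x I N s" and s2: "approx x I (l \<epsilon>) s" using approx_mono[OF x D(1) _ s] by simp_all
      have M1: "s ` I \<in> M h" and co: "\<And>\<epsilon>'. \<epsilon>' \<in> I \<Longrightarrow> h (s \<epsilon>') = x (s \<epsilon>') + (if \<epsilon>' \<in> J then real (l \<epsilon>') else 0)"
        using hN[OF s1] by auto
      note A = adapted_end_ray[OF x I \<epsilon> s2]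
      have "(h \<squnion>\<^bsub>L\<^esub> ?a) (s \<epsilon>') = x (s \<epsilon>') + (if \<epsilon>' \<in> insert \<epsilon> J then real (l \<epsilon>') else 0)" if e': "\<epsilon>' \<in> I" for \<epsilon>'
      proof -
        have "(h \<squnion>\<^bsub>L\<^esub> ?a) (s \<epsilon>') = max (h (s \<epsilon>')) (?a (s \<epsilon>'))"
          by (rule join_base(2)[OF hc ac M1 A(1)]) (use e' in blast)
        then show ?thesis using co[OF e'] A(2) A(3)[OF e'] insert.hyps(2)
          by (cases "\<epsilon>' = \<epsilon>") (auto simp: max_def)
      qed
      then show ?thesis using join_base(1)[OF hc ac M1 A(1)] by blast
    qed
    then show ?case using join[OF h aH] by blast
  qed
qed

text \<open>The increments along rays are natural numbers, so \<open>y\<close> is first lifted above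
  \<open>x\<close> by a constant \<open>d\<close>; a negative power of the ascending operator undoes
  this inside the apartment.\<close>

lemma ex_apartment_element:
  assumes x: "x \<in> carrier L" and y: "y \<in> carrier L" and I: "I \<in> end_bases_at L x" and ne: "I \<noteq> {}"
  shows "\<exists>c\<in>apartment_from L x I. \<exists>N. \<forall>s. approx x I N s \<longrightarrow> s ` I \<in> M c \<and> (\<forall>\<epsilon>\<in>I. c (s \<epsilon>) = y (s \<epsilon>))"
proof -
  note D = end_bases_atD[OF x I]
  obtain d :: nat where d: "\<And>e. e \<in> E \<Longrightarrow> x e \<le> y e + d" using ex_shift_le[OF y x] by blast
  let ?y = "\<lambda>e\<in>E. y e + real d"
  have yc: "?y \<in> carrier L" by (rule const_carrier[OF y]) simp
  have xy: "x \<sqsubseteq>\<^bsub>L\<^esub> ?y" using d by (simp add: le_L)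
  have "\<forall>\<epsilon>\<in>I. \<exists>l. \<forall>e\<in>nbhd x \<epsilon> l. ?y e = x e + real l"
    using diff_const_near_end[OF x yc _ xy] D(1) by blast
  then obtain l where l: "\<And>\<epsilon> e. \<epsilon> \<in> I \<Longrightarrow> e \<in> nbhd x \<epsilon> (l \<epsilon>) \<Longrightarrow> ?y e = x e + real (l \<epsilon>)"
    using bchoice[of I "\<lambda>\<epsilon> l. \<forall>e\<in>nbhd x \<epsilon> l. ?y e = x e + real l"] by blast
  obtain h N where h: "h \<in> sublattice L hull (\<Union>\<epsilon>\<in>I. range (end_ray L x \<epsilon>))"
    and hN: "\<And>s. approx x I N s \<Longrightarrow>
      s ` I \<in> M h \<and> (\<forall>\<epsilon>\<in>I. h (s \<epsilon>) = x (s \<epsilon>) + (if \<epsilon> \<in> I then real (l \<epsilon>) else 0))"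
    using ex_hull_element[OF x I ne subset_refl, of l] by blast
  have hc: "h \<in> carrier L" using hull_adapted[OF x I h] by (simp add: adapted_def)
  define c where "c = asc_pow L (- int d) h"
  have ceq: "c = (\<lambda>e\<in>E. h e + - real d)" unfolding c_def using asc_pow_eq[OF hc, of "- int d"] by simp
  have Mc: "M c = M h" unfolding ceq by (rule maximizers_const)
  let ?N = "max N (Max (l ` I))"
  have "s ` I \<in> M c \<and> (\<forall>\<epsilon>\<in>I. c (s \<epsilon>) = y (s \<epsilon>))" if s: "approx x I ?N s" for s
  proof -
    have s1: "approx x I N s" using approx_mono[OF x D(1) _ s] by simp
    have "c (s \<epsilon>) = y (s \<epsilon>)" if e: "\<epsilon> \<in> I" for \<epsilon>
    proof -
      have "l \<epsilon> \<le> Max (l ` I)" using e D(2) by simp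
      then have "approx x I (l \<epsilon>) s" using approx_mono[OF x D(1) _ s] by simp
      then have sn: "s \<epsilon> \<in> nbhd x \<epsilon> (l \<epsilon>)" using e by (simp add: approx_def)
      then have sE: "s \<epsilon> \<in> E" using nbhd_E by blast
      have "h (s \<epsilon>) = x (s \<epsilon>) + real (l \<epsilon>)" using hN[OF s1] e by simp
      then show ?thesis using l[OF e sn] sE ceq by simp
    qed
    then show ?thesis using hN[OF s1] Mc by simp
  qed
  moreover have "c \<in> apartment_from L x I" unfolding apartment_from_def c_def using h by blast
  ultimately show ?thesis by blast
qed

lemma end_basesD:
  assumes "I \<in> end_bases L"
  shows "I \<subseteq> ends L" "finite I" "card I = n"
  using assms end_bases_atD unfolding end_bases_def by blast+

lemma lattice_valuation_approx:
  assumes n: "n \<ge> 1" and x: "x \<in> carrier L" and I: "I \<in> end_bases L"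
  shows "\<exists>N. \<forall>s. approx x I N s \<longrightarrow>
    s ` I \<in> \<B> \<and> inj_on s I \<and> lattice_valuation L x I = vm_add \<omega> x (s ` I) - r x"
proof -
  define y where "y = (SOME y. y \<in> carrier L \<and> I \<in> end_bases_at L y)"
  have "\<exists>y. y \<in> carrier L \<and> I \<in> end_bases_at L y" using I unfolding end_bases_def by blast
  then have y: "y \<in> carrier L" and Iy: "I \<in> end_bases_at L y" unfolding y_def by (metis (mono_tags, lifting) someI_ex)+
  note D = end_bases_atD[OF y Iy]
  have ap: "apartment L I = apartment_from L y I" by (simp add: apartment_def y_def)
  \<comment> \<open>For empty \<open>I\<close> the rays generate nothing and the apartment would be
    empty.\<close>
  have ne: "I \<noteq> {}" using D(3) n by auto
  obtain c N where c: "c \<in> apartment_from L y I"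
    and cN: "\<And>s. approx y I N s \<Longrightarrow> s ` I \<in> M c \<and> (\<forall>\<epsilon>\<in>I. c (s \<epsilon>) = x (s \<epsilon>))"
    using ex_apartment_element[OF y x Iy ne] by blast
  have cc: "c \<in> carrier L" using apartment_adapted[OF y Iy c] by (simp add: adapted_def)
  obtain s0 where s0: "approx y I N s0" using approx_ex[OF y D(1)] by blast
  have cx: "c \<sqsubseteq>\<^bsub>L\<^esub> x"
  proof (rule carrier_le[OF cc x])
    show "s0 ` I \<in> M c" using cN[OF s0] by blast
    show "c f \<le> x f" if "f \<in> s0 ` I" for f using cN[OF s0] that by auto
  qed
  \<comment> \<open>Maximality of \<open>c\<close>: a member of the apartment below \<open>x\<close>
    has an optimal base of representatives, and on these \<open>c\<close> equals
    \<open>x\<close>.\<close>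
  have zc: "z \<sqsubseteq>\<^bsub>L\<^esub> c" if z: "z \<in> apartment_from L y I" "z \<sqsubseteq>\<^bsub>L\<^esub> x" for z
  proof -
    obtain N' where zc: "z \<in> carrier L" and zN: "\<And>s. approx y I N' s \<Longrightarrow> s ` I \<in> M z"
      using apartment_adapted[OF y Iy z(1)] unfolding adapted_def by blast
    obtain s where s: "approx y I (max N N') s" using approx_ex[OF y D(1)] by blast
    have s1: "approx y I N s" and s2: "approx y I N' s" using approx_mono[OF y D(1) _ s] by simp_all
    show ?thesis
    proof (rule carrier_le[OF zc cc zN[OF s2]])
      fix f assume f: "f \<in> s ` I"
      then have "f \<in> E" using baseD(1)[OF maximizersD(1)[OF zN[OF s2]]] by blast
      then show "z f \<le> c f" using z(2) cN[OF s1] f by (auto simp: le_L)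
    qed
  qed
  have "least L c (Upper L {z \<in> apartment L I. z \<sqsubseteq>\<^bsub>L\<^esub> x})"
    unfolding least_def Upper_def using cc c cx zc by (auto simp: ap)
  then have sup: "\<Squnion>\<^bsub>L\<^esub>{z \<in> apartment L I. z \<sqsubseteq>\<^bsub>L\<^esub> x} = c" by (rule sup_eqI)
  have val: "lattice_valuation L x I = r c - r x"
    unfolding lattice_valuation_def sup using interval_rank_eq[OF cc x cx] by simp
  \<comment> \<open>Precision has so far been measured at the point \<open>y\<close> that generates
    the apartment; from here on it is measured at \<open>x\<close>.\<close>
  obtain N' where N': "\<And>s. approx x I N' s \<Longrightarrow> approx y I N s"
    using approx_change_base[OF y x D(1,2)] by blast
  have "s ` I \<in> \<B> \<and> inj_on s I \<and> lattice_valuation L x I = vm_add \<omega> x (s ` I) - r x"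
    if "approx x I N' s" for s
  proof -
    have s: "approx y I N s" by (rule N'[OF that])
    have M: "s ` I \<in> M c" and co: "\<And>\<epsilon>. \<epsilon> \<in> I \<Longrightarrow> c (s \<epsilon>) = x (s \<epsilon>)" using cN[OF s] by auto
    have "vm_add \<omega> c (s ` I) = vm_add \<omega> x (s ` I)"
      unfolding vm_add_def using co by (intro arg_cong2[of _ _ _ _ "(+)"] sum.cong) auto
    then show ?thesis using val r_eq[OF M] maximizersD(1)[OF M] D(5)[OF s] by simp
  qed
  then show ?thesis by blast
qed

text \<open>Let \<open>z\<close> be the point that has \<open>B\<close> optimal and agrees with
  \<open>x\<close> on \<open>B\<close>, so that \<open>r z\<close> is the value of \<open>B\<close>
  at \<open>x\<close>. A base optimal at \<open>z\<close> with two elements in one of the balls of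
  index \<open>N\<close> would have value at most \<open>r x - (N + 1)\<close> at \<open>x\<close>,
  hence at \<open>z\<close>, which is too little. So each of these balls lies in a single flat at
  \<open>z\<close>, and the ends form a base at \<open>z\<close>.\<close>

lemma end_base_of_base:
  assumes n: "n \<ge> 1" and x: "x \<in> carrier L" and B: "B \<in> \<B>" "r x - real N \<le> vm_add \<omega> x B"
    and t: "\<And>e. e \<in> B \<Longrightarrow> t e \<in> ends L" "\<And>e. e \<in> B \<Longrightarrow> e \<in> nbhd x (t e) N"
  shows "inj_on t B" "t ` B \<in> end_bases L" "lattice_valuation L x (t ` B) = vm_add \<omega> x B - r x"
proof -
  note Bb = baseD[OF B(1)]
  show inj: "inj_on t B"
  proof (rule inj_onI, rule ccontr)
    fix e f assume ef: "e \<in> B" "f \<in> B" "t e = t f" "e \<noteq> f"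
    then have "vm_add \<omega> x B \<le> r x - (real N + 1)"
      using nbhd_diam[OF x t(1)[OF ef(1)] t(2)[OF ef(1)], of f] t(2)[OF ef(2)] B(1) by simp
    then show False using B(2) by simp
  qed
  obtain z where z: "z \<in> carrier L" "B \<in> M z" "\<And>f. f \<in> B \<Longrightarrow> z f = x f"
  proof (rule ex_carrier_of_base[OF x B(1), of x])
    show "x f \<in> \<int>" if "f \<in> B" for f using carrierD(3)[OF x] Bb(1) that by blast
  qed blast
  have zx: "z \<sqsubseteq>\<^bsub>L\<^esub> x" by (rule carrier_le[OF z(1) x z(2)]) (simp add: z(3))
  have rz: "r z = vm_add \<omega> x B"
    unfolding r_eq[OF z(2)] vm_add_def using z(3) by simp
  have sub: "nbhd x (t e) N \<subseteq> nbhd z (t e) 0" if e: "e \<in> B" for e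
  proof
    fix g assume g: "g \<in> nbhd x (t e) N"
    obtain f where f: "f \<in> nbhd z (t e) 0" "f \<in> nbhd x (t e) N"
      using nbhd_inter[OF z(1) x t(1)[OF e], of 0 N] by blast
    have "g \<in> atom z f"
    proof (rule ccontr)
      assume "g \<notin> atom z f"
      moreover have "g \<in> E" using g nbhd_E by blast
      ultimately obtain A where A: "A \<in> M z" "f \<in> A" "g \<in> A" and "g \<noteq> f" by (auto simp: atom_def)
      have "vm_add \<omega> x A \<le> r x - (real N + 1)"
        by (rule nbhd_diam[OF x t(1)[OF e] g f(2) \<open>g \<noteq> f\<close> maximizersD(1)[OF A(1)] A(3,2)])
      moreover have "vm_add \<omega> z A \<le> vm_add \<omega> x A" using zx by (intro vm_add_mono maximizersD(1)[OF A(1)]) (simp add: le_L)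
      ultimately show False using r_eq[OF A(1)] rz B(2) by simp
    qed
    then show "g \<in> nbhd z (t e) 0" using nbhd_0(1)[OF z(1) t(1)[OF e] f(1)] by simp
  qed
  \<comment> \<open>If \<open>z\<close> were smaller than \<open>x\<close> at \<open>g\<close>, the
    step from \<open>z\<close> along \<open>g\<close> would stay below \<open>x\<close>; but it also
    raises \<open>e\<close>, where \<open>z\<close> and \<open>x\<close> agree.\<close>
  have eqx: "z g = x g" if e: "e \<in> B" and g: "g \<in> nbhd x (t e) N" for e g
  proof (rule ccontr)
    assume ne: "z g \<noteq> x g"
    have eE: "e \<in> E" and gE: "g \<in> E" using e g Bb(1) nbhd_E by blast+
    have "z g \<le> x g" using zx gE by (simp add: le_L)
    then have "step z g \<sqsubseteq>\<^bsub>L\<^esub> x" using step_le[OF z(1) x zx gE] ne by simp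
    moreover have "e \<in> atom z g"
      using nbhd_0(1)[OF z(1) t(1)[OF e]] sub[OF e] g t(2)[OF e] by blast
    ultimately have "z e + 1 \<le> x e" using eE by (force simp: le_L step_def)
    then show False using z(3)[OF e] by simp
  qed
  have st: "approx x (t ` B) N s \<Longrightarrow> approx z (t ` B) 0 s" for s
    unfolding approx_def using sub by blast
  have tI: "t ` B \<subseteq> ends L" "finite (t ` B)" "card (t ` B) = n"
    using t(1) Bb card_image[OF inj] by auto
  let ?s = "inv_into B t"
  have s: "?s (t e) = e" if "e \<in> B" for e using inv_into_f_f[OF inj that] .
  have sa: "approx x (t ` B) N ?s" unfolding approx_def using s t(2) by simp
  have sB: "?s ` t ` B = B" using s by (force simp: image_image)
  have Iz: "t ` B \<in> end_bases_at L z"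
    unfolding end_bases_at_iff[OF z(1)]
  proof (intro conjI allI impI)
    have card: "card (?s ` t ` B) \<le> n" using sB Bb(3) by simp
    fix s assume s1: "approx z (t ` B) 0 s"
    \<comment> \<open>Representatives of the same end span the same flat at \<open>z\<close> and
      hence give the same step, so independence passes from \<open>B\<close> to any other
      choice.\<close>
    have "step z (s \<epsilon>) = step z (?s \<epsilon>)" if "\<epsilon> \<in> t ` B" for \<epsilon>
    proof -
      have "s \<epsilon> \<in> nbhd z \<epsilon> 0" "?s \<epsilon> \<in> nbhd z \<epsilon> 0" using s1 st[OF sa] that by (auto simp: approx_def)
      then show ?thesis using nbhd_0(2)[OF z(1)] tI(1) that by (metis subsetD)
    qed
    then have eq: "step z ` s ` t ` B = step z ` ?s ` t ` B" by (simp add: image_image)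
    have "s ` t ` B \<subseteq> E" using s1 nbhd_E unfolding approx_def by blast
    then have "r (\<Squnion>\<^bsub>L\<^esub>(insert z (step z ` s ` t ` B))) = r z + n \<longleftrightarrow> s ` t ` B \<in> M z"
      using independent_iff_base[OF z(1), of "s ` t ` B"] tI card_image_le[of "t ` B" s] by simp
    moreover have "r (\<Squnion>\<^bsub>L\<^esub>(insert z (step z ` B))) = r z + n"
      using independent_iff_base[OF z(1), of B] Bb z(2) by simp
    ultimately show "s ` t ` B \<in> M z" unfolding eq sB by blast
  qed (use tI in auto)
  then show Ib: "t ` B \<in> end_bases L" unfolding end_bases_def using z(1) by blast
  obtain N1 where N1: "\<And>s. approx x (t ` B) N1 s \<Longrightarrow>
      lattice_valuation L x (t ` B) = vm_add \<omega> x (s ` t ` B) - r x"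
    using lattice_valuation_approx[OF n x Ib] by blast
  obtain s' where s': "approx x (t ` B) (max N N1) s'" using approx_ex[OF x tI(1)] by blast
  have s1: "approx x (t ` B) N s'" "approx x (t ` B) N1 s'" using approx_mono[OF x tI(1) _ s'] by simp_all
  have M: "s' ` t ` B \<in> M z" using end_bases_atD(4)[OF z(1) Iz st[OF s1(1)]] .
  have "vm_add \<omega> x (s' ` t ` B) = vm_add \<omega> z (s' ` t ` B)"
    unfolding vm_add_def
  proof (intro arg_cong2[of _ _ _ _ "(+)"] sum.cong refl)
    fix g assume "g \<in> s' ` t ` B"
    then obtain e where e: "e \<in> B" "g = s' (t e)" by blast
    then have "g \<in> nbhd x (t e) N" using s1(1) unfolding approx_def by blast
    then show "x g = z g" using eqx[OF e(1)] by simp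
  qed
  then have "vm_add \<omega> x (s' ` t ` B) = vm_add \<omega> x B" using r_eq[OF M] rz by simp
  then show "lattice_valuation L x (t ` B) = vm_add \<omega> x B - r x" using N1[OF s1(2)] by simp
qed

end

section \<open>The completion\<close>

locale int_valuated_point = int_valuated +
  fixes x :: "'a \<Rightarrow> real"
  assumes x: "x \<in> carrier L" and n: "n \<ge> 1"
begin

abbreviation "val \<equiv> lattice_valuation L x"

definition \<phi> :: "'a \<Rightarrow> (nat \<Rightarrow> 'a \<Rightarrow> real) set" where
  "\<phi> e = end_of_ray (eray x e)"

lemma phi_end: "e \<in> E \<Longrightarrow> \<phi> e \<in> ends L"
  unfolding \<phi>_def by (rule end_of_ray(1)[OF eray_ray[OF x]])

lemma nbhd_phi:
  assumes e: "e \<in> E" shows "nbhd x (\<phi> e) l = directions (eray x e) l"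
proof -
  have "eray x e \<in> \<phi> e" unfolding \<phi>_def by (rule end_of_ray(2)[OF eray_ray[OF x e]])
  then have "end_ray L x (\<phi> e) = eray x e" using end_ray_props(4)[OF x phi_end[OF e]] by simp
  then show ?thesis by (simp add: nbhd_def)
qed

lemma in_nbhd_phi: "e \<in> E \<Longrightarrow> e \<in> nbhd x (\<phi> e) l"
  by (simp add: nbhd_phi directions_eray atom_self)

lemma nbhd_eq_of_inter:
  assumes "\<epsilon> \<in> ends L" "\<epsilon>' \<in> ends L" "nbhd x \<epsilon> l \<inter> nbhd x \<epsilon>' l \<noteq> {}" "j \<le> l"
  shows "nbhd x \<epsilon> j = nbhd x \<epsilon>' j"
  using directions_eq_of_inter[OF end_ray_props(3)[OF x assms(1)] end_ray_props(3)[OF x assms(2)] _ _ assms(4)]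
    assms(3) end_ray_props(2)[OF x assms(1)] end_ray_props(2)[OF x assms(2)] by (simp add: nbhd_def)

lemma val_nonpos: "val B \<le> 0"
  by (simp add: lattice_valuation_def)

lemma ends_separated:
  assumes "finite I" "I \<subseteq> ends L"
  shows "\<exists>N. \<forall>\<epsilon>\<in>I. \<forall>\<epsilon>'\<in>I. \<epsilon> \<noteq> \<epsilon>' \<longrightarrow> nbhd x \<epsilon> N \<inter> nbhd x \<epsilon>' N = {}"
proof -
  have "\<exists>N. \<forall>q\<in>I \<times> I. fst q \<noteq> snd q \<longrightarrow> nbhd x (fst q) N \<inter> nbhd x (snd q) N = {}"
  proof (rule finite_nat_bound)
    show "finite (I \<times> I)" using assms(1) by simp
    show "\<exists>k. fst q \<noteq> snd q \<longrightarrow> nbhd x (fst q) k \<inter> nbhd x (snd q) k = {}" if "q \<in> I \<times> I" for q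
      using ends_eq_of_nbhd_inter[OF x, of "fst q" "snd q"] that assms(2) by force
    show "fst q \<noteq> snd q \<longrightarrow> nbhd x (fst q) k' \<inter> nbhd x (snd q) k' = {}"
      if "q \<in> I \<times> I" "fst q \<noteq> snd q \<longrightarrow> nbhd x (fst q) k \<inter> nbhd x (snd q) k = {}" "k \<le> k'" for q k k'
    proof -
      have "fst q \<in> ends L" "snd q \<in> ends L" using that(1) assms(2) by auto
      then have "nbhd x (fst q) k' \<subseteq> nbhd x (fst q) k" "nbhd x (snd q) k' \<subseteq> nbhd x (snd q) k"
        using nbhd_antimono[OF x _ that(3)] by auto
      then show ?thesis using that(2) by blast
    qed
  qed
  then show ?thesis by fastforce
qed

section \<open>The valuated matroid on the ends\<close>

text \<open>One choice of representatives serves both bases and is injective on their union, so that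
  differences of sets of ends correspond to differences of sets of elements. The lower bound
  \<open>K\<close> on the precision is left open for \<open>end_exchange\<close>.\<close>

lemma ex_common_approx:
  assumes A: "A \<in> end_bases L" and B: "B \<in> end_bases L"
  obtains s N where "approx x (A \<union> B) N s" "inj_on s (A \<union> B)" "s ` A \<in> \<B>" "s ` B \<in> \<B>"
    "val A = vm_add \<omega> x (s ` A) - r x" "val B = vm_add \<omega> x (s ` B) - r x" "K \<le> N"
proof -
  have sub: "A \<union> B \<subseteq> ends L" and fin: "finite (A \<union> B)" using end_basesD A B by auto
  obtain NA where NA: "\<And>s. approx x A NA s \<Longrightarrow> s ` A \<in> \<B> \<and> val A = vm_add \<omega> x (s ` A) - r x"
    using lattice_valuation_approx[OF n x A] by blast
  obtain NB where NB: "\<And>s. approx x B NB s \<Longrightarrow> s ` B \<in> \<B> \<and> val B = vm_add \<omega> x (s ` B) - r x"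
    using lattice_valuation_approx[OF n x B] by blast
  obtain NS where NS: "\<And>\<epsilon> \<epsilon>'. \<epsilon> \<in> A \<union> B \<Longrightarrow> \<epsilon>' \<in> A \<union> B \<Longrightarrow> \<epsilon> \<noteq> \<epsilon>' \<Longrightarrow> nbhd x \<epsilon> NS \<inter> nbhd x \<epsilon>' NS = {}"
    using ends_separated[OF fin sub] by blast
  let ?N = "max (max NA NB) (max NS K)"
  obtain s where s: "approx x (A \<union> B) ?N s" using approx_ex[OF x sub] by blast
  have a: "approx x (A \<union> B) N s" if "N \<le> ?N" for N using approx_mono[OF x sub that s] .
  have "approx x A NA s" "approx x B NB s" using a[of NA] a[of NB] by (auto simp: approx_def)
  note v = NA[OF this(1)] NB[OF this(2)]
  have aS: "s \<epsilon> \<in> nbhd x \<epsilon> NS" if "\<epsilon> \<in> A \<union> B" for \<epsilon> using a[of NS] that unfolding approx_def by simp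
  have inj: "inj_on s (A \<union> B)"
  proof (rule inj_onI, rule ccontr)
    fix \<epsilon> \<epsilon>' assume *: "\<epsilon> \<in> A \<union> B" "\<epsilon>' \<in> A \<union> B" "s \<epsilon> = s \<epsilon>'" "\<epsilon> \<noteq> \<epsilon>'"
    show False using NS[OF *(1,2,4)] aS[OF *(1)] aS[OF *(2)] *(3) by auto
  qed
  have "K \<le> ?N" by simp
  then show ?thesis using that s inj v by blast
qed

text \<open>The exchange takes place on the representatives. What has to be secured is that the two
  resulting bases have values large enough, for the given precision, to be lifted back to
  ends.\<close>

lemma end_exchange:
  assumes A: "A \<in> end_bases L" and B: "B \<in> end_bases L" and \<epsilon>: "\<epsilon> \<in> A - B"
  shows "\<exists>\<epsilon>'\<in>B - A. insert \<epsilon>' (A - {\<epsilon>}) \<in> end_bases L \<and> insert \<epsilon> (B - {\<epsilon>'}) \<in> end_bases L \<and>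
    val A + val B \<le> val (insert \<epsilon>' (A - {\<epsilon>})) + val (insert \<epsilon> (B - {\<epsilon>'}))"
proof -
  \<comment> \<open>Each new base will have value at most \<open>r x\<close>, and together they
    reach at least \<open>val A + val B + 2 * r x\<close>. Hence each has value at least
    \<open>r x - K\<close>.\<close>
  define K where "K = nat \<lceil>- (val A + val B)\<rceil>"
  have K: "- (val A + val B) \<le> K" unfolding K_def by linarith
  obtain s N where s: "approx x (A \<union> B) N s" "inj_on s (A \<union> B)" "s ` A \<in> \<B>" "s ` B \<in> \<B>"
    "val A = vm_add \<omega> x (s ` A) - r x" "val B = vm_add \<omega> x (s ` B) - r x" "K \<le> N"
    using ex_common_approx[OF A B, of K] .
  have inj: "s a = s b \<longleftrightarrow> a = b" if "a \<in> A \<union> B" "b \<in> A \<union> B" for a b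
    using inj_on_eq_iff[OF s(2) that] .
  have "s \<epsilon> \<in> s ` A - s ` B" using \<epsilon> inj by blast
  then obtain f where f: "f \<in> s ` B - s ` A" "insert f (s ` A - {s \<epsilon>}) \<in> \<B>" "insert (s \<epsilon>) (s ` B - {f}) \<in> \<B>"
    "vm_add \<omega> x (s ` A) + vm_add \<omega> x (s ` B) \<le>
      vm_add \<omega> x (insert f (s ` A - {s \<epsilon>})) + vm_add \<omega> x (insert (s \<epsilon>) (s ` B - {f}))"
    using exchange[OF s(3,4), of "s \<epsilon>" x] by blast
  then obtain \<epsilon>' where e': "\<epsilon>' \<in> B - A" "f = s \<epsilon>'" by blast
  let ?A = "insert \<epsilon>' (A - {\<epsilon>})" and ?B = "insert \<epsilon> (B - {\<epsilon>'})"
  have sA: "insert f (s ` A - {s \<epsilon>}) = s ` ?A" and sB: "insert (s \<epsilon>) (s ` B - {f}) = s ` ?B"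
    using e' \<epsilon> inj by auto
  have sub: "A \<union> B \<subseteq> ends L" using end_basesD A B by auto
  let ?t = "inv_into (A \<union> B) s"
  have t: "?t (s \<epsilon>) = \<epsilon>" if "\<epsilon> \<in> A \<union> B" for \<epsilon> using inv_into_f_f[OF s(2) that] .
  have lift: "C \<in> end_bases L \<and> val C = vm_add \<omega> x (s ` C) - r x"
    if C: "C \<subseteq> A \<union> B" "s ` C \<in> \<B>" "r x - real N \<le> vm_add \<omega> x (s ` C)" for C
  proof -
    have tC: "?t ` s ` C = C" using t C(1) by (force simp: image_image)
    have 1: "?t e \<in> ends L" if e: "e \<in> s ` C" for e
    proof -
      obtain c where c: "c \<in> C" "e = s c" using e by blast
      have "c \<in> A \<union> B" using C(1) c(1) by blast
      then show ?thesis using t[of c] sub unfolding c(2) by auto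
    qed
    have 2: "e \<in> nbhd x (?t e) N" if e: "e \<in> s ` C" for e
    proof -
      obtain c where c: "c \<in> C" "e = s c" using e by blast
      have "c \<in> A \<union> B" using C(1) c(1) by blast
      then show ?thesis using s(1) t c(2) by (simp add: approx_def)
    qed
    show ?thesis using end_base_of_base(2,3)[OF n x C(2,3), of ?t] 1 2 tC by simp
  qed
  have AC: "s ` ?A \<in> \<B>" and BC: "s ` ?B \<in> \<B>" using f(2,3) sA sB by auto
  have "vm_add \<omega> x (s ` ?A) \<le> r x" "vm_add \<omega> x (s ` ?B) \<le> r x" using le_r[OF x] AC BC by auto
  moreover have "val A + val B + 2 * r x \<le> vm_add \<omega> x (s ` ?A) + vm_add \<omega> x (s ` ?B)"
    using f(4) s(5,6) sA sB by simp
  ultimately have "r x - real N \<le> vm_add \<omega> x (s ` ?A)" "r x - real N \<le> vm_add \<omega> x (s ` ?B)"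
    and sum: "val A + val B \<le> (vm_add \<omega> x (s ` ?A) - r x) + (vm_add \<omega> x (s ` ?B) - r x)"
    using K s(7) by linarith+
  then have "?A \<in> end_bases L" "val ?A = vm_add \<omega> x (s ` ?A) - r x"
    "?B \<in> end_bases L" "val ?B = vm_add \<omega> x (s ` ?B) - r x"
    using lift[of ?A] lift[of ?B] AC BC e' \<epsilon> by auto
  then show ?thesis using e'(1) sum by (intro bexI[of _ \<epsilon>']) auto
qed

text \<open>In an optimal base through a representative of the end, that representative is replaced
  by the end and every other element by its own end; for an optimal base precision 0 is
  enough.\<close>

lemma ex_end_base:
  assumes \<epsilon>: "\<epsilon> \<in> ends L"
  shows "\<exists>I\<in>end_bases L. \<epsilon> \<in> I \<and> val I = 0"
proof -
  obtain e where e: "e \<in> nbhd x \<epsilon> 0" using nbhd_nonempty[OF x \<epsilon>] by blast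
  then have eE: "e \<in> E" using nbhd_E by blast
  obtain B where B: "B \<in> M x" "e \<in> B" using carrierD(5)[OF x eE] by blast
  have BE: "B \<subseteq> E" using baseD(1)[OF maximizersD(1)[OF B(1)]] .
  let ?t = "\<lambda>g. if g = e then \<epsilon> else \<phi> g"
  have val: "r x - real 0 \<le> vm_add \<omega> x B" using r_eq[OF B(1)] by simp
  have t: "?t g \<in> ends L" "g \<in> nbhd x (?t g) 0" if "g \<in> B" for g
    using \<epsilon> e phi_end[of g] in_nbhd_phi[of g 0] BE that by (cases "g = e"; auto)+
  have I: "?t ` B \<in> end_bases L" "val (?t ` B) = vm_add \<omega> x B - r x"
    by (rule end_base_of_base[OF n x maximizersD(1)[OF B(1)] val t], assumption, assumption)+
  have "\<epsilon> \<in> ?t ` B" by (rule image_eqI[OF _ B(2)]) simp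
  moreover have "val (?t ` B) = 0" unfolding I(2) using r_eq[OF B(1)] by simp
  ultimately show ?thesis by (intro bexI[OF _ I(1)] conjI)
qed

text \<open>Disjoint balls of index \<open>N\<close> supply representatives that share a base of
  value at least \<open>r x - N\<close>, which is just enough to lift it at precision
  \<open>N\<close>.\<close>

lemma ex_end_base_pair:
  assumes \<epsilon>: "\<epsilon> \<in> ends L" and \<epsilon>': "\<epsilon>' \<in> ends L" and disj: "nbhd x \<epsilon> N \<inter> nbhd x \<epsilon>' N = {}"
  shows "\<exists>I\<in>end_bases L. \<epsilon> \<in> I \<and> \<epsilon>' \<in> I \<and> - real N \<le> val I"
proof -
  obtain e where e: "e \<in> nbhd x \<epsilon> N" using nbhd_nonempty[OF x \<epsilon>] by blast
  obtain f where f: "f \<in> nbhd x \<epsilon>' N" using nbhd_nonempty[OF x \<epsilon>'] by blast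
  have eE: "e \<in> E" and fE: "f \<in> E" using e f nbhd_E by blast+
  have "f \<notin> nbhd x \<epsilon> N" "f \<noteq> e" using e f disj by blast+
  then have "f \<notin> directions (eray x e) N" using nbhd_approx(2)[OF x \<epsilon> e, of N] by simp
  then obtain B where B: "B \<in> \<B>" "e \<in> B" "f \<in> B" "r x - real N \<le> vm_add \<omega> x B"
    using ex_base_not_directions_eray[OF x eE fE _ \<open>f \<noteq> e\<close>] by blast
  have BE: "B \<subseteq> E" using baseD(1)[OF B(1)] .
  let ?t = "\<lambda>g. if g = e then \<epsilon> else if g = f then \<epsilon>' else \<phi> g"
  have t: "?t g \<in> ends L" "g \<in> nbhd x (?t g) N" if "g \<in> B" for g
    using \<epsilon> e \<epsilon>' f phi_end[of g] in_nbhd_phi[of g N] BE that by (cases "g = e"; cases "g = f"; auto)+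
  have I: "?t ` B \<in> end_bases L" "val (?t ` B) = vm_add \<omega> x B - r x"
    by (rule end_base_of_base[OF n x B(1,4) t], assumption, assumption)+
  have "\<epsilon> \<in> ?t ` B" by (rule image_eqI[OF _ B(2)]) simp
  moreover have "\<epsilon>' \<in> ?t ` B" by (rule image_eqI[OF _ B(3)]) (simp add: \<open>f \<noteq> e\<close>)
  moreover have "- real N \<le> val (?t ` B)" unfolding I(2) using B(4) by simp
  ultimately show ?thesis by (intro bexI[OF _ I(1)] conjI)
qed

lemma val_le_of_nbhd_inter:
  assumes I: "I \<in> end_bases L" and \<epsilon>: "\<epsilon> \<in> I" "\<epsilon>' \<in> I" "\<epsilon> \<noteq> \<epsilon>'"
    and int: "nbhd x \<epsilon> N \<inter> nbhd x \<epsilon>' N \<noteq> {}"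
  shows "val I \<le> - (real N + 1)"
proof -
  obtain s N' where s: "approx x (I \<union> I) N' s" "inj_on s (I \<union> I)" "s ` I \<in> \<B>" "val I = vm_add \<omega> x (s ` I) - r x" "N \<le> N'"
    using ex_common_approx[OF I I, of N] by metis
  have eL: "\<epsilon> \<in> ends L" "\<epsilon>' \<in> ends L" using end_basesD(1)[OF I] \<epsilon> by auto
  have "s \<epsilon> \<in> nbhd x \<epsilon> N'" "s \<epsilon>' \<in> nbhd x \<epsilon>' N'" using s(1) \<epsilon> by (auto simp: approx_def)
  then have "s \<epsilon> \<in> nbhd x \<epsilon> N" "s \<epsilon>' \<in> nbhd x \<epsilon>' N" using nbhd_antimono[OF x _ s(5)] eL by blast+
  then have se: "s \<epsilon> \<in> nbhd x \<epsilon> N" "s \<epsilon>' \<in> nbhd x \<epsilon> N" using nbhd_eq_of_inter[OF eL int order_refl] by auto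
  have "s \<epsilon> \<noteq> s \<epsilon>'" using inj_on_eq_iff[OF s(2)] \<epsilon> by simp
  then have "vm_add \<omega> x (s ` I) \<le> r x - (real N + 1)"
    using nbhd_diam[OF x eL(1) se _ s(3)] \<epsilon> by blast
  then show ?thesis using s(4) by simp
qed

lemma valuated_ends: "valuated_matroid n (ends L) (end_bases L) val"
  unfolding valuated_matroid_def matroid_bases_def
proof (intro conjI ballI)
  obtain B where B: "B \<in> M x" using carrierD(4)[OF x] by blast
  obtain e where "e \<in> B" using baseD(3)[OF maximizersD(1)[OF B]] n by fastforce
  then have "e \<in> E" using baseD(1)[OF maximizersD(1)[OF B]] by blast
  then show "end_bases L \<noteq> {}" using ex_end_base phi_end by blast
  show "B \<subseteq> ends L" "finite B" "card B = n" if "B \<in> end_bases L" for B using end_basesD[OF that] by auto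
  fix A B \<epsilon> assume "A \<in> end_bases L" "B \<in> end_bases L" "\<epsilon> \<in> A - B"
  note ex = end_exchange[OF this]
  show "\<exists>\<epsilon>'\<in>B - A. insert \<epsilon>' (A - {\<epsilon>}) \<in> end_bases L" using ex by blast
  show "\<exists>\<epsilon>'\<in>B - A. insert \<epsilon>' (A - {\<epsilon>}) \<in> end_bases L \<and> insert \<epsilon> (B - {\<epsilon>'}) \<in> end_bases L \<and>
    val A + val B \<le> val (insert \<epsilon>' (A - {\<epsilon>})) + val (insert \<epsilon> (B - {\<epsilon>'}))" by (rule ex)
qed

lemma simple_ends: "simple_matroid (ends L) (end_bases L)"
  unfolding simple_matroid_def is_loop_def
proof (intro conjI ballI impI)
  show "\<not> (\<forall>B\<in>end_bases L. \<epsilon> \<notin> B)" if "\<epsilon> \<in> ends L" for \<epsilon> using ex_end_base[OF that] by blast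
  fix \<epsilon> \<epsilon>' assume e: "\<epsilon> \<in> ends L" "\<epsilon>' \<in> ends L" "\<epsilon> \<noteq> \<epsilon>'"
  then obtain N where "nbhd x \<epsilon> N \<inter> nbhd x \<epsilon>' N = {}" using ends_eq_of_nbhd_inter[OF x] by blast
  then show "\<exists>B\<in>end_bases L. {\<epsilon>, \<epsilon>'} \<subseteq> B" using ex_end_base_pair[OF e(1,2)] by blast
qed

text \<open>The metric of the tight span was treated for arbitrary valuated matroids, so that those
  results also apply to the ends.\<close>

sublocale V: valuated n "ends L" "end_bases L" val
  by unfold_locales (rule valuated_ends)

section \<open>Completeness of the ends and density of \<open>E\<close>\<close>

text \<open>\<open>val\<close> is nonpositive and every end lies in a base of value 0. This gives a
  concrete member of the tight span with which every other one is compared.\<close>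

lemma zero_tight_span: "(\<lambda>\<epsilon>\<in>ends L. 0) \<in> tight_span (ends L) (end_bases L) val"
  unfolding tight_span_def
proof (intro CollectI conjI ballI)
  fix \<epsilon> assume e: "\<epsilon> \<in> ends L"
  obtain I where I: "I \<in> end_bases L" "\<epsilon> \<in> I" "val I = 0" using ex_end_base[OF e] by blast
  have z: "(\<Sum>f\<in>B - {\<epsilon>}. (\<lambda>\<epsilon>\<in>ends L. 0 :: real) f) = 0" if "B \<in> end_bases L" for B
    using end_basesD(1)[OF that] by (intro sum.neutral) auto
  show "is_maximum ((\<lambda>B. val B - (\<Sum>f\<in>B - {\<epsilon>}. (\<lambda>\<epsilon>\<in>ends L. 0) f)) ` {B \<in> end_bases L. \<epsilon> \<in> B}) ((\<lambda>\<epsilon>\<in>ends L. 0) \<epsilon>)"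
    unfolding is_maximum_def
  proof
    show "(\<lambda>\<epsilon>\<in>ends L. 0) \<epsilon> \<in> (\<lambda>B. val B - (\<Sum>f\<in>B - {\<epsilon>}. (\<lambda>\<epsilon>\<in>ends L. 0) f)) ` {B \<in> end_bases L. \<epsilon> \<in> B}"
      using e I z[OF I(1)] by (intro image_eqI[of _ _ I]) auto
    show "\<forall>s\<in>(\<lambda>B. val B - (\<Sum>f\<in>B - {\<epsilon>}. (\<lambda>\<epsilon>\<in>ends L. 0) f)) ` {B \<in> end_bases L. \<epsilon> \<in> B}. s \<le> (\<lambda>\<epsilon>\<in>ends L. 0) \<epsilon>"
    proof (intro ballI, elim imageE CollectE conjE)
      fix s B assume B: "s = val B - (\<Sum>f\<in>B - {\<epsilon>}. (\<lambda>\<epsilon>\<in>ends L. 0) f)" "B \<in> end_bases L" "\<epsilon> \<in> B"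
      show "s \<le> (\<lambda>\<epsilon>\<in>ends L. 0) \<epsilon>" unfolding B(1) z[OF B(2)] using val_nonpos e by simp
    qed
  qed
qed simp

text \<open>For \<open>p = 0\<close> the exponent of the distance is the largest value of a base
  through both ends, and this is what lying in a common ball measures. Any other \<open>p\<close>
  differs from 0 by at most \<open>K\<close>, so sums over the \<open>n\<close> elements of a base
  change by at most \<open>C = n * K\<close>.\<close>

lemma dist_nbhd_bounds:
  assumes p: "p \<in> tight_span (ends L) (end_bases L) val"
  shows "\<exists>C. \<forall>\<epsilon>\<in>ends L. \<forall>\<epsilon>'\<in>ends L. \<forall>N.
      (nbhd x \<epsilon> N \<inter> nbhd x \<epsilon>' N \<noteq> {} \<longrightarrow> tight_span_dist (end_bases L) val p \<epsilon> \<epsilon>' < exp (C - real N)) \<and>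
      (tight_span_dist (end_bases L) val p \<epsilon> \<epsilon>' < exp (- C - real N) \<longrightarrow> nbhd x \<epsilon> N \<inter> nbhd x \<epsilon>' N \<noteq> {})"
proof -
  obtain K1 where K1: "\<forall>\<epsilon>\<in>ends L. p \<epsilon> - (\<lambda>\<epsilon>\<in>ends L. 0) \<epsilon> \<le> K1"
    using V.tight_span_bounded_diff[OF n p zero_tight_span] by blast
  obtain K2 where K2: "\<forall>\<epsilon>\<in>ends L. (\<lambda>\<epsilon>\<in>ends L. 0) \<epsilon> - p \<epsilon> \<le> K2"
    using V.tight_span_bounded_diff[OF n zero_tight_span p] by blast
  define K where "K = max K1 K2"
  have K: "\<bar>p \<epsilon>\<bar> \<le> K" if "\<epsilon> \<in> ends L" for \<epsilon> using K1 K2 that by (force simp: K_def)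
  define C where "C = real n * K"
  have C: "\<bar>sum p I\<bar> \<le> C" if I: "I \<in> end_bases L" for I
  proof -
    have "\<bar>sum p I\<bar> \<le> (\<Sum>i\<in>I. \<bar>p i\<bar>)" by (rule sum_abs)
    also have "\<dots> \<le> (\<Sum>i\<in>I. K)" using K end_basesD(1)[OF I] by (intro sum_mono) auto
    finally show ?thesis using end_basesD(3)[OF I] by (simp add: C_def)
  qed
  have up: "tight_span_dist (end_bases L) val p \<epsilon> \<epsilon>' < exp (C - real N)"
    if e: "\<epsilon> \<in> ends L" "\<epsilon>' \<in> ends L" "nbhd x \<epsilon> N \<inter> nbhd x \<epsilon>' N \<noteq> {}" for \<epsilon> \<epsilon>' N
  proof (cases "\<epsilon> = \<epsilon>'")
    case True
    then show ?thesis by (simp add: tight_span_dist_def)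
  next
    case False
    obtain I where I: "I \<in> end_bases L" "\<epsilon> \<in> I" "\<epsilon>' \<in> I"
      "tight_span_dist (end_bases L) val p \<epsilon> \<epsilon>' = exp (val I - sum p I)"
      using V.tight_span_dist_eq[OF n p simple_ends e(1,2) False] by blast
    have "val I \<le> - (real N + 1)" by (rule val_le_of_nbhd_inter[OF I(1-3) False e(3)])
    then have "val I - sum p I < C - real N" using C[OF I(1)] by linarith
    then show ?thesis using I(4) by simp
  qed
  have low: "nbhd x \<epsilon> N \<inter> nbhd x \<epsilon>' N \<noteq> {}"
    if e: "\<epsilon> \<in> ends L" "\<epsilon>' \<in> ends L" "tight_span_dist (end_bases L) val p \<epsilon> \<epsilon>' < exp (- C - real N)" for \<epsilon> \<epsilon>' N
  proof
    assume disj: "nbhd x \<epsilon> N \<inter> nbhd x \<epsilon>' N = {}"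
    then have ne: "\<epsilon> \<noteq> \<epsilon>'" using nbhd_nonempty[OF x e(1)] by blast
    obtain I where I: "I \<in> end_bases L" "\<epsilon> \<in> I" "\<epsilon>' \<in> I" "- real N \<le> val I"
      using ex_end_base_pair[OF e(1,2) disj] by blast
    obtain J where J: "tight_span_dist (end_bases L) val p \<epsilon> \<epsilon>' = exp (val J - sum p J)"
      "val I - sum p I \<le> val J - sum p J"
      using V.tight_span_dist_eq[OF n p simple_ends e(1,2) ne] I(1-3) by blast
    have "- C - real N \<le> val J - sum p J" using J(2) I(4) C[OF I(1)] by linarith
    then show False using e(3) J(1) by simp
  qed
  show ?thesis using up low by blast
qed

text \<open>In a Cauchy sequence the rays from \<open>x\<close> that represent the ends eventually
  agree up to any given index. The stable values form a ray, and its end is the limit.\<close>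

lemma mcomplete_ends:
  assumes p: "p \<in> tight_span (ends L) (end_bases L) val"
  shows "Metric_space.mcomplete (ends L) (tight_span_dist (end_bases L) val p)"
proof -
  let ?d = "tight_span_dist (end_bases L) val p"
  interpret MS: Metric_space "ends L" ?d by (rule V.Metric_space_tight_span_dist[OF n p simple_ends])
  obtain C where up: "\<And>\<epsilon> \<epsilon>' N. \<epsilon> \<in> ends L \<Longrightarrow> \<epsilon>' \<in> ends L \<Longrightarrow> nbhd x \<epsilon> N \<inter> nbhd x \<epsilon>' N \<noteq> {} \<Longrightarrow>
      ?d \<epsilon> \<epsilon>' < exp (C - real N)"
    and low: "\<And>\<epsilon> \<epsilon>' N. \<epsilon> \<in> ends L \<Longrightarrow> \<epsilon>' \<in> ends L \<Longrightarrow> ?d \<epsilon> \<epsilon>' < exp (- C - real N) \<Longrightarrow>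
      nbhd x \<epsilon> N \<inter> nbhd x \<epsilon>' N \<noteq> {}"
    using dist_nbhd_bounds[OF p] by blast
  show ?thesis
    unfolding MS.mcomplete_def
  proof (intro allI impI)
    fix \<sigma> :: "nat \<Rightarrow> (nat \<Rightarrow> 'a \<Rightarrow> real) set"
    assume "MS.MCauchy \<sigma>"
    then have \<sigma>: "\<And>i. \<sigma> i \<in> ends L"
      and cau: "\<And>\<epsilon>. 0 < \<epsilon> \<Longrightarrow> \<exists>N. \<forall>i i'. N \<le> i \<longrightarrow> N \<le> i' \<longrightarrow> ?d (\<sigma> i) (\<sigma> i') < \<epsilon>"
      unfolding MS.MCauchy_def by blast+
    have "\<exists>m. \<forall>i i'. m \<le> i \<longrightarrow> m \<le> i' \<longrightarrow> nbhd x (\<sigma> i) N \<inter> nbhd x (\<sigma> i') N \<noteq> {}" for N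
      using cau[of "exp (- C - real N)"] low[OF \<sigma> \<sigma>] by (metis exp_gt_zero)
    then obtain m where m: "\<And>N i i'. m N \<le> i \<Longrightarrow> m N \<le> i' \<Longrightarrow> nbhd x (\<sigma> i) N \<inter> nbhd x (\<sigma> i') N \<noteq> {}"
      by metis
    \<comment> \<open>Taking the maximum makes one threshold valid for all smaller indices at the
      same time.\<close>
    define k where "k N = Max (m ` {..N})" for N
    have km: "m j \<le> k N" if "j \<le> N" for j N unfolding k_def using that by (intro Max_ge) auto
    let ?e = "\<lambda>i. end_ray L x (\<sigma> i)"
    define a where "a l = ?e (k l) l" for l
    have agree: "?e i j = ?e i' j" if ii: "m l \<le> i" "m l \<le> i'" "j \<le> Suc l" for i i' j l
    proof -
      obtain e where e: "e \<in> nbhd x (\<sigma> i) l" "e \<in> nbhd x (\<sigma> i') l" using m[OF ii(1,2)] by blast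
      show ?thesis using nbhd_approx(1)[OF x \<sigma> e(1) ii(3)] nbhd_approx(1)[OF x \<sigma> e(2) ii(3)] by simp
    qed
    have aj: "a j = ?e i j" if "j \<le> l" "k l \<le> i" for i j l
      unfolding a_def by (rule agree[of j]) (use km[of j j] km[of j l] that in auto)
    have a0: "a 0 = x" unfolding a_def by (rule end_ray_props(2)[OF x \<sigma>])
    have ray: "a \<in> rays L"
    proof (rule rayI)
      show "a 0 \<in> carrier L" using a0 x by simp
      fix l
      obtain e where e: "e \<in> nbhd x (\<sigma> (k l)) l" using nbhd_nonempty[OF x \<sigma>] by blast
      have "a j = eray x e j" if "j \<le> l" for j
        using aj[OF that order_refl] nbhd_approx(1)[OF x \<sigma> e, of j] that by simp
      then show "\<exists>e\<in>E. \<forall>j\<le>l. a j = eray (a 0) e j" unfolding a0 using e nbhd_E by blast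
    qed
    let ?\<alpha> = "end_of_ray a"
    note \<alpha> = end_of_ray[OF ray]
    have er: "end_ray L x ?\<alpha> = a" by (rule end_ray_props(4)[OF x \<alpha> a0])
    \<comment> \<open>The flat at \<open>N\<close> is read off from the points at \<open>N\<close>
      and \<open>N + 1\<close>, hence the threshold at \<open>Suc N\<close>.\<close>
    have near: "nbhd x (\<sigma> i) N \<inter> nbhd x ?\<alpha> N \<noteq> {}" if i: "k (Suc N) \<le> i" for i N
    proof -
      have "nbhd x ?\<alpha> N = nbhd x (\<sigma> i) N"
        unfolding nbhd_def er directions_def using aj[of N "Suc N" i] aj[of "Suc N" "Suc N" i] i by simp
      then show ?thesis using nbhd_nonempty[OF x \<sigma>] by simp
    qed
    have "limitin MS.mtopology \<sigma> ?\<alpha> sequentially"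
      unfolding MS.limit_metric_sequentially
    proof (intro conjI allI impI \<alpha>(1))
      fix d :: real assume "0 < d"
      then obtain N where N: "exp (C - real N) < d" using exp_diff_nat_less_ex by blast
      have "?d (\<sigma> i) ?\<alpha> < d" if "k (Suc N) \<le> i" for i
        using up[OF \<sigma> \<alpha>(1) near[OF that]] N by simp
      then show "\<exists>N. \<forall>i\<ge>N. \<sigma> i \<in> ends L \<and> ?d (\<sigma> i) ?\<alpha> < d" using \<sigma> by blast
    qed
    then show "\<exists>\<alpha>. limitin MS.mtopology \<sigma> \<alpha> sequentially" by blast
  qed
qed

lemma complete_ends: "complete_valuated_matroid n (ends L) (end_bases L) val"
  unfolding complete_valuated_matroid_def
  using valuated_ends simple_ends V.Metric_space_tight_span_dist[OF n _ simple_ends] mcomplete_ends by blast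

lemma dense_phi: "dense_in_valuated_matroid (ends L) (end_bases L) val (\<phi> ` E)"
  unfolding dense_in_valuated_matroid_def
proof (intro conjI ballI)
  show "\<phi> ` E \<subseteq> ends L" using phi_end by blast
  fix p assume p: "p \<in> tight_span (ends L) (end_bases L) val"
  let ?d = "tight_span_dist (end_bases L) val p"
  interpret MS: Metric_space "ends L" ?d by (rule V.Metric_space_tight_span_dist[OF n p simple_ends])
  obtain C where up: "\<And>\<epsilon> \<epsilon>' N. \<epsilon> \<in> ends L \<Longrightarrow> \<epsilon>' \<in> ends L \<Longrightarrow> nbhd x \<epsilon> N \<inter> nbhd x \<epsilon>' N \<noteq> {} \<Longrightarrow>
      ?d \<epsilon> \<epsilon>' < exp (C - real N)"
    using dist_nbhd_bounds[OF p] by blast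
  have "\<exists>\<epsilon>'\<in>\<phi> ` E. \<epsilon>' \<in> MS.mball \<epsilon> d" if \<epsilon>: "\<epsilon> \<in> ends L" and d: "0 < d" for \<epsilon> d
  proof -
    obtain N where N: "exp (C - real N) < d" using exp_diff_nat_less_ex[OF d] by blast
    obtain e where e: "e \<in> nbhd x \<epsilon> N" using nbhd_nonempty[OF x \<epsilon>] by blast
    then have eE: "e \<in> E" using nbhd_E by blast
    have "nbhd x \<epsilon> N \<inter> nbhd x (\<phi> e) N \<noteq> {}" using e in_nbhd_phi[OF eE] by blast
    then have "?d \<epsilon> (\<phi> e) < d" using up[OF \<epsilon> phi_end[OF eE]] N by force
    then show ?thesis using \<epsilon> phi_end[OF eE] eE by (intro bexI[of _ "\<phi> e"]) auto
  qed
  then show "MS.mtopology closure_of \<phi> ` E = ends L" unfolding MS.metric_closure_of by blast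
qed

section \<open>Parallel classes and the simplification of \<open>E\<close>\<close>

lemma not_loop: "e \<in> E \<Longrightarrow> \<not> is_loop \<B> e"
  using carrierD(5)[OF x] maximizersD(1) unfolding is_loop_def by blast

text \<open>The value of a common base of \<open>e\<close> and \<open>f\<close> bounds the indices
  whose flats contain both; without a common base no index can separate them.\<close>

lemma parallel_class_iff:
  assumes e: "e \<in> E" shows "f \<in> parallel_class E \<B> e \<longleftrightarrow> f \<in> E \<and> (\<forall>l. f \<in> directions (eray x e) l)"
proof
  assume f: "f \<in> parallel_class E \<B> e"
  then have fE: "f \<in> E" by (simp add: parallel_class_def)
  have "f \<in> directions (eray x e) l" for l
  proof (cases "f = e")
    case True
    then show ?thesis using atom_self[OF e] by (simp add: directions_eray)
  next
    case False
    then have "\<not> (\<exists>B\<in>\<B>. {e, f} \<subseteq> B)" using f unfolding parallel_class_def by blast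
    then show ?thesis using ex_base_not_directions_eray[OF x e fE _ False] by blast
  qed
  with fE show "f \<in> E \<and> (\<forall>l. f \<in> directions (eray x e) l)" by blast
next
  assume f: "f \<in> E \<and> (\<forall>l. f \<in> directions (eray x e) l)"
  have "\<not> (\<exists>B\<in>\<B>. {e, f} \<subseteq> B)" if "f \<noteq> e"
  proof
    assume "\<exists>B\<in>\<B>. {e, f} \<subseteq> B"
    then obtain B where B: "B \<in> \<B>" "e \<in> B" "f \<in> B" by blast
    obtain l :: nat where "r x - vm_add \<omega> x B < l" using reals_Archimedean2 by blast
    moreover have "vm_add \<omega> x B \<le> r x - (real l + 1)" by (rule directions_eray_le[OF x e _ that B]) (use f in blast)
    ultimately show False by simp
  qed
  then show "f \<in> parallel_class E \<B> e" using f not_loop unfolding parallel_class_def by blast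
qed

lemma phi_eq_iff:
  assumes e: "e \<in> E" and f: "f \<in> E" shows "\<phi> f = \<phi> e \<longleftrightarrow> f \<in> parallel_class E \<B> e"
proof
  assume "\<phi> f = \<phi> e"
  then show "f \<in> parallel_class E \<B> e"
    using parallel_class_iff[OF e] in_nbhd_phi[OF f] nbhd_phi[OF e] f by simp
next
  assume p: "f \<in> parallel_class E \<B> e"
  have "f \<in> nbhd x (\<phi> f) l \<inter> nbhd x (\<phi> e) l" for l
    using p parallel_class_iff[OF e] in_nbhd_phi[OF f] nbhd_phi[OF e] by blast
  then show "\<phi> f = \<phi> e" using ends_eq_of_nbhd_inter[OF x phi_end[OF f] phi_end[OF e]] by blast
qed

text \<open>For uniqueness, the direction contains \<open>e\<close>, so \<open>e\<close> lies in
  every flat of the ray, and this makes the ray parallel to \<open>eray x e\<close>.\<close>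

lemma end_of_element_eq:
  assumes e: "e \<in> E" shows "end_of_element E \<B> \<omega> e = \<phi> e"
  unfolding end_of_element_def
proof (rule the_equality)
  have mem: "eray x e \<in> \<phi> e" unfolding \<phi>_def by (rule end_of_ray(2)[OF eray_ray[OF x e]])
  have "has_infinity_direction E (eray x e) (parallel_class E \<B> e)"
    unfolding has_infinity_direction_def
  proof (intro exI[of _ "directions (eray x e)"] conjI allI ballI)
    show "directions (eray x e) l \<subseteq> E" for l by (rule directions_E)
    show "eray x e (Suc l) g = eray x e l g + indicat_real (directions (eray x e) l) g" if "g \<in> E" for l g
      unfolding directions_eray using that by (simp add: eray_Suc step_def)
    show "(\<Inter>l. directions (eray x e) l) = parallel_class E \<B> e"
    proof (rule Set.set_eqI)
      fix f
      have "f \<in> directions (eray x e) 0 \<Longrightarrow> f \<in> E" using directions_E by blast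
      then show "f \<in> (\<Inter>l. directions (eray x e) l) \<longleftrightarrow> f \<in> parallel_class E \<B> e"
        unfolding parallel_class_iff[OF e] by blast
    qed
  qed
  then show "\<phi> e \<in> ends L \<and> (\<exists>a\<in>\<phi> e. has_infinity_direction E a (parallel_class E \<B> e))"
    using phi_end[OF e] mem by blast
  fix \<epsilon> assume "\<epsilon> \<in> ends L \<and> (\<exists>a\<in>\<epsilon>. has_infinity_direction E a (parallel_class E \<B> e))"
  then obtain a where \<epsilon>: "\<epsilon> \<in> ends L" and a: "a \<in> \<epsilon>"
    and D: "has_infinity_direction E a (parallel_class E \<B> e)" by blast
  obtain F where F: "\<forall>l. F l \<subseteq> E \<and> (\<forall>g\<in>E. a (Suc l) g = a l g + indicat_real (F l) g)"
    "(\<Inter>l. F l) = parallel_class E \<B> e"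
    using D unfolding has_infinity_direction_def by (elim exE conjE)
  have "e \<in> parallel_class E \<B> e" using e not_loop[OF e] by (simp add: parallel_class_def)
  then have "e \<in> F l" for l using F(2) by blast
  then have ea: "e \<in> directions a l" for l using F(1) e by (simp add: directions_def)
  have ra: "a \<in> rays L" using ends_parallel[OF \<epsilon> a a] by (simp add: parallel_iff)
  have "e \<in> directions (eray x e) l" for l by (simp add: directions_eray atom_self[OF e])
  then have "(a, eray x e) \<in> parallel_rays L" using ea ra eray_ray[OF x e] by (auto simp: parallel_iff)
  then have "eray x e \<in> \<epsilon>" using \<epsilon> a in_quotient_imp_closed[OF equiv_parallel] by (auto simp: ends_def)
  then show "\<epsilon> = \<phi> e" by (rule ends_eqI[OF \<epsilon> phi_end[OF e] _ mem])
qed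

text \<open>The fibres of \<phi> on \<open>E\<close> are the parallel classes by
  \<open>phi_eq_iff\<close>, so selecting one element per fibre gives a simplification.\<close>

definition simp_rep :: "(nat \<Rightarrow> 'a \<Rightarrow> real) set \<Rightarrow> 'a" where
  "simp_rep \<epsilon> = (SOME e. e \<in> E \<and> \<phi> e = \<epsilon>)"

definition E0 :: "'a set" where
  "E0 = simp_rep ` \<phi> ` E"

lemma simp_rep: "e \<in> E \<Longrightarrow> simp_rep (\<phi> e) \<in> E" "e \<in> E \<Longrightarrow> \<phi> (simp_rep (\<phi> e)) = \<phi> e"
  unfolding simp_rep_def by (metis (mono_tags, lifting) someI_ex)+

lemma E0_sub: "E0 \<subseteq> E" and phi_E0: "\<phi> ` E0 = \<phi> ` E" and rep_E0: "f \<in> E0 \<Longrightarrow> simp_rep (\<phi> f) = f"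
proof -
  show "E0 \<subseteq> E" using simp_rep(1) by (auto simp: E0_def)
  show "\<phi> ` E0 = \<phi> ` E" unfolding E0_def image_image using simp_rep(2) by (intro image_cong) auto
  show "simp_rep (\<phi> f) = f" if "f \<in> E0" using that simp_rep(2) by (auto simp: E0_def)
qed

lemma inj_phi_E0: "inj_on \<phi> E0"
  by (rule inj_on_inverseI[of _ simp_rep]) (rule rep_E0)

lemma simplification_E0: "is_simplification E \<B> E0"
  unfolding is_simplification_def
proof (intro conjI ballI impI)
  show "E0 \<subseteq> {e \<in> E. \<not> is_loop \<B> e}" using E0_sub not_loop by blast
  fix e assume e: "e \<in> E"
  show "\<exists>!f. f \<in> E0 \<and> f \<in> parallel_class E \<B> e"
  proof (rule ex1I[of _ "simp_rep (\<phi> e)"])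
    show "simp_rep (\<phi> e) \<in> E0 \<and> simp_rep (\<phi> e) \<in> parallel_class E \<B> e"
      using e simp_rep[OF e] phi_eq_iff[OF e simp_rep(1)[OF e]] by (auto simp: E0_def)
    fix f assume f: "f \<in> E0 \<and> f \<in> parallel_class E \<B> e"
    then have "\<phi> f = \<phi> e" using phi_eq_iff[OF e, of f] E0_sub by blast
    then show "f = simp_rep (\<phi> e)" using rep_E0[of f] f by simp
  qed
qed

lemma phi_base:
  assumes B: "B \<in> \<B>" shows "\<phi> ` B \<in> end_bases L" "val (\<phi> ` B) = vm_add \<omega> x B - r x"
proof -
  obtain N :: nat where N: "r x - vm_add \<omega> x B < N" using reals_Archimedean2 by blast
  have "B \<subseteq> E" using baseD(1)[OF B] .
  then show "\<phi> ` B \<in> end_bases L" "val (\<phi> ` B) = vm_add \<omega> x B - r x"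
    using end_base_of_base(2,3)[OF n x B, of N \<phi>] N phi_end in_nbhd_phi by auto
qed

text \<open>An element lies in every ball around its own end, so \<open>simp_rep\<close> is a choice
  of representatives of every precision, whatever \<open>N\<close> the valuation asks for.\<close>

lemma rep_base:
  assumes I: "I \<in> end_bases L" "I \<subseteq> \<phi> ` E" shows "simp_rep ` I \<in> restrict_bases \<B> E0"
proof -
  obtain N where N: "\<And>s. approx x I N s \<Longrightarrow> s ` I \<in> \<B>" using lattice_valuation_approx[OF n x I(1)] by blast
  have "approx x I N simp_rep"
    unfolding approx_def
  proof
    fix \<epsilon> assume "\<epsilon> \<in> I"
    then obtain e where e: "e \<in> E" "\<epsilon> = \<phi> e" using I(2) by blast
    then show "simp_rep \<epsilon> \<in> nbhd x \<epsilon> N" using in_nbhd_phi[OF simp_rep(1)[OF e(1)]] simp_rep(2)[OF e(1)] by simp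
  qed
  then show ?thesis using N I(2) by (auto simp: restrict_bases_def E0_def)
qed

text \<open>Sending \<open>B\<close> to ends and choosing representatives replaces its elements by
  parallel ones in \<open>E0\<close> and keeps those that are already there.\<close>

lemma ex_base_E0:
  assumes B: "B \<in> \<B>" and "F \<subseteq> B" "F \<subseteq> E0" shows "\<exists>B'\<in>restrict_bases \<B> E0. F \<subseteq> B'"
proof -
  have sub: "\<phi> ` B \<subseteq> \<phi> ` E" using baseD(1)[OF B] by blast
  have "F \<subseteq> simp_rep ` \<phi> ` B"
  proof
    fix f assume f: "f \<in> F"
    then have "simp_rep (\<phi> f) = f" using rep_E0 assms(3) by blast
    then show "f \<in> simp_rep ` \<phi> ` B" using f assms(2) by force
  qed
  then show ?thesis using rep_base[OF phi_base(1)[OF B] sub] by blast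
qed

lemma completion:
  defines "\<omega>' \<equiv> \<lambda>B. vm_add \<omega> x B - r x"
  shows "projectively_equivalent E \<B> \<omega> \<omega>'"
    "is_completion n (end_of_element E \<B> \<omega>) E \<B> \<omega>' (ends L) (end_bases L) val"
proof -
  \<comment> \<open>The normalising constant \<open>r x\<close> is spread evenly over the
    \<open>n\<close> elements of a base, which turns it into a vector; the division relies on
    \<open>n \<ge> 1\<close>.\<close>
  have "\<omega>' B = vm_add \<omega> (\<lambda>e\<in>E. x e + - r x / real n) B" if "B \<in> \<B>" for B
    unfolding \<omega>'_def vm_add_const[OF that] using n by simp
  then show "projectively_equivalent E \<B> \<omega> \<omega>'"
    unfolding projectively_equivalent_def by (intro bexI[of _ "\<lambda>e\<in>E. x e + - r x / real n"]) auto
  let ?R = "restrict_bases \<B> E0"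
  let ?\<psi> = "end_of_element E \<B> \<omega>"
  have R: "B \<in> ?R \<longleftrightarrow> B \<in> \<B> \<and> B \<subseteq> E0" for B by (simp add: restrict_bases_def)
  have \<psi>: "?\<psi> e = \<phi> e" if "e \<in> E0" for e using end_of_element_eq E0_sub that by blast
  have \<psi>im: "?\<psi> ` B = \<phi> ` B" if "B \<subseteq> E0" for B using \<psi> that by (intro image_cong) auto
  have ex: "\<exists>f\<in>B' - B. insert f (B - {e}) \<in> ?R \<and> insert e (B' - {f}) \<in> ?R \<and>
      \<omega>' B + \<omega>' B' \<le> \<omega>' (insert f (B - {e})) + \<omega>' (insert e (B' - {f}))"
    if B: "B \<in> ?R" "B' \<in> ?R" "e \<in> B - B'" for B B' e
  proof -
    have BB: "B \<in> \<B>" "B' \<in> \<B>" "B \<subseteq> E0" "B' \<subseteq> E0" using B R by auto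
    obtain f where f: "f \<in> B' - B" "insert f (B - {e}) \<in> \<B>" "insert e (B' - {f}) \<in> \<B>"
      "vm_add \<omega> x B + vm_add \<omega> x B' \<le> vm_add \<omega> x (insert f (B - {e})) + vm_add \<omega> x (insert e (B' - {f}))"
      using exchange[OF BB(1,2) B(3), of x] by blast
    moreover have "insert f (B - {e}) \<subseteq> E0" "insert e (B' - {f}) \<subseteq> E0" using BB(3,4) B(3) f(1) by auto
    ultimately show ?thesis unfolding R \<omega>'_def by (intro bexI[of _ f]) auto
  qed
  have "valuated_matroid n E0 ?R \<omega>'"
    unfolding valuated_matroid_def matroid_bases_def
  proof (intro conjI ballI)
    obtain B where "B \<in> \<B>" using bases_nonempty by blast
    then show "?R \<noteq> {}" using ex_base_E0[of B "{}"] by blast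
    show "B \<subseteq> E0" "finite B" "card B = n" if "B \<in> ?R" for B using that baseD R by auto
    fix B B' e assume B: "B \<in> ?R" "B' \<in> ?R" "e \<in> B - B'"
    show "\<exists>f\<in>B' - B. insert f (B - {e}) \<in> ?R" using ex[OF B] by blast
    show "\<exists>f\<in>B' - B. insert f (B - {e}) \<in> ?R \<and> insert e (B' - {f}) \<in> ?R \<and>
      \<omega>' B + \<omega>' B' \<le> \<omega>' (insert f (B - {e})) + \<omega>' (insert e (B' - {f}))" by (rule ex[OF B])
  qed
  moreover have "simple_matroid E0 ?R"
    unfolding simple_matroid_def is_loop_def
  proof (intro conjI ballI impI)
    show "\<not> (\<forall>B\<in>?R. e \<notin> B)" if e: "e \<in> E0" for e
    proof -
      obtain B where B: "B \<in> M x" "e \<in> B" using carrierD(5)[OF x] e E0_sub by blast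
      then show ?thesis using ex_base_E0[OF maximizersD(1)[OF B(1)], of "{e}"] e by blast
    qed
    fix e f assume ef: "e \<in> E0" "f \<in> E0" "e \<noteq> f"
    have efE: "e \<in> E" "f \<in> E" using ef E0_sub by auto
    have "\<phi> f \<noteq> \<phi> e" using ef inj_on_eq_iff[OF inj_phi_E0] by simp
    then have "f \<notin> parallel_class E \<B> e" using phi_eq_iff[OF efE] by simp
    then obtain B where "B \<in> \<B>" "{e, f} \<subseteq> B" using efE(2) not_loop unfolding parallel_class_def by blast
    then show "\<exists>B\<in>?R. {e, f} \<subseteq> B" using ex_base_E0[of B "{e, f}"] ef by blast
  qed
  moreover have "inj_on ?\<psi> E0" using inj_phi_E0 \<psi> by (simp add: inj_on_def)
  moreover have "?\<psi> ` E0 \<subseteq> ends L" unfolding \<psi>im[OF order_refl] phi_E0 using phi_end by blast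
  moreover have "dense_in_valuated_matroid (ends L) (end_bases L) val (?\<psi> ` E0)"
    unfolding \<psi>im[OF order_refl] phi_E0 by (rule dense_phi)
  moreover have "\<forall>B. B \<subseteq> E0 \<longrightarrow> (B \<in> ?R \<longleftrightarrow> ?\<psi> ` B \<in> end_bases L)"
  proof (intro allI impI iffI)
    fix B assume B: "B \<subseteq> E0"
    show "?\<psi> ` B \<in> end_bases L" if "B \<in> ?R" unfolding \<psi>im[OF B] using phi_base(1) that R by blast
    assume "?\<psi> ` B \<in> end_bases L"
    then have "simp_rep ` \<phi> ` B \<in> ?R" using rep_base[of "\<phi> ` B"] B E0_sub \<psi>im[OF B] by auto
    moreover have "simp_rep ` \<phi> ` B = B" using rep_E0 B by (force simp: image_image)
    ultimately show "B \<in> ?R" by simp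
  qed
  moreover have "\<forall>B\<in>?R. \<omega>' B = val (?\<psi> ` B)"
    unfolding R \<omega>'_def using phi_base(2) \<psi>im R by auto
  ultimately have "is_completion_of_simple n ?\<psi> E0 ?R \<omega>' (ends L) (end_bases L) val"
    unfolding is_completion_of_simple_def using complete_ends by blast
  then show "is_completion n ?\<psi> E \<B> \<omega>' (ends L) (end_bases L) val"
    unfolding is_completion_def using simplification_E0 by blast
qed

end

theorem theorem4p25:
  fixes n :: nat and E :: "'a set" and \<B> :: "'a set set" and \<omega> :: "'a set \<Rightarrow> real"
  defines "L \<equiv> vm_lattice E \<B> \<omega>"
  assumes "valuated_matroid n E \<B> \<omega>"
    and "\<forall>B\<in>\<B>. \<omega> B \<in> \<int>"
  shows "uniform_semimodular_lattice L \<and> has_uniform_rank L n \<and>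
    ((\<forall>e\<in>E. \<not> is_loop \<B> e) \<longrightarrow> carrier L \<noteq> {}) \<and>
    (\<forall>x\<in>carrier L. asc L x = (\<lambda>e\<in>E. x e + 1)) \<and>
    height_function L (\<lambda>x. GREATEST m. m \<in> vm_add \<omega> x ` \<B>) \<and>
    (\<forall>x\<in>carrier L. \<forall>y\<in>carrier L.
        x \<sqinter>\<^bsub>L\<^esub> y = (\<lambda>e\<in>E. min (x e) (y e)) \<and>
        x \<squnion>\<^bsub>L\<^esub> y = \<Sqinter>\<^bsub>L\<^esub>{z \<in> carrier L. x \<sqsubseteq>\<^bsub>L\<^esub> z \<and> y \<sqsubseteq>\<^bsub>L\<^esub> z}) \<and>
    (n \<ge> 1 \<longrightarrow>
      (\<forall>x\<in>carrier L. \<exists>\<omega>'. projectively_equivalent E \<B> \<omega> \<omega>' \<and>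
        is_completion n (end_of_element E \<B> \<omega>) E \<B> \<omega>'
          (ends L) (end_bases L) (lattice_valuation L x)))"
proof -
  interpret int_valuated n E \<B> \<omega>
    by unfold_locales (use assms in auto)
  have r: "r = (\<lambda>x. GREATEST m. m \<in> vm_add \<omega> x ` \<B>)" by (rule ext) (rule r_def)
  have "\<exists>\<omega>'. projectively_equivalent E \<B> \<omega> \<omega>' \<and>
        is_completion n (end_of_element E \<B> \<omega>) E \<B> \<omega>'
          (ends L) (end_bases L) (lattice_valuation L x)" if n: "n \<ge> 1" and x: "x \<in> carrier L" for x
  proof -
    interpret int_valuated_point n E \<B> \<omega> x
      by unfold_locales (use n x in \<open>auto simp: L_def\<close>)
    show ?thesis unfolding L_def using completion by blast
  qed
  then show ?thesis
    unfolding L_def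
    using uniform_L uniform_rank_L carrier_nonempty asc_eq height_L[unfolded r] meet_eq join_eq_inf by blast
qed

end
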